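(* Let $m\ge1$ be an integer, let $0=x_0<x_1<\cdots<x_m<x_{m+1}=1$, let $f:(0,1)\times\mathbb{R}\to\mathbb{R}$ be a Carathéodory function, let $\imath_1,\dots,\imath_m:\mathbb{R}\to\mathbb{R}$ be continuous, and let $\Phi$ be the associated functional on $H=H^1_0(0,1)$ (see context), assumed to be of class $C^1$. Assume: (i) $f(x,t)=o(t)$ as $t\to0$, uniformly for a.e. $x\in(0,1)$; (ii) $\imath_j(t)=b_j\,t+h_j(t)$ for $j=1,\dots,m$, where $b=(b_1,\dots,b_m)\in\mathbb{R}^m$ and $h_j(t)=o(t)$ as $t\to0$ for each $j$; (iii) $b\notin B$, where $B\subset\mathbb{R}^m$ is the resonance set defined in the context. Let $m_0$ be the Morse index of the functional $\Phi_b$ at its (nondegenerate) critical point $0$ (see context). Then, with homology coefficients in the coefficient group $\mathcal{G}$, $$C_q(\Phi,0)\cong\begin{cases}\mathcal{G},&q=m_0,\\0,&q\ne m_0,\end{cases}\qquad q\ge0.$$ In particular, $C_q(\Phi,0)=0$ for all $q>m$.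
   Context: $H=H^1_0(0,1)$ has inner product $(u,v)=\int_0^1u'v'$; its elements are identified with continuous functions on $[0,1]$. The functional is $$\Phi(u)=\frac12\int_0^1(u')^2-\int_0^1F(x,u)-\sum_{j=1}^mI_j(u(x_j)),\quad F(x,t)=\int_0^tf(x,s)\,ds,\quad I_j(t)=\int_0^t\imath_j(s)\,ds .$$ "$f(x,t)=o(t)$ as $t\to0$ uniformly a.e." means: for every $\varepsilon>0$ there is $\delta>0$ such that $|f(x,t)|\le\varepsilon|t|$ for a.e. $x$ and all $|t|\le\delta$ (in particular $f(\cdot,0)=0$ a.e.); similarly for $h_j$ (so $\imath_j(0)=0$). Hence $0$ is a critical point of $\Phi$. Resonance set: $B$ is the set of $b=(b_1,\dots,b_m)\in\mathbb{R}^m$ for which the problem $$-u''=0\text{ on }(0,1)\setminus\{x_1,\dots,x_m\},\quad u(0)=u(1)=0,\quad u(x_j^+)=u(x_j^-),\quad u'(x_j^+)=u'(x_j^-)-b_j\,u(x_j),\ j=1,\dots,m,$$ has a nontrivial solution ($\pm$ denote right/left limits). $M\subset H$ is the $m$-dimensional subspace of continuous functions on $[0,1]$ that vanish at $0$ and $1$ and are affine on each $[x_{j-1},x_j]$, $j=1,\dots,m+1$. The functional $\Phi_b:M\to\mathbb{R}$ is $$\Phi_b(w)=\frac12\Big[\int_0^1(w')^2-\sum_{j=1}^mb_j\,w(x_j)^2\Big].$$ Its Morse index $m_0$ at $0$ is the maximal dimension of a subspace of $M$ on which this quadratic form is negative definite; $0\le m_0\le m$. Critical groups: for a functional $\Psi$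 with critical point $0$ and $\Psi(0)=0$, $C_q(\Psi,0)=H_q(\Psi^0\cap U,\ \Psi^0\cap U\setminus\{0\})$, $q\ge0$, where $\Psi^0=\{u:\Psi(u)\le0\}$, $U$ is any neighborhood of $0$, and $H_*(\cdot,\cdot)$ is relative singular homology with coefficients in a fixed abelian group $\mathcal{G}$. *)

theory Defs
  imports "HOL-Analysis.Analysis" "HOL-Homology.Homology"
begin

subsection \<open>The space $H^1_0(0,1)$\<close>

abbreviation unit_ival :: "real measure"
  where "unit_ival \<equiv> lebesgue_on {0<..<1}"

definition C1_test :: "(real \<Rightarrow> real) \<Rightarrow> (real \<Rightarrow> real) \<Rightarrow> bool"
  where "C1_test \<phi> \<phi>' \<longleftrightarrow>
    (\<forall>t. (\<phi> has_real_derivative \<phi>' t) (at t)) \<and> continuous_on UNIV \<phi>' \<and>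
    (\<exists>c d. 0 < c \<and> d < 1 \<and> (\<forall>t. t \<notin> {c..d} \<longrightarrow> \<phi> t = 0))"

text \<open>\<open>g\<close> is the distributional derivative of \<open>u\<close> on $(0,1)$ and lies in $L^2(0,1)$. The tests
  \<open>C1_test\<close> are the $C^1$ functions with compact support in $(0,1)$.\<close>

definition weak_L2_deriv :: "(real \<Rightarrow> real) \<Rightarrow> (real \<Rightarrow> real) \<Rightarrow> bool"
  where "weak_L2_deriv u g \<longleftrightarrow>
    g \<in> borel_measurable unit_ival \<and> integrable unit_ival (\<lambda>t. (g t)\<^sup>2) \<and>
    (\<forall>\<phi> \<phi>'. C1_test \<phi> \<phi>' \<longrightarrow>
      (LINT t|unit_ival. u t * \<phi>' t) = - (LINT t|unit_ival. g t * \<phi> t))"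

lemma integrable_unit_ival_cont:
  fixes f :: "real \<Rightarrow> real"
  assumes "continuous_on {0..1} f"
  shows "integrable unit_ival f"
proof -
  have "integrable (lebesgue_on {0..1}) f"
    by (rule continuous_imp_integrable_real[OF assms])
  then have "set_integrable lebesgue {0..1} f"
    by (simp add: integrable_restrict_space set_integrable_def)
  then have "set_integrable lebesgue {0<..<1} f"
    by (rule set_integrable_subset) auto
  then show ?thesis
    by (simp add: integrable_restrict_space set_integrable_def)
qed

lemma finite_measure_unit_ival: "finite_measure unit_ival"
  by (rule finite_measureI) (simp add: emeasure_restrict_space)

lemma integrable_L2_prod:
  fixes f g :: "real \<Rightarrow> real"
  assumes [measurable]: "f \<in> borel_measurable M" "g \<in> borel_measurable M"
    and "integrable M (\<lambda>t. (f t)\<^sup>2)" "integrable M (\<lambda>t. (g t)\<^sup>2)"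
  shows "integrable M (\<lambda>t. f t * g t)"
proof (rule Bochner_Integration.integrable_bound)
  show "integrable M (\<lambda>t. (f t)\<^sup>2 + (g t)\<^sup>2)"
    using assms by (intro Bochner_Integration.integrable_add)
  have "\<bar>a * b\<bar> \<le> a\<^sup>2 + b\<^sup>2" for a b :: real
  proof -
    have "2 * \<bar>a\<bar> * \<bar>b\<bar> \<le> a\<^sup>2 + b\<^sup>2" using sum_squares_bound[of "\<bar>a\<bar>" "\<bar>b\<bar>"] by simp
    moreover have "0 \<le> \<bar>a\<bar> * \<bar>b\<bar>" by simp
    ultimately show ?thesis unfolding abs_mult by linarith
  qed
  then show "AE t in M. norm (f t * g t) \<le> norm ((f t)\<^sup>2 + (g t)\<^sup>2)"
    by simp
qed measurable

lemma weak_L2_deriv_integrable: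
  assumes "weak_L2_deriv u g"
  shows "integrable unit_ival g"
proof -
  interpret finite_measure unit_ival by (rule finite_measure_unit_ival)
  have "integrable unit_ival (\<lambda>t. g t * 1)"
    using assms by (intro integrable_L2_prod) (auto simp: weak_L2_deriv_def)
  then show ?thesis by simp
qed

lemma C1_test_cont:
  assumes "C1_test \<phi> \<phi>'"
  shows "continuous_on S \<phi>" "continuous_on S \<phi>'"
  using assms unfolding C1_test_def
  by (meson DERIV_isCont continuous_at_imp_continuous_on,
      meson continuous_on_subset subset_UNIV)

lemma C1_test_bounded:
  assumes "C1_test \<phi> \<phi>'"
  obtains B where "\<And>t. \<bar>\<phi> t\<bar> \<le> B"
proof -
  obtain c d where cd: "\<forall>t. t \<notin> {c..d} \<longrightarrow> \<phi> t = 0"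
    using assms by (auto simp: C1_test_def)
  have "bounded (\<phi> ` {c..d})"
    by (intro compact_imp_bounded compact_continuous_image C1_test_cont(1)[OF assms]) auto
  then obtain B where B: "\<forall>t\<in>{c..d}. \<bar>\<phi> t\<bar> \<le> B"
    by (auto simp: bounded_iff)
  have "\<bar>\<phi> t\<bar> \<le> max B 0" for t
    using bspec[OF B, of t] cd by (cases "t \<in> {c..d}") auto
  then show ?thesis by (rule that)
qed

lemma weak_L2_deriv_integrable_test:
  assumes "integrable unit_ival g" "C1_test \<phi> \<phi>'"
  shows "integrable unit_ival (\<lambda>t. g t * \<phi> t)"
proof -
  obtain B where B: "\<And>t. \<bar>\<phi> t\<bar> \<le> B" by (rule C1_test_bounded[OF assms(2)]) blast
  have [measurable]: "\<phi> \<in> borel_measurable unit_ival"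
    by (intro continuous_imp_measurable_on_sets_lebesgue C1_test_cont(1)[OF assms(2)]) auto
  have [measurable]: "g \<in> borel_measurable unit_ival" using assms(1) by simp
  show ?thesis
  proof (rule Bochner_Integration.integrable_bound)
    show "integrable unit_ival (\<lambda>t. B * g t)" using assms(1) by simp
    show "AE t in unit_ival. norm (g t * \<phi> t) \<le> norm (B * g t)"
    proof (rule AE_I2)
      fix t
      have "\<bar>g t\<bar> * \<bar>\<phi> t\<bar> \<le> \<bar>g t\<bar> * \<bar>B\<bar>"
        using B[of t] by (intro mult_left_mono) auto
      then show "norm (g t * \<phi> t) \<le> norm (B * g t)" by (simp add: abs_mult mult.commute)
    qed
  qed measurable
qed

text \<open>\<open>ramp\<close> is a $C^1$ step from 0 to 1 with derivative \<open>tent\<close>; rescaled, it yields tests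
  approximating indicator functions of intervals.\<close>

definition ramp :: "real \<Rightarrow> real"
  where "ramp y = 2 * ((max 0 y)\<^sup>2 - 2 * (max 0 (y - 1/2))\<^sup>2 + (max 0 (y - 1))\<^sup>2)"
definition tent :: "real \<Rightarrow> real"
  where "tent y = 4 * (max 0 y - 2 * max 0 (y - 1/2) + max 0 (y - 1))"

lemma has_deriv_pos_part_sq:
  "((\<lambda>y. (max 0 (y - c))\<^sup>2) has_real_derivative 2 * max 0 (y - c)) (at y)" for c y :: real
proof (cases y c rule: linorder_cases)
  case less
  have "((\<lambda>y. 0) has_real_derivative 0) (at y)" by simp
  then have "((\<lambda>y. (max 0 (y - c))\<^sup>2) has_real_derivative 0) (at y)"
    by (rule has_field_derivative_transform_within_open[where S="{..<c}"]) (use less in auto)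
  with less show ?thesis by simp
next
  case greater
  have "((\<lambda>y. (y - c)\<^sup>2) has_real_derivative 2 * (y - c)) (at y)"
    by (auto intro!: derivative_eq_intros)
  then have "((\<lambda>y. (max 0 (y - c))\<^sup>2) has_real_derivative 2 * (y - c)) (at y)"
    by (rule has_field_derivative_transform_within_open[where S="{c<..}"]) (use greater in auto)
  with greater show ?thesis by simp
next
  case equal
  have "((\<lambda>h. ((max 0 h)\<^sup>2) / h) \<longlongrightarrow> 0) (at (0::real))"
  proof (rule Lim_null_comparison)
    show "\<forall>\<^sub>F h in at (0::real). norm ((max 0 h)\<^sup>2 / h) \<le> \<bar>h\<bar>"
      by (intro always_eventually allI) (auto simp: max_def power2_eq_square)
    show "((\<lambda>h::real. \<bar>h\<bar>) \<longlongrightarrow> 0) (at 0)"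
      by (auto intro!: tendsto_eq_intros)
  qed
  then show ?thesis using equal by (simp add: DERIV_def)
qed

lemma ramp_deriv: "(ramp has_real_derivative tent y) (at y)"
proof -
  have "((\<lambda>y. 2 * ((max 0 (y - 0))\<^sup>2 - 2 * (max 0 (y - 1/2))\<^sup>2 + (max 0 (y - 1))\<^sup>2)) has_real_derivative
      2 * (2 * max 0 (y - 0) - 2 * (2 * max 0 (y - 1/2)) + 2 * max 0 (y - 1))) (at y)"
    by (intro DERIV_cmult DERIV_add DERIV_diff has_deriv_pos_part_sq)
  then show ?thesis
    by (simp add: ramp_def[abs_def] tent_def algebra_simps)
qed

lemma tent_props: "continuous_on S tent" "tent y \<ge> 0" "y \<notin> {0..1} \<Longrightarrow> tent y = 0"
  unfolding tent_def by (intro continuous_intros) (auto simp: max_def)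

lemma ramp_props: "y \<le> 0 \<Longrightarrow> ramp y = 0" "y \<ge> 1 \<Longrightarrow> ramp y = 1"
  unfolding ramp_def by (auto simp: max_def power2_eq_square algebra_simps)

lemma ramp_mono: "mono ramp"
  by (rule monoI, rule DERIV_nonneg_imp_nondecreasing) (use ramp_deriv tent_props(2) in blast)+

lemma ramp_bounds: "0 \<le> ramp y" "ramp y \<le> 1"
  using monoD[OF ramp_mono, of 0 y] monoD[OF ramp_mono, of y 0]
    monoD[OF ramp_mono, of 1 y] monoD[OF ramp_mono, of y 1] ramp_props[of y] ramp_props[of 0] ramp_props[of 1]
  by linarith+

lemma kernel_limit:
  fixes u :: "real \<Rightarrow> real"
  assumes u: "continuous_on {0..1} u" and a: "0 < a" "a < 1"
  shows "(\<lambda>n. LINT t|unit_ival. u t * (real n * tent (real n * (t - a)))) \<longlonglongrightarrow> u a"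
proof (rule LIMSEQ_I)
  fix r :: real assume r: "r > 0"
  obtain d where d: "d > 0" "\<And>t. t \<in> {0..1} \<Longrightarrow> \<bar>t - a\<bar> < d \<Longrightarrow> \<bar>u t - u a\<bar> < r/2"
    using u a r unfolding continuous_on_iff dist_real_def
    by (metis atLeastAtMost_iff half_gt_zero less_eq_real_def)
  define e where "e = min d (1 - a)"
  have e: "e > 0" using d a by (simp add: e_def)
  obtain N :: nat where N: "N > 0" "1 / real N < e"
    using e real_arch_inverse[of e] by (auto simp: inverse_eq_divide)
  have "norm ((LINT t|unit_ival. u t * (real n * tent (real n * (t - a)))) - u a) < r" if n: "n \<ge> N" for n
  proof -
    have n0: "real n > 0" "1 / real n < e"
      using N n by (auto intro: le_less_trans[OF _ N(2)] simp: frac_le)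
    let ?w = "\<lambda>t. real n * tent (real n * (t - a))"
    have cw: "continuous_on S ?w" for S
      by (intro continuous_intros continuous_on_compose2[OF tent_props(1)]) auto
    have w0: "?w t = 0" if "t \<in> {0..1}" "\<bar>t - a\<bar> \<ge> d" for t
    proof -
      have "real n * (t - a) \<notin> {0..1}"
      proof
        assume "real n * (t - a) \<in> {0..1}"
        then have "0 \<le> t - a" "t - a \<le> 1 / real n"
          using n0 by (auto simp: zero_le_mult_iff field_simps)
        then show False using that n0 by (auto simp: e_def)
      qed
      then show ?thesis using tent_props(3) by simp
    qed
    have wnn: "?w t \<ge> 0" for t using tent_props(2) n0 by simp
    have iw: "integrable unit_ival ?w"
      by (intro integrable_unit_ival_cont cw)
    have "(?w has_integral (ramp (real n * (1 - a)) - ramp (real n * (0 - a)))) {0..1}"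
    proof (rule fundamental_theorem_of_calculus)
      fix t :: real
      have "((\<lambda>t. ramp (real n * (t - a))) has_real_derivative tent (real n * (t - a)) * real n) (at t)"
        by (rule DERIV_chain2[OF ramp_deriv]) (auto intro!: derivative_eq_intros)
      then show "((\<lambda>t. ramp (real n * (t - a))) has_vector_derivative ?w t) (at t within {0..1})"
        by (auto simp: has_real_derivative_iff_has_vector_derivative mult.commute
            intro: has_vector_derivative_at_within)
    qed simp
    moreover have "ramp (real n * (1 - a)) = 1"
      using n0 by (intro ramp_props) (auto simp: e_def field_simps)
    moreover have "ramp (real n * (0 - a)) = 0"
      using n0 a by (intro ramp_props) (auto simp: mult_le_0_iff)
    ultimately have "(?w has_integral 1) {0..1}" by simp
    then have "(?w has_integral 1) {0<..<1}"
      using has_integral_Icc_iff_Ioo by blast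
    moreover have "(?w has_integral (LINT t|unit_ival. ?w t)) {0<..<1}"
      by (rule has_integral_integral_lebesgue_on[OF iw]) simp
    ultimately have w1: "(LINT t|unit_ival. ?w t) = 1"
      using has_integral_unique by blast
    have iuw: "integrable unit_ival (\<lambda>t. u t * ?w t)"
      by (intro integrable_unit_ival_cont continuous_on_mult u cw)
    have "(LINT t|unit_ival. u t * ?w t) - u a = (LINT t|unit_ival. u t * ?w t - u a * ?w t)"
      using iw iuw w1 by (subst Bochner_Integration.integral_diff) auto
    also have "norm \<dots> \<le> (LINT t|unit_ival. r/2 * ?w t)"
    proof (rule Bochner_Integration.integral_norm_bound_integral)
      show "integrable unit_ival (\<lambda>t. u t * ?w t - u a * ?w t)"
        using iw iuw by (intro Bochner_Integration.integrable_diff) auto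
      show "integrable unit_ival (\<lambda>t. r/2 * ?w t)" using iw by simp
      fix t assume "t \<in> space unit_ival"
      then have t: "t \<in> {0..1}" by simp
      have "norm (u t * ?w t - u a * ?w t) = \<bar>u t - u a\<bar> * ?w t"
        using tent_props(2) by (simp add: left_diff_distrib[symmetric] abs_mult)
      also have "\<dots> \<le> r/2 * ?w t"
      proof (cases "\<bar>t - a\<bar> < d")
        case True
        then show ?thesis using d(2)[OF t] wnn[of t] by (intro mult_right_mono) auto
      next
        case False
        then show ?thesis using w0[OF t] by auto
      qed
      finally show "norm (u t * ?w t - u a * ?w t) \<le> r/2 * ?w t" .
    qed
    also have "\<dots> = r/2" using w1 by (simp only: integral_mult_right_zero)
    finally show ?thesis using r by simp
  qed
  then show "\<exists>no. \<forall>n\<ge>no. norm ((LINT t|unit_ival. u t * (real n * tent (real n * (t - a)))) - u a) < r"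
    by blast
qed

lemma ramp_limit: "(\<lambda>n. ramp (real n * (t - a))) \<longlonglongrightarrow> indicator {a<..} t"
proof (cases "t \<le> a")
  case True
  then have "ramp (real n * (t - a)) = 0" for n by (intro ramp_props) (auto simp: mult_le_0_iff)
  with True show ?thesis by simp
next
  case False
  obtain N :: nat where "real N > 1 / (t - a)" using reals_Archimedean2 by blast
  then have "ramp (real n * (t - a)) = 1" if "n \<ge> N" for n
  proof -
    have "1 / (t - a) \<le> real n" using that \<open>real N > 1 / (t - a)\<close> by simp
    then show ?thesis using False by (intro ramp_props) (auto simp: field_simps)
  qed
  then have "\<forall>\<^sub>F n in sequentially. ramp (real n * (t - a)) = 1"
    by (auto simp: eventually_sequentially)
  then have "(\<lambda>n. ramp (real n * (t - a))) \<longlonglongrightarrow> 1" by (rule tendsto_eventually)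
  with False show ?thesis by simp
qed

lemma weak_L2_deriv_FTC:
  assumes u: "continuous_on {0..1} u" and w: "weak_L2_deriv u g" and ab: "0 < a" "a < b" "b < 1"
  shows "u b - u a = (LINT t|unit_ival. g t * indicator {a<..b} t)"
proof -
  let ?\<phi> = "\<lambda>n t. ramp (real n * (t - a)) - ramp (real n * (t - b))"
  let ?\<phi>' = "\<lambda>n t. real n * tent (real n * (t - a)) - real n * tent (real n * (t - b))"
  have ig: "integrable unit_ival g" by (rule weak_L2_deriv_integrable[OF w])
  then have [measurable]: "g \<in> borel_measurable unit_ival" by simp
  have [measurable]: "ramp \<in> borel_measurable borel" 
    using ramp_deriv by (intro borel_measurable_continuous_onI continuous_at_imp_continuous_on)
       (blast intro: DERIV_isCont)
  obtain N :: nat where N: "N > 0" "1 / real N < 1 - b"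
    using ab real_arch_inverse[of "1 - b"] by (auto simp: inverse_eq_divide)
  have test: "C1_test (?\<phi> n) (?\<phi>' n)" if n: "n \<ge> N" for n
    unfolding C1_test_def
  proof (intro conjI allI exI impI)
    have n0: "real n > 0" "1 / real n < 1 - b"
      using N n by (auto intro: le_less_trans[OF _ N(2)] simp: frac_le)
    show "0 < a" by fact
    show "b + 1 / real n < 1" using n0 by simp
    show "continuous_on UNIV (?\<phi>' n)"
      by (intro continuous_intros continuous_on_compose2[OF tent_props(1)]) auto
    have *: "((\<lambda>t. ramp (real n * (t - c))) has_real_derivative tent (real n * (t - c)) * real n) (at t)" for c t
        by (rule DERIV_chain2[OF ramp_deriv]) (auto intro!: derivative_eq_intros)
    show "((?\<phi> n) has_real_derivative ?\<phi>' n t) (at t)" for t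
      by (intro DERIV_diff) (use * in \<open>simp_all add: mult.commute\<close>)
    fix t assume t: "t \<notin> {a..b + 1 / real n}"
    show "?\<phi> n t = 0"
    proof (cases "t < a")
      case True
      then have "ramp (real n * (t - a)) = 0" "ramp (real n * (t - b)) = 0"
        using ab n0 by (auto intro!: ramp_props simp: mult_le_0_iff)
      then show ?thesis by simp
    next
      case False
      then have "t - b \<ge> 1 / real n" "t - a \<ge> 1 / real n" using t ab by auto
      then have "ramp (real n * (t - a)) = 1" "ramp (real n * (t - b)) = 1"
        using n0 by (auto intro!: ramp_props simp: field_simps)
      then show ?thesis by simp
    qed
  qed
  have "(\<lambda>n. (LINT t|unit_ival. u t * (real n * tent (real n * (t - a)))) -
      (LINT t|unit_ival. u t * (real n * tent (real n * (t - b))))) \<longlonglongrightarrow> u a - u b"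
    using ab by (intro tendsto_diff kernel_limit u) auto
  moreover have "(LINT t|unit_ival. u t * (real n * tent (real n * (t - a)))) -
      (LINT t|unit_ival. u t * (real n * tent (real n * (t - b)))) = (LINT t|unit_ival. u t * ?\<phi>' n t)" for n
  proof -
    have "integrable unit_ival (\<lambda>t. u t * (real n * tent (real n * (t - c))))" for c
      by (intro integrable_unit_ival_cont continuous_intros u continuous_on_compose2[OF tent_props(1)]) auto
    then show ?thesis
      by (subst Bochner_Integration.integral_diff[symmetric]) (auto simp: right_diff_distrib)
  qed
  ultimately have lim1: "(\<lambda>n. LINT t|unit_ival. u t * ?\<phi>' n t) \<longlonglongrightarrow> u a - u b" by simp
  have lim2: "(\<lambda>n. LINT t|unit_ival. g t * ?\<phi> n t) \<longlonglongrightarrow> (LINT t|unit_ival. g t * indicator {a<..b} t)"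
  proof (rule integral_dominated_convergence)
    show "(\<lambda>t. g t * indicator {a<..b} t) \<in> borel_measurable unit_ival"
      using ab by (intro borel_measurable_times borel_measurable_indicator) (auto simp: sets_restrict_space intro!: image_eqI[where x="{a<..b}"] )
    show "(\<lambda>t. g t * ?\<phi> n t) \<in> borel_measurable unit_ival" for n
      by (intro borel_measurable_times) (auto intro!: measurable_restrict_space1 measurable_completion)
    show "integrable unit_ival (\<lambda>t. \<bar>g t\<bar>)" using ig by simp
    show "AE t in unit_ival. (\<lambda>n. g t * ?\<phi> n t) \<longlonglongrightarrow> g t * indicator {a<..b} t"
    proof (rule AE_I2)
      fix t
      have "(\<lambda>n. ?\<phi> n t) \<longlonglongrightarrow> indicator {a<..} t - indicator {b<..} t"
        by (intro tendsto_diff ramp_limit)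
      moreover have "indicator {a<..} t - indicator {b<..} t = (indicator {a<..b} t :: real)"
        using ab by (auto simp: indicator_def)
      ultimately show "(\<lambda>n. g t * ?\<phi> n t) \<longlonglongrightarrow> g t * indicator {a<..b} t"
        by (intro tendsto_mult) auto
    qed
    show "AE t in unit_ival. norm (g t * ?\<phi> n t) \<le> \<bar>g t\<bar>" for n
    proof (rule AE_I2)
      fix t
      have "\<bar>?\<phi> n t\<bar> \<le> 1"
        using ramp_bounds[of "real n * (t - a)"] ramp_bounds[of "real n * (t - b)"] by linarith
      then show "norm (g t * ?\<phi> n t) \<le> \<bar>g t\<bar>"
        by (simp add: abs_mult mult_left_le)
    qed
  qed
  have "\<forall>\<^sub>F n in sequentially. (LINT t|unit_ival. u t * ?\<phi>' n t) = - (LINT t|unit_ival. g t * ?\<phi> n t)"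
    using test w unfolding weak_L2_deriv_def eventually_sequentially by blast
  then have "(\<lambda>n. - (LINT t|unit_ival. g t * ?\<phi> n t)) \<longlonglongrightarrow> u a - u b"
    using lim1 by (rule Lim_transform_eventually[rotated])
  moreover have "(\<lambda>n. - (LINT t|unit_ival. g t * ?\<phi> n t)) \<longlonglongrightarrow> - (LINT t|unit_ival. g t * indicator {a<..b} t)"
    by (intro tendsto_minus lim2)
  ultimately have "u a - u b = - (LINT t|unit_ival. g t * indicator {a<..b} t)"
    by (rule LIMSEQ_unique)
  then show ?thesis by simp
qed

lemma weak_L2_deriv_zero_AE:
  assumes w: "weak_L2_deriv (\<lambda>_. 0) k"
  shows "AE t in unit_ival. k t = 0"
proof -
  have ik: "integrable unit_ival k" by (rule weak_L2_deriv_integrable[OF w])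
  define f where "f = (\<lambda>t. if t \<in> {0<..<1} then k t else 0)"
  have f_eq: "f t = indicator {0<..<1} t *\<^sub>R k t" for t by (simp add: f_def indicator_def)
  have fi: "integrable lebesgue f"
    using ik by (simp add: integrable_restrict_space f_eq[abs_def])
  then have "f \<in> borel_measurable lebesgue" by simp
  then obtain f' where f'[measurable]: "f' \<in> borel_measurable lborel" and ff': "AE t in lborel. f t = f' t"
    using completion_ex_borel_measurable_real[of f lborel] by auto
  have AEl: "AE t in lebesgue. f t = f' t" using ff' by (simp add: AE_completion)
  have "integrable lebesgue f'"
    by (rule integrable_cong_AE_imp[OF fi]) (use AEl f' in \<open>auto intro: measurable_completion\<close>)
  then have f'i: "integrable lborel f'" by (simp add: integrable_completion)
  have ind0: "(LINT t|lborel. f' t * indicator {c<..d} t) = 0" if "0 < c" "c < d" "d < 1" for c d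
  proof -
    have "(LINT t|lborel. f' t * indicator {c<..d} t) = (LINT t|lebesgue. f' t * indicator {c<..d} t)"
      by (simp add: integral_completion)
    also have "\<dots> = (LINT t|lebesgue. f t * indicator {c<..d} t)"
      using AEl f' fi by (intro integral_cong_AE) (auto intro!: borel_measurable_times intro: measurable_completion)
    also have "\<dots> = (LINT t|unit_ival. k t * indicator {c<..d} t)"
      by (simp add: integral_restrict_space f_eq mult.assoc)
    also have "\<dots> = 0"
      using weak_L2_deriv_FTC[OF _ w that] by simp
    finally show ?thesis .
  qed
  have tail0: "(LINT t|lborel. f' t * indicator {x<..} t) = 0" for x
  proof -
    let ?c = "\<lambda>n. max x (1 / (real n + 3))" and ?d = "\<lambda>n. 1 - 1 / (real n + 3)"
    have "(\<lambda>n. LINT t|lborel. f' t * indicator {?c n<..?d n} t) \<longlonglongrightarrow> (LINT t|lborel. f' t * indicator {x<..} t)"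
    proof (rule integral_dominated_convergence)
      show "integrable lborel (\<lambda>t. \<bar>f' t\<bar>)" using f'i by simp
      show "AE t in lborel. norm (f' t * indicator {?c n<..?d n} t) \<le> \<bar>f' t\<bar>" for n
        by (auto simp: indicator_def)
      show "AE t in lborel. (\<lambda>n. f' t * indicator {?c n<..?d n} t) \<longlonglongrightarrow> f' t * indicator {x<..} t"
        using ff'
      proof eventually_elim
        case (elim t)
        show ?case
        proof (cases "t \<in> {0<..<1} \<and> x < t")
          case False
          then have "f' t * indicator {?c n<..?d n} t = f' t * indicator {x<..} t" for n
          proof (cases "t \<in> {0<..<1}")
            case True
            then show ?thesis using False by (auto simp: indicator_def)
          next
            case False
            then have "f' t = 0" using elim by (auto simp: f_def split: if_splits)
            then show ?thesis by simp
          qed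
          then show ?thesis by (simp only: tendsto_const)
        next
          case True
          obtain N :: nat where N: "1 / min t (1 - t) < real N" using reals_Archimedean2 by blast
          have "t \<in> {?c n<..?d n}" if "n \<ge> N" for n
          proof -
            have "1 / min t (1 - t) < real n + 3" using N that by linarith
            then have "1 < min t (1 - t) * (real n + 3)" using True by (simp add: field_simps)
            moreover have "min t (1 - t) * (real n + 3) \<le> t * (real n + 3)"
                "min t (1 - t) * (real n + 3) \<le> (1 - t) * (real n + 3)"
              by (intro mult_right_mono; simp)+
            ultimately have "1 < t * (real n + 3)" "1 < (1 - t) * (real n + 3)" by linarith+
            then have "1 / (real n + 3) < t" "1 / (real n + 3) < 1 - t"
              by (simp_all add: divide_less_eq)
            then show ?thesis using True by auto
          qed
          then have "\<forall>\<^sub>F n in sequentially. f' t * indicator {?c n<..?d n} t = f' t * indicator {x<..} t"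
            using True unfolding eventually_sequentially by (intro exI[of _ N]) auto
          then show ?thesis by (rule tendsto_eventually)
        qed
      qed
    qed measurable
    moreover have "(LINT t|lborel. f' t * indicator {?c n<..?d n} t) = 0" for n
    proof (cases "?c n < ?d n")
      case True
      moreover have "0 < ?c n" by (simp add: less_max_iff_disj)
      ultimately show ?thesis by (intro ind0) auto
    qed simp
    ultimately show ?thesis using LIMSEQ_unique[OF _ tendsto_const] by simp
  qed
  let ?P = "density lborel (\<lambda>t. ennreal (max 0 (f' t)))"
  let ?N = "density lborel (\<lambda>t. ennreal (max 0 (- f' t)))"
  have em: "emeasure (density lborel (\<lambda>t. ennreal (g t))) {x<..} = ennreal (LINT t|lborel. g t * indicator {x<..} t)"
    if "integrable lborel g" "\<And>t. g t \<ge> 0" for g :: "real \<Rightarrow> real" and x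
  proof -
    have "g \<in> borel_measurable lborel" using that by simp
    then have "emeasure (density lborel (\<lambda>t. ennreal (g t))) {x<..} = (\<integral>\<^sup>+t. ennreal (g t * indicator {x<..} t) \<partial>lborel)"
      by (subst emeasure_density) (auto intro!: nn_integral_cong simp: indicator_def)
    also have "\<dots> = ennreal (LINT t|lborel. g t * indicator {x<..} t)"
      using that by (intro nn_integral_eq_integral) (auto intro: integrable_real_mult_indicator)
    finally show ?thesis .
  qed
  have ip: "integrable lborel (\<lambda>t. max 0 (f' t))" "integrable lborel (\<lambda>t. max 0 (- f' t))"
    using f'i by (auto intro!: integrable_max)
  have "?P = ?N"
  proof (rule measure_eqI_lessThan)
    fix x
    show "emeasure ?P {x<..} < \<infinity>" by (subst em) (use ip in auto)
    have i: "integrable lborel (\<lambda>t. max 0 (f' t) * indicator {x<..} t)"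
        "integrable lborel (\<lambda>t. max 0 (- f' t) * indicator {x<..} t)"
      by (rule integrable_real_mult_indicator[OF _ ip(1)], simp)
         (rule integrable_real_mult_indicator[OF _ ip(2)], simp)
    have "(LINT t|lborel. max 0 (f' t) * indicator {x<..} t) - (LINT t|lborel. max 0 (- f' t) * indicator {x<..} t)
      = (LINT t|lborel. max 0 (f' t) * indicator {x<..} t - max 0 (- f' t) * indicator {x<..} t)"
      by (rule Bochner_Integration.integral_diff[OF i, symmetric])
    also have "\<dots> = (LINT t|lborel. f' t * indicator {x<..} t)"
      by (intro Bochner_Integration.integral_cong) (auto simp: indicator_def max_def)
    finally have "(LINT t|lborel. max 0 (f' t) * indicator {x<..} t) = (LINT t|lborel. max 0 (- f' t) * indicator {x<..} t)"
      using tail0[of x] by simp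
    then show "emeasure ?P {x<..} = emeasure ?N {x<..}"
      using ip by (simp add: em)
  qed auto
  then have "AE t in lborel. ennreal (max 0 (f' t)) = ennreal (max 0 (- f' t))"
    by (intro sigma_finite_measure.density_unique[OF lborel.sigma_finite_measure_axioms]) auto
  then have "AE t in lborel. f' t = 0"
    by eventually_elim (auto simp: max_def split: if_splits)
  with ff' have "AE t in lborel. f t = 0" by eventually_elim simp
  then have "AE t in lebesgue. f t = 0" by (rule AE_completion)
  then show ?thesis
    by (subst AE_restrict_space_iff) (auto simp: f_def)
qed

lemma weak_L2_deriv_add:
  assumes u: "continuous_on {0..1} u" "weak_L2_deriv u g"
    and v: "continuous_on {0..1} v" "weak_L2_deriv v k"
  shows "weak_L2_deriv (\<lambda>t. u t + v t) (\<lambda>t. g t + k t)"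
  unfolding weak_L2_deriv_def
proof (intro conjI allI impI)
  have [measurable]: "g \<in> borel_measurable unit_ival" "k \<in> borel_measurable unit_ival"
    using u v by (auto simp: weak_L2_deriv_def)
  show "(\<lambda>t. g t + k t) \<in> borel_measurable unit_ival" by measurable
  have "integrable unit_ival (\<lambda>t. (g t)\<^sup>2 + (k t)\<^sup>2 + 2 * (g t * k t))"
    using u v integrable_L2_prod[of g unit_ival k]
    by (intro Bochner_Integration.integrable_add) (auto simp: weak_L2_deriv_def)
  then show "integrable unit_ival (\<lambda>t. (g t + k t)\<^sup>2)"
    by (simp add: power2_sum mult.assoc)
  fix \<phi> \<phi>' assume \<phi>: "C1_test \<phi> \<phi>'"
  have "integrable unit_ival (\<lambda>t. u t * \<phi>' t)" "integrable unit_ival (\<lambda>t. v t * \<phi>' t)"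
    by (intro integrable_unit_ival_cont continuous_on_mult u v C1_test_cont(2)[OF \<phi>])+
  moreover have "integrable unit_ival (\<lambda>t. g t * \<phi> t)" "integrable unit_ival (\<lambda>t. k t * \<phi> t)"
    by (intro weak_L2_deriv_integrable_test[OF _ \<phi>] weak_L2_deriv_integrable[OF u(2)]
        weak_L2_deriv_integrable[OF v(2)])+
  ultimately show "(LINT t|unit_ival. (u t + v t) * \<phi>' t) = - (LINT t|unit_ival. (g t + k t) * \<phi> t)"
    using u(2) v(2) \<phi> by (simp add: weak_L2_deriv_def distrib_right)
qed

lemma weak_L2_deriv_scale:
  assumes "weak_L2_deriv u g"
  shows "weak_L2_deriv (\<lambda>t. r * u t) (\<lambda>t. r * g t)"
  using assms by (auto simp: weak_L2_deriv_def power_mult_distrib mult.assoc)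

lemma weak_L2_deriv_unique_AE:
  assumes "continuous_on {0..1} u" "weak_L2_deriv u g" "weak_L2_deriv u k"
  shows "AE t in unit_ival. g t = k t"
proof -
  have "continuous_on {0..1} (\<lambda>t. - 1 * u t)"
    using assms(1) by (intro continuous_intros)
  then have "weak_L2_deriv (\<lambda>t. u t + - 1 * u t) (\<lambda>t. g t + - 1 * k t)"
    using assms by (intro weak_L2_deriv_add weak_L2_deriv_scale)
  then have "weak_L2_deriv (\<lambda>_. 0) (\<lambda>t. g t + - 1 * k t)" by simp
  from weak_L2_deriv_zero_AE[OF this] show ?thesis by simp
qed

text \<open>An element of $H^1_0(0,1)$ is represented by its continuous representative on $[0,1]$,
  extended by zero to the real line, so that equality of elements is equality of functions.\<close>

definition H10_functions :: "(real \<Rightarrow> real) set"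
  where "H10_functions =
    {u. continuous_on {0..1} u \<and> (\<forall>t. t \<notin> {0<..<1} \<longrightarrow> u t = 0) \<and> (\<exists>g. weak_L2_deriv u g)}"

lemma H10_functions_zero: "(\<lambda>_. 0) \<in> H10_functions"
  by (auto simp: H10_functions_def weak_L2_deriv_def intro!: exI[of _ "\<lambda>_. 0"])

lemma H10_functions_add:
  "u \<in> H10_functions \<Longrightarrow> v \<in> H10_functions \<Longrightarrow> (\<lambda>t. u t + v t) \<in> H10_functions"
  unfolding H10_functions_def by (auto intro: continuous_on_add weak_L2_deriv_add)

lemma H10_functions_scale: "u \<in> H10_functions \<Longrightarrow> (\<lambda>t. r * u t) \<in> H10_functions"
  unfolding H10_functions_def by (auto intro: continuous_on_mult_left weak_L2_deriv_scale)

typedef H10 = H10_functions morphisms fun_of Abs_H10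
  using H10_functions_zero by blast

text \<open>A representative of the weak derivative; it is determined only almost everywhere
  (lemma \<open>weak_deriv_AE\<close>).\<close>

definition weak_deriv :: "H10 \<Rightarrow> real \<Rightarrow> real"
  where "weak_deriv u = (SOME g. weak_L2_deriv (fun_of u) g)"

lemma fun_of_cont: "continuous_on {0..1} (fun_of u)"
  and fun_of_outside: "t \<notin> {0<..<1} \<Longrightarrow> fun_of u t = 0"
  and weak_deriv: "weak_L2_deriv (fun_of u) (weak_deriv u)"
proof -
  show "continuous_on {0..1} (fun_of u)" "t \<notin> {0<..<1} \<Longrightarrow> fun_of u t = 0"
    using fun_of[of u] by (auto simp: H10_functions_def)
  have "\<exists>g. weak_L2_deriv (fun_of u) g"
    using fun_of[of u] by (simp add: H10_functions_def)
  then show "weak_L2_deriv (fun_of u) (weak_deriv u)"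
    unfolding weak_deriv_def by (rule someI_ex)
qed

lemma weak_deriv_AE:
  "weak_L2_deriv (fun_of u) g \<Longrightarrow> AE t in unit_ival. weak_deriv u t = g t"
  by (rule weak_L2_deriv_unique_AE[OF fun_of_cont weak_deriv])

lemma weak_deriv_measurable [measurable]: "weak_deriv u \<in> borel_measurable unit_ival"
  and weak_deriv_sq_integrable: "integrable unit_ival (\<lambda>t. (weak_deriv u t)\<^sup>2)"
  using weak_deriv[of u] by (auto simp: weak_L2_deriv_def)

lemma weak_deriv_prod_integrable: "integrable unit_ival (\<lambda>t. weak_deriv u t * weak_deriv v t)"
  by (intro integrable_L2_prod weak_deriv_measurable weak_deriv_sq_integrable)

lemma H10_eqI: "fun_of u = fun_of v \<Longrightarrow> u = v"
  by (simp add: fun_of_inject)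

instantiation H10 :: real_vector
begin

definition zero_H10 :: H10 where "0 = Abs_H10 (\<lambda>_. 0)"
definition plus_H10 :: "H10 \<Rightarrow> H10 \<Rightarrow> H10" where "u + v = Abs_H10 (\<lambda>t. fun_of u t + fun_of v t)"
definition scaleR_H10 :: "real \<Rightarrow> H10 \<Rightarrow> H10" where "r *\<^sub>R u = Abs_H10 (\<lambda>t. r * fun_of u t)"
definition uminus_H10 :: "H10 \<Rightarrow> H10" where "- u = (- 1) *\<^sub>R (u :: H10)"
definition minus_H10 :: "H10 \<Rightarrow> H10 \<Rightarrow> H10" where "u - v = u + - (v :: H10)"

lemma fun_of_zero: "fun_of 0 = (\<lambda>_. 0)"
  by (simp add: zero_H10_def Abs_H10_inverse H10_functions_zero)

lemma fun_of_plus: "fun_of (u + v) = (\<lambda>t. fun_of u t + fun_of v t)"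
  by (simp add: plus_H10_def Abs_H10_inverse H10_functions_add fun_of)

lemma fun_of_scaleR: "fun_of (r *\<^sub>R u) = (\<lambda>t. r * fun_of u t)"
  by (simp add: scaleR_H10_def Abs_H10_inverse H10_functions_scale fun_of)

lemma fun_of_uminus: "fun_of (- u) = (\<lambda>t. - fun_of u t)"
  by (simp add: uminus_H10_def fun_of_scaleR)

lemma fun_of_minus: "fun_of (u - v) = (\<lambda>t. fun_of u t - fun_of v t)"
  by (simp add: minus_H10_def fun_of_plus fun_of_uminus)

instance
  by standard
    (rule H10_eqI, simp add: fun_of_zero fun_of_plus fun_of_scaleR fun_of_uminus fun_of_minus algebra_simps)+

end

lemma weak_deriv_add_AE:
  "AE t in unit_ival. weak_deriv (u + v) t = weak_deriv u t + weak_deriv v t"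
  by (intro weak_deriv_AE) (simp add: fun_of_plus weak_L2_deriv_add fun_of_cont weak_deriv)

lemma weak_deriv_scaleR_AE:
  "AE t in unit_ival. weak_deriv (r *\<^sub>R u) t = r * weak_deriv u t"
  by (intro weak_deriv_AE) (simp add: fun_of_scaleR weak_L2_deriv_scale weak_deriv)

lemma weak_deriv_AE_zero_imp:
  assumes "AE t in unit_ival. weak_deriv u t = 0"
  shows "u = 0"
proof (rule H10_eqI, rule ext)
  fix t
  have const: "fun_of u b = fun_of u a" if "0 < a" "a < b" "b < 1" for a b
  proof -
    have "fun_of u b - fun_of u a = (LINT t|unit_ival. weak_deriv u t * indicator {a<..b} t)"
      by (rule weak_L2_deriv_FTC[OF fun_of_cont weak_deriv that])
    also have "\<dots> = 0"
      using assms by (intro integral_eq_zero_AE) auto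
    finally show ?thesis by simp
  qed
  show "fun_of u t = fun_of 0 t"
  proof (cases "t \<in> {0<..<1}")
    case True
    have "(fun_of u \<longlongrightarrow> fun_of u 0) (at 0 within {0..1})"
      using fun_of_cont[of u] by (auto simp: continuous_on_def)
    then have "(fun_of u \<longlongrightarrow> fun_of u 0) (at 0 within {0<..<1})"
      by (rule tendsto_within_subset) auto
    moreover have "\<forall>\<^sub>F s in at 0 within {0<..<1}. fun_of u s = fun_of u t"
      unfolding eventually_at using True const
      by (intro exI[of _ t]) (auto simp: dist_real_def)
    ultimately have lim: "((\<lambda>_. fun_of u t) \<longlongrightarrow> fun_of u 0) (at (0::real) within {0<..<1})"
      by (rule Lim_transform_eventually)
    have "(0::real) islimpt {0<..<1}"
      by (simp add: islimpt_greaterThanLessThan1)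
    then have "at (0::real) within {0<..<1} \<noteq> bot"
      by (simp add: trivial_limit_within)
    then have "fun_of u t = fun_of u 0"
      by (rule tendsto_unique[OF _ tendsto_const lim])
    then show ?thesis by (simp add: fun_of_outside fun_of_zero)
  qed (simp add: fun_of_outside fun_of_zero)
qed

instantiation H10 :: real_inner
begin

definition inner_H10 :: "H10 \<Rightarrow> H10 \<Rightarrow> real"
  where "u \<bullet> v = (LINT t|unit_ival. weak_deriv u t * weak_deriv v t)"
definition norm_H10 :: "H10 \<Rightarrow> real" where "norm u = sqrt (u \<bullet> u)" for u :: H10
definition dist_H10 :: "H10 \<Rightarrow> H10 \<Rightarrow> real" where "dist u v = norm (u - v)" for u v :: H10
definition sgn_H10 :: "H10 \<Rightarrow> H10" where "sgn u = u /\<^sub>R norm u" for u :: H10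
definition uniformity_H10 :: "(H10 \<times> H10) filter"
  where "uniformity_H10 = (INF e\<in>{0 <..}. principal {(x, y). dist x y < e})"
definition open_H10 :: "H10 set \<Rightarrow> bool"
  where "open_H10 S = (\<forall>x\<in>S. \<forall>\<^sub>F (x', y) in uniformity. x' = x \<longrightarrow> y \<in> S)"

instance
proof
  fix u v w :: H10 and r :: real and S :: "H10 set"
  show "dist u v = norm (u - v)" by (fact dist_H10_def)
  show "sgn u = u /\<^sub>R norm u" by (fact sgn_H10_def)
  show "uniformity = (INF e\<in>{0 <..}. principal {(x::H10, y). dist x y < e})"
    by (fact uniformity_H10_def)
  show "open S = (\<forall>x\<in>S. \<forall>\<^sub>F (x', y) in uniformity. x' = x \<longrightarrow> y \<in> S)"
    by (fact open_H10_def)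
  show "norm u = sqrt (u \<bullet> u)" by (fact norm_H10_def)
  show "u \<bullet> v = v \<bullet> u" by (simp add: inner_H10_def mult.commute)
  have "(u + v) \<bullet> w = (LINT t|unit_ival. weak_deriv u t * weak_deriv w t + weak_deriv v t * weak_deriv w t)"
    unfolding inner_H10_def using weak_deriv_add_AE[of u v]
    by (intro integral_cong_AE) (auto simp: distrib_right)
  then show "(u + v) \<bullet> w = u \<bullet> w + v \<bullet> w"
    by (simp add: inner_H10_def weak_deriv_prod_integrable)
  have "(r *\<^sub>R u) \<bullet> v = (LINT t|unit_ival. r * (weak_deriv u t * weak_deriv v t))"
    unfolding inner_H10_def using weak_deriv_scaleR_AE[of r u]
    by (intro integral_cong_AE) auto
  then show "(r *\<^sub>R u) \<bullet> v = r * (u \<bullet> v)"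
    by (simp add: inner_H10_def)
  show "0 \<le> u \<bullet> u" by (simp add: inner_H10_def)
  show "u \<bullet> u = 0 \<longleftrightarrow> u = 0"
  proof
    assume "u \<bullet> u = 0"
    then have "AE t in unit_ival. weak_deriv u t * weak_deriv u t = 0"
      unfolding inner_H10_def
      by (subst (asm) integral_nonneg_eq_0_iff_AE) (auto intro: weak_deriv_prod_integrable)
    then show "u = 0" by (intro weak_deriv_AE_zero_imp) simp
  next
    assume "u = 0"
    then have "AE t in unit_ival. weak_deriv u t = 0"
      using weak_deriv_scaleR_AE[of 0 0] by simp
    then show "u \<bullet> u = 0"
      unfolding inner_H10_def by (intro integral_eq_zero_AE) auto
  qed
qed

end

subsection \<open>The functional and the linear problem\<close>

definition C1_functional :: "('a::real_normed_vector \<Rightarrow> real) \<Rightarrow> bool"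
  where "C1_functional \<Psi> \<longleftrightarrow>
    (\<exists>D :: 'a \<Rightarrow> 'a \<Rightarrow>\<^sub>L real. (\<forall>u. (\<Psi> has_derivative blinfun_apply (D u)) (at u)) \<and> continuous_on UNIV D)"

definition caratheodory :: "(real \<Rightarrow> real \<Rightarrow> real) \<Rightarrow> bool"
  where "caratheodory f \<longleftrightarrow>
    (\<forall>s. (\<lambda>t. f t s) \<in> borel_measurable unit_ival) \<and> (AE t in unit_ival. continuous_on UNIV (f t))"

text \<open>The interval integral is oriented, so this is $\int_0^s g$ for negative $s$ as well.\<close>

definition primitive :: "(real \<Rightarrow> real) \<Rightarrow> real \<Rightarrow> real"
  where "primitive g s = (LBINT r=0..s. g r)"

definition Phi :: "nat \<Rightarrow> (nat \<Rightarrow> real) \<Rightarrow> (real \<Rightarrow> real \<Rightarrow> real) \<Rightarrow> (nat \<Rightarrow> real \<Rightarrow> real) \<Rightarrow> H10 \<Rightarrow> real"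
  where "Phi m x f \<iota> u =
    1/2 * (LINT t|unit_ival. (weak_deriv u t)\<^sup>2)
    - (LINT t|unit_ival. primitive (f t) (fun_of u t))
    - (\<Sum>j=1..m. primitive (\<iota> j) (fun_of u (x j)))"

text \<open>Points $x_1,\dots,x_m$ and vectors $b\in R^m$ are functions on \<open>nat\<close> of which only the values
  at \<open>1..m\<close> matter (for the points also $x_0 = 0$ and $x_{m+1} = 1$). Continuity of \<open>u\<close> on
  $[0,1]$ covers $u(x_j^+) = u(x_j^-)$, with common value $u(x_j)$, and makes the boundary
  conditions meaningful; $l$ and $r$ are $u'(x_j^-)$ and $u'(x_j^+)$.\<close>

definition interface_solution :: "nat \<Rightarrow> (nat \<Rightarrow> real) \<Rightarrow> (nat \<Rightarrow> real) \<Rightarrow> (real \<Rightarrow> real) \<Rightarrow> bool"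
  where "interface_solution m x b u \<longleftrightarrow>
    continuous_on {0..1} u \<and> u 0 = 0 \<and> u 1 = 0 \<and>
    (\<exists>u' u''.
      (\<forall>t\<in>{0<..<1} - x ` {1..m}.
        (u has_real_derivative u' t) (at t) \<and> (u' has_real_derivative u'' t) (at t) \<and> - u'' t = 0) \<and>
      (\<forall>j\<in>{1..m}. \<exists>l r. (u' \<longlongrightarrow> l) (at_left (x j)) \<and> (u' \<longlongrightarrow> r) (at_right (x j)) \<and>
        r = l - b j * u (x j)))"

definition resonance_set :: "nat \<Rightarrow> (nat \<Rightarrow> real) \<Rightarrow> (nat \<Rightarrow> real) set"
  where "resonance_set m x = {b. \<exists>u. interface_solution m x b u \<and> (\<exists>t\<in>{0..1}. u t \<noteq> 0)}"

definition piecewise_affine :: "nat \<Rightarrow> (nat \<Rightarrow> real) \<Rightarrow> H10 set"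
  where "piecewise_affine m x =
    {w. \<forall>j\<in>{1..m+1}. \<exists>p q. \<forall>t\<in>{x (j - 1)..x j}. fun_of w t = p + q * t}"

definition Phi_quad :: "nat \<Rightarrow> (nat \<Rightarrow> real) \<Rightarrow> (nat \<Rightarrow> real) \<Rightarrow> H10 \<Rightarrow> real"
  where "Phi_quad m x b w =
    1/2 * ((LINT t|unit_ival. (weak_deriv w t)\<^sup>2) - (\<Sum>j=1..m. b j * (fun_of w (x j))\<^sup>2))"

text \<open>Intended for a quadratic form \<open>Q\<close> on a finite-dimensional subspace \<open>M\<close>, where the set
  of dimensions is finite and contains 0.\<close>

definition morse_index :: "('a::real_vector \<Rightarrow> real) \<Rightarrow> 'a set \<Rightarrow> nat"
  where "morse_index Q M = Max {dim V |V. subspace V \<and> V \<subseteq> M \<and> (\<forall>w\<in>V. w \<noteq> 0 \<longrightarrow> Q w < 0)}"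

subsection \<open>Singular homology with coefficients and critical groups\<close>

text \<open>The library develops singular homology with integer coefficients only. Chains with
  coefficients in \<open>'g\<close> are finitely supported families of elements of \<open>'g\<close> indexed by singular
  simplices; simplices and faces are those of the library, and for \<open>'g = int\<close> the resulting
  groups are the library's (lemma \<open>coeff_homology_group_int\<close>).\<close>

type_synonym ('a, 'g) coeff_chain = "((nat \<Rightarrow> real) \<Rightarrow> 'a) \<Rightarrow>\<^sub>0 'g"

definition coeff_chain :: "nat \<Rightarrow> 'a topology \<Rightarrow> ('a, 'g::ab_group_add) coeff_chain \<Rightarrow> bool"
  where "coeff_chain p X c \<longleftrightarrow> Poly_Mapping.keys c \<subseteq> singular_simplex_set p X"

definition coeff_boundary :: "nat \<Rightarrow> ('a, 'g::ab_group_add) coeff_chain \<Rightarrow> ('a, 'g) coeff_chain"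
  where "coeff_boundary p c =
    (if p = 0 then 0
     else \<Sum>\<sigma>\<in>Poly_Mapping.keys c. \<Sum>k\<le>p. Poly_Mapping.single (singular_face p k \<sigma>)
       (if even k then Poly_Mapping.lookup c \<sigma> else - Poly_Mapping.lookup c \<sigma>))"

definition coeff_relcycle :: "nat \<Rightarrow> 'a topology \<Rightarrow> 'a set \<Rightarrow> ('a, 'g::ab_group_add) coeff_chain \<Rightarrow> bool"
  where "coeff_relcycle p X S c \<longleftrightarrow>
    coeff_chain p X c \<and> coeff_chain (p - 1) (subtopology X S) (coeff_boundary p c)"

definition coeff_relboundary :: "nat \<Rightarrow> 'a topology \<Rightarrow> 'a set \<Rightarrow> ('a, 'g::ab_group_add) coeff_chain \<Rightarrow> bool"
  where "coeff_relboundary p X S c \<longleftrightarrow>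
    (\<exists>d. coeff_chain (Suc p) X d \<and> coeff_chain p (subtopology X S) (coeff_boundary (Suc p) d - c))"

definition coeff_homology_group ::
    "'g itself \<Rightarrow> nat \<Rightarrow> 'a topology \<Rightarrow> 'a set \<Rightarrow> ('a, 'g::ab_group_add) coeff_chain set monoid"
  where "coeff_homology_group TYPE('g) p X S =
    \<lparr>carrier = Collect (coeff_relcycle p X S), monoid.mult = (+), one = 0\<rparr> Mod
      Collect (coeff_relboundary p X S)"

lemma coeff_chain_int: "coeff_chain p X c \<longleftrightarrow> singular_chain p X c"
  by (simp add: coeff_chain_def singular_chain_def)

lemma coeff_boundary_int:
  fixes c :: "'a chain"
  shows "coeff_boundary p c = chain_boundary p c"
proof -
  have eq: "Poly_Mapping.single (singular_face p k \<sigma>) (if even k then a else - a) =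
      frag_cmul a (frag_cmul ((- 1) ^ k) (frag_of (singular_face p k \<sigma>)))" for k a and \<sigma> :: "(nat \<Rightarrow> real) \<Rightarrow> 'a"
    by (rule poly_mapping_eqI) (simp add: lookup_single when_def)
  then show ?thesis
    by (simp only: coeff_boundary_def chain_boundary_def frag_extend_def frag_cmul_sum eq)
qed

lemma coeff_homology_group_int:
  "coeff_homology_group TYPE(int) p X S = relative_homology_group (int p) X S"
proof -
  have cyc: "coeff_relcycle p X S = singular_relcycle p X S"
    by (auto simp: fun_eq_iff coeff_relcycle_def singular_relcycle_def mod_subset_def
        coeff_chain_int coeff_boundary_int)
  have bd: "coeff_relboundary p X S = singular_relboundary p X S"
    by (auto simp: fun_eq_iff coeff_relboundary_def singular_relboundary_def mod_subset_def
        coeff_chain_int coeff_boundary_int)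
  have grp: "relcycle_group p X S = \<lparr>carrier = Collect (singular_relcycle p X S), monoid.mult = (+), one = 0\<rparr>"
    using carrier_relcycle_group[of p X S]
    by (intro monoid.equality) (simp_all add: relcycle_group_def chain_group_def free_Abelian_group_def)
  show ?thesis
    unfolding coeff_homology_group_def relative_homology_group_def cyc bd by (simp add: grp)
qed

definition additive_group :: "'g itself \<Rightarrow> 'g::ab_group_add monoid"
  where "additive_group TYPE('g) = \<lparr>carrier = UNIV, monoid.mult = (+), one = 0\<rparr>"

text \<open>$C_q(\Psi,0)$ computed in the neighbourhood \<open>U\<close> of 0.\<close>

definition critical_group ::
    "'g itself \<Rightarrow> nat \<Rightarrow> ('a::real_normed_vector \<Rightarrow> real) \<Rightarrow> 'a set \<Rightarrow> ('a, 'g::ab_group_add) coeff_chain set monoid"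
  where "critical_group TYPE('g) q \<Psi> U =
    coeff_homology_group TYPE('g) q (top_of_set ({u. \<Psi> u \<le> 0} \<inter> U)) ({u. \<Psi> u \<le> 0} \<inter> U - {0})"

end

theory Submission
  imports Defs
begin

text \<open>With the Green functions \<open>green x\<^sub>j\<close> one has \<open>u (x\<^sub>j) = u \<bullet> green x\<^sub>j\<close>. Hence the
  functional is the quadratic form \<open>1/2 (u \<bullet> u - \<Sum>\<^sub>j b\<^sub>j (u \<bullet> green x\<^sub>j)\<^sup>2)\<close> plus a remainder \<open>G\<close>
  whose Lipschitz constant on the ball of radius \<open>r\<close> is \<open>o(r)\<close>, and the piecewise affine functions are
  the span of the Green functions. Let \<open>V\<close> be a maximal negative subspace of that span and \<open>P\<close> the
  projection to \<open>V\<close> along its complement orthogonal for the form; nonresonance makes the form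
  coercive on this complement. By the estimate on \<open>G\<close>, once the functional is positive at a point of
  the segment from \<open>P u\<close> to \<open>u\<close>, it stays positive up to \<open>u\<close>. So the linear homotopy from the
  identity to \<open>P\<close> preserves the sublevel set near 0, and deforms it, and its complement of 0, to \<open>V\<close>;
  no gradient flow and no completeness are needed. This gives the integral homology, and freeness
  of the singular chain complex transfers the result to arbitrary coefficients.\<close>

subsection \<open>Changing coefficients\<close>

text \<open>Away from 0 the functional need have no second derivative, so the Morse lemma is out of
  reach; what remains is the Lipschitz bound on \<open>G\<close>. On a segment
  \<open>s *\<^sub>R v + w\<close> starting at \<open>w\<close> in \<open>V\<close>, the form grows
  between \<open>s\<close> and \<open>t\<close> by at least
  \<open>c * (t\<^sup>2 - s\<^sup>2) * (norm v)\<^sup>2\<close>, while \<open>G\<close> changes by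
  at most \<epsilon> times the size of the points times \<open>(t - s) * norm v\<close>. Close to
  \<open>V\<close> that size is not controlled by \<open>t * norm v\<close>, and monotonicity may
  fail. A positive value at \<open>s\<close> repairs this: as the form is negative on
  \<open>V\<close>, it forces \<open>norm w \<le> K * s * norm v\<close>. Hence positivity is
  propagated instead.

  \<open>P\<close> is orthogonal for the form, not for the inner product, so a ball need not be
  stable under the homotopy; excision allows a neighbourhood adapted to \<open>P\<close>.

  For coefficients, an abstract isomorphism with the integers says nothing about chains. It is first
  turned into a cycle \<open>z\<close> generating the homology; the contraction of the relative
  complex onto multiples of \<open>z\<close> is then an identity on single simplices, and such
  identities can be tensored with any group.\<close>

definition zscale :: "int \<Rightarrow> 'g::ab_group_add \<Rightarrow> 'g"
  where "zscale n g = (if 0 \<le> n then (\<Sum>i<nat n. g) else - (\<Sum>i<nat (- n). g))"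

lemma zscale_0_left [simp]: "zscale 0 g = 0"
  by (simp add: zscale_def)

lemma zscale_succ: "zscale (n + 1) g = zscale n g + g"
proof -
  consider "0 \<le> n" | "n = - 1" | "n < - 1" by linarith
  then show ?thesis
  proof cases
    case 1
    then have "nat (n + 1) = Suc (nat n)" by simp
    with 1 show ?thesis by (simp add: zscale_def)
  next
    case 2
    then show ?thesis by (simp add: zscale_def)
  next
    case 3
    then have "nat (- n) = Suc (nat (- (n + 1)))" by simp
    with 3 show ?thesis by (simp add: zscale_def)
  qed
qed

lemma zscale_1 [simp]: "zscale 1 g = g"
  using zscale_succ[of 0 g] by simp

lemma zscale_add_left: "zscale (n + l) g = zscale n g + zscale l g"
proof (induction l rule: int_induct[where k=0])
  case (step1 i)
  then show ?case using zscale_succ[of "n + i" g] zscale_succ[of i g] by (simp add: algebra_simps)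
next
  case (step2 i)
  then show ?case
    using zscale_succ[of "n + (i - 1)" g] zscale_succ[of "i - 1" g] by (simp add: algebra_simps)
qed simp

lemma zscale_uminus_left: "zscale (- n) g = - zscale n g"
  using zscale_add_left[of "- n" n g] by (simp add: eq_neg_iff_add_eq_0)

lemma zscale_diff_left: "zscale (n - l) g = zscale n g - zscale l g"
  using zscale_add_left[of n "- l" g] by (simp add: zscale_uminus_left)

lemma zscale_add_right: "zscale n (g + h) = zscale n g + zscale n h"
  by (simp add: zscale_def sum.distrib)

lemma zscale_0_right [simp]: "zscale n 0 = 0"
  by (simp add: zscale_def)

lemma zscale_mult: "zscale (n * l) g = zscale n (zscale l g)"
proof (induction n rule: int_induct[where k=0])
  case (step1 i)
  then show ?case by (simp add: distrib_right zscale_add_left)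
next
  case (step2 i)
  then show ?case by (simp add: left_diff_distrib zscale_diff_left)
qed simp

lemma zscale_int [simp]: "zscale n (l::int) = n * l"
  by (simp add: zscale_def)

text \<open>The elementary tensor of \<open>a\<close> and \<open>g\<close>, when the tensor product
  of a free abelian group with \<open>'g\<close> is realized as the finitely supported families in
  \<open>'g\<close>.\<close>

definition frag_tensor :: "('a \<Rightarrow>\<^sub>0 int) \<Rightarrow> 'g::ab_group_add \<Rightarrow> ('a \<Rightarrow>\<^sub>0 'g)"
  where "frag_tensor a g = (\<Sum>x\<in>Poly_Mapping.keys a. Poly_Mapping.single x (zscale (Poly_Mapping.lookup a x) g))"

lemma lookup_frag_tensor [simp]: "Poly_Mapping.lookup (frag_tensor a g) x = zscale (Poly_Mapping.lookup a x) g"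
proof -
  have "Poly_Mapping.lookup (frag_tensor a g) x =
      (\<Sum>y\<in>Poly_Mapping.keys a. if y = x then zscale (Poly_Mapping.lookup a y) g else 0)"
    unfolding frag_tensor_def lookup_sum by (intro sum.cong) (auto simp: lookup_single when_def)
  also have "\<dots> = zscale (Poly_Mapping.lookup a x) g"
    by (auto simp: sum.delta in_keys_iff)
  finally show ?thesis .
qed

lemma frag_tensor_add_left: "frag_tensor (a + b) g = frag_tensor a g + frag_tensor b g"
  and frag_tensor_diff_left: "frag_tensor (a - b) g = frag_tensor a g - frag_tensor b g"
  and frag_tensor_add_right: "frag_tensor a (g + h) = frag_tensor a g + frag_tensor a h"
  and frag_tensor_0_left [simp]: "frag_tensor 0 g = 0"
  and frag_tensor_0_right [simp]: "frag_tensor a 0 = 0"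
  and frag_tensor_of [simp]: "frag_tensor (frag_of x) g = Poly_Mapping.single x g"
  and frag_tensor_cmul: "frag_tensor (frag_cmul n a) g = frag_tensor a (zscale n g)"

  by (rule poly_mapping_eqI; simp add: lookup_add lookup_minus zscale_add_left zscale_diff_left
      zscale_add_right lookup_single when_def zscale_mult[symmetric] mult.commute)+

lemma keys_frag_tensor: "Poly_Mapping.keys (frag_tensor a g) \<subseteq> Poly_Mapping.keys a"
  by (auto simp: in_keys_iff)

lemma frag_tensor_sum: "frag_tensor (\<Sum>i\<in>I. a i) g = (\<Sum>i\<in>I. frag_tensor (a i) g)"
  by (induction I rule: infinite_finite_induct) (simp_all add: frag_tensor_add_left)

lemma frag_tensor_sum_right: "frag_tensor a (\<Sum>i\<in>I. g i) = (\<Sum>i\<in>I. frag_tensor a (g i))"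
  by (induction I rule: infinite_finite_induct) (simp_all add: frag_tensor_add_right)

text \<open>The linear extension of \<open>s\<close>, tensored with the identity of the coefficient
  group.\<close>

definition coeff_extend :: "('b \<Rightarrow> ('a \<Rightarrow>\<^sub>0 int)) \<Rightarrow> ('b \<Rightarrow>\<^sub>0 'g::ab_group_add) \<Rightarrow> ('a \<Rightarrow>\<^sub>0 'g)"
  where "coeff_extend s c = (\<Sum>x\<in>Poly_Mapping.keys c. frag_tensor (s x) (Poly_Mapping.lookup c x))"

text \<open>The same construction for an integer-valued \<open>r\<close>, with the tensor product of
  the integers and \<open>'g\<close> identified with \<open>'g\<close>.\<close>

definition coeff_val :: "('b \<Rightarrow> int) \<Rightarrow> ('b \<Rightarrow>\<^sub>0 'g::ab_group_add) \<Rightarrow> 'g"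
  where "coeff_val r c = (\<Sum>x\<in>Poly_Mapping.keys c. zscale (r x) (Poly_Mapping.lookup c x))"

lemma coeff_extend_0 [simp]: "coeff_extend s 0 = 0"
  and coeff_val_0 [simp]: "coeff_val r 0 = 0"
  by (simp_all add: coeff_extend_def coeff_val_def)

lemma coeff_extend_single [simp]: "coeff_extend s (Poly_Mapping.single x g) = frag_tensor (s x) g"
  and coeff_val_single [simp]: "coeff_val r (Poly_Mapping.single x g) = zscale (r x) g"
  by (simp_all add: coeff_extend_def coeff_val_def)

lemma coeff_extend_add: "coeff_extend s (c + d) = coeff_extend s c + coeff_extend s d"
  unfolding coeff_extend_def
  by (intro setsum_keys_plus_distrib) (simp_all add: frag_tensor_add_right)

lemma coeff_val_add: "coeff_val r (c + d) = coeff_val r c + coeff_val r d"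
  unfolding coeff_val_def
  by (intro setsum_keys_plus_distrib) (simp_all add: zscale_add_right)

lemma coeff_extend_diff: "coeff_extend s (c - d) = coeff_extend s c - coeff_extend s d"
  using coeff_extend_add[of s "c - d" d] by simp

lemma coeff_val_diff: "coeff_val r (c - d) = coeff_val r c - coeff_val r d"
  using coeff_val_add[of r "c - d" d] by simp

lemma coeff_extend_sum: "coeff_extend s (\<Sum>i\<in>I. c i) = (\<Sum>i\<in>I. coeff_extend s (c i))"
  by (induction I rule: infinite_finite_induct) (simp_all add: coeff_extend_add)

lemma coeff_val_sum: "coeff_val r (\<Sum>i\<in>I. c i) = (\<Sum>i\<in>I. coeff_val r (c i))"
  by (induction I rule: infinite_finite_induct) (simp_all add: coeff_val_add)

text \<open>Both sides are additive in \<open>a\<close>, so induction over the free abelian group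
  reduces the claim to one generator. From this rule follow the composition laws below, which carry
  identities between integral maps over to coefficients.\<close>

lemma coeff_extend_frag_tensor: "coeff_extend s (frag_tensor a g) = frag_tensor (frag_extend s a) g"
proof (rule frag_induction[of a UNIV])
  show "coeff_extend s (frag_tensor (a - b) g) = frag_tensor (frag_extend s (a - b)) g"
    if "coeff_extend s (frag_tensor a g) = frag_tensor (frag_extend s a) g"
       "coeff_extend s (frag_tensor b g) = frag_tensor (frag_extend s b) g" for a b
    using that by (simp add: frag_tensor_diff_left coeff_extend_diff frag_extend_diff)
qed simp_all

lemma coeff_val_frag_tensor: "coeff_val r (frag_tensor a g) = zscale (coeff_val r a) g"
proof (rule frag_induction[of a UNIV])
  show "coeff_val r (frag_tensor (a - b) g) = zscale (coeff_val r (a - b)) g"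
    if "coeff_val r (frag_tensor a g) = zscale (coeff_val r a) g"
       "coeff_val r (frag_tensor b g) = zscale (coeff_val r b) g" for a b
    using that by (simp add: frag_tensor_diff_left coeff_val_diff zscale_diff_left)
qed simp_all

lemma coeff_extend_extend:
  "coeff_extend s (coeff_extend t c) = coeff_extend (\<lambda>x. frag_extend s (t x)) c"
  by (simp add: coeff_extend_def[of t] coeff_extend_sum coeff_extend_frag_tensor)
     (simp add: coeff_extend_def)

lemma coeff_val_extend:
  "coeff_val r (coeff_extend t c) = coeff_val (\<lambda>x. coeff_val r (t x)) c"
  by (simp add: coeff_extend_def[of t] coeff_val_sum coeff_val_frag_tensor)
     (simp add: coeff_val_def)

lemma coeff_extend_cong:
  "(\<And>x. x \<in> Poly_Mapping.keys c \<Longrightarrow> s x = t x) \<Longrightarrow> coeff_extend s c = coeff_extend t c"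
  by (simp add: coeff_extend_def)

lemma coeff_extend_pointwise_add:
  "coeff_extend (\<lambda>x. s x + t x) c = coeff_extend s c + coeff_extend t c"
  and coeff_extend_pointwise_diff:
  "coeff_extend (\<lambda>x. s x - t x) c = coeff_extend s c - coeff_extend t c"
  by (simp_all add: coeff_extend_def frag_tensor_add_left frag_tensor_diff_left sum.distrib sum_subtractf)

text \<open>A map that factors through the integers stays of rank one after tensoring: this is the
  form that the projection onto the generator \<open>z\<close> takes for arbitrary
  coefficients.\<close>

lemma coeff_extend_cmul:
  "coeff_extend (\<lambda>x. frag_cmul (r x) z) c = frag_tensor z (coeff_val r c)"
  by (simp add: coeff_extend_def coeff_val_def frag_tensor_cmul frag_tensor_sum_right)

lemma coeff_extend_frag_of [simp]: "coeff_extend frag_of c = c"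
proof (rule poly_mapping_eqI)
  fix x
  have "Poly_Mapping.lookup (coeff_extend frag_of c) x =
      (\<Sum>y\<in>Poly_Mapping.keys c. if y = x then Poly_Mapping.lookup c y else 0)"
    unfolding coeff_extend_def lookup_sum by (intro sum.cong) (auto simp: lookup_single when_def)
  also have "\<dots> = Poly_Mapping.lookup c x"
    by (auto simp: sum.delta in_keys_iff)
  finally show "Poly_Mapping.lookup (coeff_extend frag_of c) x = Poly_Mapping.lookup c x" .
qed

section \<open>Chains and boundaries with coefficients\<close>

lemma coeff_chain_iff: "coeff_chain p X c \<longleftrightarrow> (\<forall>\<sigma>. Poly_Mapping.lookup c \<sigma> \<noteq> 0 \<longrightarrow> singular_simplex p X \<sigma>)"
  by (auto simp: coeff_chain_def in_keys_iff)

lemma coeff_chain_0 [simp]: "coeff_chain p X 0"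
  by (simp add: coeff_chain_iff)

lemma coeff_chain_add: "coeff_chain p X c \<Longrightarrow> coeff_chain p X d \<Longrightarrow> coeff_chain p X (c + d)"
  unfolding coeff_chain_iff lookup_add
proof (intro allI impI)
  fix \<sigma>
  assume c: "\<forall>\<sigma>. Poly_Mapping.lookup c \<sigma> \<noteq> 0 \<longrightarrow> singular_simplex p X \<sigma>"
    and d: "\<forall>\<sigma>. Poly_Mapping.lookup d \<sigma> \<noteq> 0 \<longrightarrow> singular_simplex p X \<sigma>"
    and "Poly_Mapping.lookup c \<sigma> + Poly_Mapping.lookup d \<sigma> \<noteq> 0"
  then have "Poly_Mapping.lookup c \<sigma> \<noteq> 0 \<or> Poly_Mapping.lookup d \<sigma> \<noteq> 0" by auto
  with c d show "singular_simplex p X \<sigma>" by blast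
qed

lemma coeff_chain_diff: "coeff_chain p X c \<Longrightarrow> coeff_chain p X d \<Longrightarrow> coeff_chain p X (c - d)"
  unfolding coeff_chain_iff lookup_minus
proof (intro allI impI)
  fix \<sigma>
  assume c: "\<forall>\<sigma>. Poly_Mapping.lookup c \<sigma> \<noteq> 0 \<longrightarrow> singular_simplex p X \<sigma>"
    and d: "\<forall>\<sigma>. Poly_Mapping.lookup d \<sigma> \<noteq> 0 \<longrightarrow> singular_simplex p X \<sigma>"
    and "Poly_Mapping.lookup c \<sigma> - Poly_Mapping.lookup d \<sigma> \<noteq> 0"
  then have "Poly_Mapping.lookup c \<sigma> \<noteq> 0 \<or> Poly_Mapping.lookup d \<sigma> \<noteq> 0" by auto
  with c d show "singular_simplex p X \<sigma>" by blast
qed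

lemma coeff_chain_sum:
  "(\<And>i. i \<in> I \<Longrightarrow> coeff_chain p X (c i)) \<Longrightarrow> coeff_chain p X (\<Sum>i\<in>I. c i)"
  by (induction I rule: infinite_finite_induct) (auto intro: coeff_chain_add)

lemma coeff_chain_frag_tensor: "singular_chain p X a \<Longrightarrow> coeff_chain p X (frag_tensor a g)"
  unfolding coeff_chain_def singular_chain_def by (rule order_trans[OF keys_frag_tensor])

lemma coeff_chain_extend:
  "(\<And>x. x \<in> Poly_Mapping.keys c \<Longrightarrow> singular_chain p X (s x)) \<Longrightarrow> coeff_chain p X (coeff_extend s c)"
  unfolding coeff_extend_def by (intro coeff_chain_sum coeff_chain_frag_tensor)

text \<open>Exhibits the boundary as the integral one tensored with the coefficient group, so that
  its properties can be inherited.\<close>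

lemma coeff_boundary_extend: "coeff_boundary p c = coeff_extend (\<lambda>\<sigma>. chain_boundary p (frag_of \<sigma>)) c"
proof -
  have "frag_tensor (frag_cmul ((- 1) ^ k) (frag_of \<tau>)) (Poly_Mapping.lookup c \<sigma>) =
      Poly_Mapping.single \<tau> (if even k then Poly_Mapping.lookup c \<sigma> else - Poly_Mapping.lookup c \<sigma>)" for k \<sigma> and \<tau> :: "(nat \<Rightarrow> real) \<Rightarrow> 'a"
    by (simp add: frag_tensor_cmul zscale_uminus_left minus_one_power_iff)
  then show ?thesis
    by (simp add: coeff_boundary_def coeff_extend_def chain_boundary_of frag_tensor_sum)
qed

lemma frag_extend_chain_boundary:
  "frag_extend u (chain_boundary p a) = frag_extend (\<lambda>\<sigma>. frag_extend u (chain_boundary p (frag_of \<sigma>))) a"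
proof (rule frag_induction[of a UNIV])
  show "frag_extend u (chain_boundary p (a - b)) = frag_extend (\<lambda>\<sigma>. frag_extend u (chain_boundary p (frag_of \<sigma>))) (a - b)"
    if "frag_extend u (chain_boundary p a) = frag_extend (\<lambda>\<sigma>. frag_extend u (chain_boundary p (frag_of \<sigma>))) a"
       "frag_extend u (chain_boundary p b) = frag_extend (\<lambda>\<sigma>. frag_extend u (chain_boundary p (frag_of \<sigma>))) b" for a b
    using that by (simp add: chain_boundary_diff frag_extend_diff)
qed simp_all

lemma frag_extend_frag_of: "frag_extend frag_of a = a"
  by (rule frag_expansion[symmetric])

lemma coeff_boundary_coeff_extend:
  "coeff_boundary p (coeff_extend s c) = coeff_extend (\<lambda>x. chain_boundary p (s x)) c"
proof -
  \<comment> \<open>The case \<open>u = frag_of\<close> of the rule on composites with the boundary: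
    the integral boundary is the linear extension of its values on simplices.\<close>
  have "frag_extend (\<lambda>\<sigma>. chain_boundary p (frag_of \<sigma>)) a = chain_boundary p a" for a :: "'a chain"
    unfolding frag_extend_chain_boundary[of frag_of p a, unfolded frag_extend_frag_of] frag_extend_frag_of ..
  then show ?thesis by (simp add: coeff_boundary_extend coeff_extend_extend)
qed

lemma coeff_boundary_0 [simp]: "coeff_boundary p 0 = 0"
  and coeff_boundary_add: "coeff_boundary p (c + d) = coeff_boundary p c + coeff_boundary p d"
  and coeff_boundary_diff: "coeff_boundary p (c - d) = coeff_boundary p c - coeff_boundary p d"
  by (simp_all add: coeff_boundary_extend coeff_extend_add coeff_extend_diff)

lemma coeff_boundary_frag_tensor: "coeff_boundary p (frag_tensor a g) = frag_tensor (chain_boundary p a) g"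
  \<comment> \<open>An elementary tensor is the extension of a constant map from the one-point index
    set \<open>{()}\<close>.\<close>
  using coeff_boundary_coeff_extend[of p "\<lambda>_. a" "Poly_Mapping.single () g"] by simp

lemma coeff_chain_boundary: "coeff_chain p X c \<Longrightarrow> coeff_chain (p - 1) X (coeff_boundary p c)"
  unfolding coeff_boundary_extend
proof (intro coeff_chain_extend)
  fix \<sigma> assume "coeff_chain p X c" "\<sigma> \<in> Poly_Mapping.keys c"
  then have "singular_chain p X (frag_of \<sigma>)" by (auto simp: coeff_chain_def singular_chain_of)
  then show "singular_chain (p - 1) X (chain_boundary p (frag_of \<sigma>))"
    using singular_chain_boundary by fastforce
qed

lemma coeff_boundary_boundary:
  assumes "coeff_chain (Suc p) X c"
  shows "coeff_boundary p (coeff_boundary (Suc p) c) = 0"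
proof -
  have "chain_boundary p (chain_boundary (Suc p) (frag_of \<sigma>)) = 0" if "\<sigma> \<in> Poly_Mapping.keys c" for \<sigma>
  proof -
    have "singular_chain (Suc p) X (frag_of \<sigma>)"
      using that assms by (auto simp: coeff_chain_def singular_chain_of)
    then show ?thesis by (rule chain_boundary_boundary_alt)
  qed
  then have "coeff_boundary p (coeff_boundary (Suc p) c) = coeff_extend (\<lambda>_. 0) c"
    unfolding coeff_boundary_extend[of "Suc p"] coeff_boundary_coeff_extend by (intro coeff_extend_cong)
  then show ?thesis by (simp add: coeff_extend_def)
qed

text \<open>One degree of the construction. Here \<open>t \<sigma>\<close> stands for the previous
  homotopy applied to the boundary of \<sigma>. The defect
  \<open>frag_of \<sigma> - t \<sigma>\<close> is a relative cycle, so it bounds, in degree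
  \<open>k\<close> after removal of a multiple of \<open>z\<close>. The choices are independent
  because simplices form a basis; choosing 0 on simplices of the subspace makes both maps descend to
  relative chains.\<close>

lemma chain_homotopy_step:
  assumes triv: "\<And>c. p \<noteq> k \<Longrightarrow> singular_relcycle p X S c \<Longrightarrow> singular_relboundary p X S c"
    and gen: "\<And>c. singular_relcycle k X S c \<Longrightarrow> \<exists>n. singular_relboundary k X S (c - frag_cmul n z)"
    and cyc: "\<And>\<sigma>. singular_simplex p X \<sigma> \<Longrightarrow> singular_relcycle p X S (frag_of \<sigma> - t \<sigma>)"
    and zero: "\<And>\<sigma>. singular_simplex p (subtopology X S) \<sigma> \<Longrightarrow> t \<sigma> = 0"
  shows "\<exists>s r. (\<forall>\<sigma>. singular_simplex p X \<sigma> \<longrightarrow> singular_chain (Suc p) X (s \<sigma>)) \<and>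
      (\<forall>\<sigma>. singular_simplex p (subtopology X S) \<sigma> \<longrightarrow> s \<sigma> = 0 \<and> r \<sigma> = 0) \<and>
      (\<forall>\<sigma>. p \<noteq> k \<longrightarrow> r \<sigma> = 0) \<and>
      (\<forall>\<sigma>. singular_simplex p X \<sigma> \<longrightarrow> singular_chain p (subtopology X S)
         (chain_boundary (Suc p) (s \<sigma>) + t \<sigma> + frag_cmul (r \<sigma>) z - frag_of \<sigma>))"
proof -
  define R where "R \<sigma> d n \<longleftrightarrow> singular_chain (Suc p) X d \<and> (p \<noteq> k \<longrightarrow> n = 0) \<and>
      (singular_simplex p (subtopology X S) \<sigma> \<longrightarrow> d = 0 \<and> n = 0) \<and>
      singular_chain p (subtopology X S)
       (chain_boundary (Suc p) d + t \<sigma> + frag_cmul n z - frag_of \<sigma>)" for \<sigma> d n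
  have "\<exists>d n. R \<sigma> d n" if \<sigma>: "singular_simplex p X \<sigma>" for \<sigma>
  proof (cases "singular_simplex p (subtopology X S) \<sigma>")
    case True
    then have "R \<sigma> 0 0"
      using zero[OF True] by (simp add: R_def singular_chain_minus singular_chain_of)
    then show ?thesis by blast
  next
    case False
    have "\<exists>n. (p \<noteq> k \<longrightarrow> n = 0) \<and> singular_relboundary p X S (frag_of \<sigma> - t \<sigma> - frag_cmul n z)"
    proof (cases "p = k")
      case True
      then show ?thesis using gen cyc[OF \<sigma>] by blast
    next
      case False
      then show ?thesis using triv[OF False cyc[OF \<sigma>]] by (intro exI[of _ 0]) simp
    qed
    then obtain n d where "p \<noteq> k \<longrightarrow> n = 0" and d: "singular_chain (Suc p) X d"
        "singular_chain p (subtopology X S) (chain_boundary (Suc p) d - (frag_of \<sigma> - t \<sigma> - frag_cmul n z))"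
      by (auto simp: singular_relboundary_def mod_subset_def)
    then have "R \<sigma> d n" using False by (simp add: R_def algebra_simps)
    then show ?thesis by blast
  qed
  then have "\<exists>d n. singular_simplex p X \<sigma> \<longrightarrow> R \<sigma> d n" for \<sigma> by blast
  then obtain s r where sr: "\<And>\<sigma>. singular_simplex p X \<sigma> \<Longrightarrow> R \<sigma> (s \<sigma>) (r \<sigma>)"
    by metis
  \<comment> \<open>The vanishing of \<open>r\<close> in degrees other than \<open>k\<close> is
    demanded for every argument, so the unconstrained values outside \<open>X\<close> are reset to
    0.\<close>
  define r' where "r' \<sigma> = (if singular_simplex p X \<sigma> then r \<sigma> else 0)" for \<sigma>
  show ?thesis
    by (rule exI[of _ s], rule exI[of _ r'])
       (use sr in \<open>auto simp: r'_def R_def singular_simplex_subtopology\<close>)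
qed

lemma frag_extend_chain_identity:
  assumes "singular_chain p X a"
    and "\<And>\<sigma>. singular_simplex p X \<sigma> \<Longrightarrow> singular_chain p Y
       (chain_boundary (Suc p) (s \<sigma>) + t \<sigma> + frag_cmul (r \<sigma>) z - frag_of \<sigma>)"
  shows "singular_chain p Y
    (chain_boundary (Suc p) (frag_extend s a) + frag_extend t a + frag_cmul (coeff_val r a) z - a)"
proof (rule frag_induction[of a "singular_simplex_set p X"])
  show "Poly_Mapping.keys a \<subseteq> singular_simplex_set p X"
    using assms(1) by (simp add: singular_chain_def)
  fix a b
  assume "singular_chain p Y
      (chain_boundary (Suc p) (frag_extend s a) + frag_extend t a + frag_cmul (coeff_val r a) z - a)"
    and "singular_chain p Y
      (chain_boundary (Suc p) (frag_extend s b) + frag_extend t b + frag_cmul (coeff_val r b) z - b)"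
  from singular_chain_diff[OF this]
  show "singular_chain p Y (chain_boundary (Suc p) (frag_extend s (a - b)) + frag_extend t (a - b) +
      frag_cmul (coeff_val r (a - b)) z - (a - b))"
    by (simp add: frag_extend_diff chain_boundary_diff coeff_val_diff frag_cmul_diff_distrib algebra_simps)
qed (use assms(2) in simp_all)

lemma frag_extend_zero_on:
  assumes "singular_chain p X a" "\<And>\<sigma>. singular_simplex p X \<sigma> \<Longrightarrow> s \<sigma> = 0"
  shows "frag_extend s a = 0"
  using assms by (intro frag_extend_eq_0) (auto simp: singular_chain_def)

text \<open>Modulo the subspace the assumption says that \<open>d - e\<close> bounds
  \<open>c\<close>. In use, \<open>c\<close> is the multiple of \<open>z\<close> left over when a
  boundary is fed to the homotopy, and freeness then makes this multiple 0.\<close>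

lemma relboundary_of_homotopy_identity:
  assumes \<tau>: "singular_chain (Suc p) X d" and e: "singular_chain (Suc p) X e"
    and A: "singular_chain p (subtopology X S) (chain_boundary (Suc p) e + c - chain_boundary (Suc p) d)"
  shows "singular_relboundary p X S c"
proof -
  have "chain_boundary (Suc p) (d - e) - c = - (chain_boundary (Suc p) e + c - chain_boundary (Suc p) d)"
    by (simp add: chain_boundary_diff)
  then have "singular_chain p (subtopology X S) (chain_boundary (Suc p) (d - e) - c)"
    using A by (simp only: singular_chain_minus)
  then show ?thesis
    using singular_chain_diff[OF \<tau> e] by (auto simp: singular_relboundary_def mod_subset_def)
qed

text \<open>The relative chain complex is free, so a complex with the homology of a point in degree \<open>k\<close>
  is chain homotopy equivalent to it: \<open>r\<close> is the projection to the integers, \<open>s\<close> the homotopy.\<close>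

lemma chain_homotopy_exists:
  assumes triv: "\<And>q c. q \<noteq> k \<Longrightarrow> singular_relcycle q X S c \<Longrightarrow> singular_relboundary q X S c"
    and gen: "\<And>c. singular_relcycle k X S c \<Longrightarrow> \<exists>n. singular_relboundary k X S (c - frag_cmul n z)"
    and free: "\<And>n. singular_relboundary k X S (frag_cmul n z) \<Longrightarrow> n = 0"
  obtains s :: "nat \<Rightarrow> ((nat \<Rightarrow> real) \<Rightarrow> 'a) \<Rightarrow> 'a chain" and r :: "nat \<Rightarrow> ((nat \<Rightarrow> real) \<Rightarrow> 'a) \<Rightarrow> int"
  where "\<And>p \<sigma>. singular_simplex p X \<sigma> \<Longrightarrow> singular_chain (Suc p) X (s p \<sigma>)"
    "\<And>p \<sigma>. singular_simplex p (subtopology X S) \<sigma> \<Longrightarrow> s p \<sigma> = 0"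
    "\<And>p \<sigma>. singular_simplex p (subtopology X S) \<sigma> \<Longrightarrow> r p \<sigma> = 0"
    "\<And>p \<sigma>. p \<noteq> k \<Longrightarrow> r p \<sigma> = 0"
    "\<And>p \<sigma>. singular_simplex p X \<sigma> \<Longrightarrow> singular_chain p (subtopology X S)
       (chain_boundary (Suc p) (s p \<sigma>) + frag_extend (s (p - 1)) (chain_boundary p (frag_of \<sigma>)) +
        frag_cmul (r p \<sigma>) z - frag_of \<sigma>)"
proof -
  \<comment> \<open>The homotopy \<open>t\<close> of the preceding degree is a parameter, so that
    the construction becomes a recursion in which each stage refers only to the one before.\<close>
  define good where "good p s r t \<longleftrightarrow>
      (\<forall>\<sigma>. singular_simplex p X \<sigma> \<longrightarrow> singular_chain (Suc p) X (s \<sigma>)) \<and>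
      (\<forall>\<sigma>. singular_simplex p (subtopology X S) \<sigma> \<longrightarrow> s \<sigma> = 0 \<and> r \<sigma> = 0) \<and>
      (\<forall>\<sigma>. p \<noteq> k \<longrightarrow> r \<sigma> = 0) \<and>
      (\<forall>\<sigma>. singular_simplex p X \<sigma> \<longrightarrow> singular_chain p (subtopology X S)
         (chain_boundary (Suc p) (s \<sigma>) + frag_extend t (chain_boundary p (frag_of \<sigma>)) +
          frag_cmul (r \<sigma>) z - frag_of \<sigma>))"
    for p and s t :: "((nat \<Rightarrow> real) \<Rightarrow> 'a) \<Rightarrow> 'a chain" and r :: "((nat \<Rightarrow> real) \<Rightarrow> 'a) \<Rightarrow> int"
  have ex0: "\<exists>s r. good 0 s r (\<lambda>_. 0)"
    unfolding good_def
    by (rule chain_homotopy_step[OF triv gen])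
       (auto simp: singular_relcycle_def singular_chain_of chain_boundary_def)
  have step: "\<exists>s' r'. good (Suc p) s' r' s" if g: "good p s r t" for p s r t
  proof -
    have s: "\<And>\<sigma>. singular_simplex p X \<sigma> \<Longrightarrow> singular_chain (Suc p) X (s \<sigma>)"
      and s0: "\<And>\<sigma>. singular_simplex p (subtopology X S) \<sigma> \<Longrightarrow> s \<sigma> = 0"
      and rk: "\<And>\<sigma>. p \<noteq> k \<Longrightarrow> r \<sigma> = 0"
      and id: "\<And>\<sigma>. singular_simplex p X \<sigma> \<Longrightarrow> singular_chain p (subtopology X S)
         (chain_boundary (Suc p) (s \<sigma>) + frag_extend t (chain_boundary p (frag_of \<sigma>)) +
          frag_cmul (r \<sigma>) z - frag_of \<sigma>)"
      using g by (auto simp: good_def)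
    let ?t = "\<lambda>\<tau>. frag_extend s (chain_boundary (Suc p) (frag_of \<tau>))"
    have cyc: "singular_relcycle (Suc p) X S (frag_of \<tau> - ?t \<tau>)" if \<tau>: "singular_simplex (Suc p) X \<tau>" for \<tau>
    proof -
      let ?a = "chain_boundary (Suc p) (frag_of \<tau>)"
      have c\<tau>: "singular_chain (Suc p) X (frag_of \<tau>)" using \<tau> by (simp add: singular_chain_of)
      then have a: "singular_chain p X ?a" by (rule singular_chain_boundary_alt)
      have sa: "singular_chain (Suc p) X (frag_extend s ?a)"
        using a s by (intro singular_chain_extend) (auto simp: singular_chain_def)
      have "frag_extend (\<lambda>\<sigma>. frag_extend t (chain_boundary p (frag_of \<sigma>))) ?a = 0"
        by (simp add: chain_boundary_boundary_alt[OF c\<tau>] flip: frag_extend_chain_boundary)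
      then have A: "singular_chain p (subtopology X S)
          (chain_boundary (Suc p) (frag_extend s ?a) + frag_cmul (coeff_val r ?a) z - ?a)"
        using frag_extend_chain_identity[OF a id] by simp
      \<comment> \<open>By \<open>A\<close> the term \<open>frag_cmul (coeff_val r ?a) z\<close>
        would obstruct the cycle condition. In degree \<open>k\<close> it is itself a relative
        boundary, hence 0 by freeness; in other degrees \<open>r\<close> is 0.\<close>
      have "coeff_val r ?a = 0"
      proof (cases "p = k")
        case True
        have "singular_relboundary k X S (frag_cmul (coeff_val r ?a) z)"
          using relboundary_of_homotopy_identity[OF c\<tau> sa A] True by simp
        then show ?thesis by (rule free)
      next
        case False
        then show ?thesis by (simp add: coeff_val_def rk)
      qed
      with A have "singular_chain p (subtopology X S) (chain_boundary (Suc p) (frag_extend s ?a) - ?a)"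
        by simp
      from singular_chain_minus[THEN iffD2, OF this]
      show ?thesis
        using c\<tau> sa by (simp add: singular_relcycle_def mod_subset_def singular_chain_diff chain_boundary_diff)
    qed
    have zero: "?t \<tau> = 0" if "singular_simplex (Suc p) (subtopology X S) \<tau>" for \<tau>
      using that by (intro frag_extend_zero_on[OF singular_chain_boundary_alt s0])
        (auto simp: singular_chain_of)
    show ?thesis
      unfolding good_def by (rule chain_homotopy_step[OF triv gen cyc zero])
  qed
  define P where "P p sr \<longleftrightarrow> (\<exists>t. good p (fst sr) (snd sr) t) \<and> (p = 0 \<longrightarrow> good 0 (fst sr) (snd sr) (\<lambda>_. 0))" for p sr
  define Q where "Q p sr sr' \<longleftrightarrow> good (Suc p) (fst sr') (snd sr') (fst sr)"
    for p and sr sr' :: "(((nat \<Rightarrow> real) \<Rightarrow> 'a) \<Rightarrow> 'a chain) \<times> (((nat \<Rightarrow> real) \<Rightarrow> 'a) \<Rightarrow> int)"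
  have "\<exists>f. \<forall>n. P n (f n) \<and> Q n (f n) (f (Suc n))"
  proof (rule dependent_nat_choice)
    show "\<exists>sr. P 0 sr" using ex0 by (auto simp: P_def)
    show "\<exists>sr'. P (Suc p) sr' \<and> Q p sr sr'" if "P p sr" for sr p
      using that step[of p "fst sr" "snd sr"] by (force simp: P_def Q_def)
  qed
  then obtain f where f: "\<And>n. P n (f n)" "\<And>n. Q n (f n) (f (Suc n))" by blast
  \<comment> \<open>At \<open>p = 0\<close> the truncated \<open>p - 1\<close> is again 0. This is
    harmless: the boundary vanishes in degree 0, so every choice of the last argument of
    \<open>good\<close> gives the same condition.\<close>
  have "good p (fst (f p)) (snd (f p)) (fst (f (p - 1)))" for p
  proof (cases p)
    case 0
    then show ?thesis using f(1)[of 0] by (simp add: P_def good_def chain_boundary_def)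
  next
    case (Suc n)
    then show ?thesis using f(2)[of n] by (simp add: Q_def)
  qed
  then show thesis
    by (intro that[of "\<lambda>p. fst (f p)" "\<lambda>p. snd (f p)"]) (auto simp: good_def)
qed


section \<open>Homology with coefficients when the integral homology sits in one degree\<close>

lemma trivial_group_self_factor:
  assumes "comm_group G"
  shows "trivial_group (G Mod carrier G)"
proof -
  interpret comm_group G by fact
  have "carrier G \<lhd> G" by (simp add: normal_iff_subgroup subgroup_self)
  then have grp: "group (G Mod carrier G)" by (rule normal.factorgroup_is_group)
  have "trivial_group (G\<lparr>carrier := {\<one>\<^bsub>G\<^esub>}\<rparr>)"
    using subgroup_imp_group[OF triv_subgroup] by (simp add: trivial_group_def)
  moreover have "G Mod carrier G \<cong> G\<lparr>carrier := {\<one>\<^bsub>G\<^esub>}\<rparr>"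
    using self_factor_iso by (rule is_isoI)
  ultimately show ?thesis
    using isomorphic_group_triviality1 group.iso_sym[OF grp] grp by blast
qed

lemma comm_group_additive_group: "comm_group (additive_group TYPE('g::ab_group_add))"
  by (rule comm_groupI) (auto simp: additive_group_def add.assoc add.commute intro: exI[of _ "- _"])

lemma comm_group_coeff_relcycle:
  "comm_group \<lparr>carrier = Collect (coeff_relcycle p X S :: ('a, 'g::ab_group_add) coeff_chain \<Rightarrow> bool),
     monoid.mult = (+), one = 0\<rparr>"
proof (rule comm_groupI; clarsimp)
  fix c d :: "('a, 'g) coeff_chain"
  assume c: "coeff_relcycle p X S c"
  show "\<exists>d. coeff_relcycle p X S d \<and> d + c = 0"
    using c coeff_chain_diff[OF coeff_chain_0] coeff_boundary_diff[of p 0 c]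
    by (intro exI[of _ "- c"]) (force simp: coeff_relcycle_def)
  assume "coeff_relcycle p X S d"
  with c show "coeff_relcycle p X S (c + d)"
    by (simp add: coeff_relcycle_def coeff_chain_add coeff_boundary_add)
qed (auto simp: coeff_relcycle_def add.assoc add.commute)

text \<open>The homotopy identity holds simplex by simplex and therefore survives tensoring. For
  coefficients it shows that a relative cycle is a relative boundary exactly when
  \<open>coeff_val (r p)\<close> kills it. This map is 0 in degrees other than \<open>k\<close> and
  onto in degree \<open>k\<close>, where elementary tensors with \<open>z\<close> are preimages, so
  the first isomorphism theorem applies.\<close>

theorem coeff_homology_concentrated:
  fixes X :: "'a topology"
  assumes triv: "\<And>q c. q \<noteq> k \<Longrightarrow> singular_relcycle q X S c \<Longrightarrow> singular_relboundary q X S c"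
    and z: "singular_relcycle k X S z"
    and gen: "\<And>c. singular_relcycle k X S c \<Longrightarrow> \<exists>n. singular_relboundary k X S (c - frag_cmul n z)"
    and free: "\<And>n. singular_relboundary k X S (frag_cmul n z) \<Longrightarrow> n = 0"
  shows "q \<noteq> k \<Longrightarrow> trivial_group (coeff_homology_group TYPE('g::ab_group_add) q X S)"
    and "coeff_homology_group TYPE('g) k X S \<cong> additive_group TYPE('g)"
proof -
  obtain s :: "nat \<Rightarrow> ((nat \<Rightarrow> real) \<Rightarrow> 'a) \<Rightarrow> 'a chain" and r :: "nat \<Rightarrow> ((nat \<Rightarrow> real) \<Rightarrow> 'a) \<Rightarrow> int"
    where s: "\<And>p \<sigma>. singular_simplex p X \<sigma> \<Longrightarrow> singular_chain (Suc p) X (s p \<sigma>)"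
      and s0: "\<And>p \<sigma>. singular_simplex p (subtopology X S) \<sigma> \<Longrightarrow> s p \<sigma> = 0"
      and r0: "\<And>p \<sigma>. singular_simplex p (subtopology X S) \<sigma> \<Longrightarrow> r p \<sigma> = 0"
      and rk: "\<And>p \<sigma>. p \<noteq> k \<Longrightarrow> r p \<sigma> = 0"
      and id: "\<And>p \<sigma>. singular_simplex p X \<sigma> \<Longrightarrow> singular_chain p (subtopology X S)
         (chain_boundary (Suc p) (s p \<sigma>) + frag_extend (s (p - 1)) (chain_boundary p (frag_of \<sigma>)) +
          frag_cmul (r p \<sigma>) z - frag_of \<sigma>)"
    using chain_homotopy_exists[OF triv gen free] by blast
  have chain_id: "singular_chain p (subtopology X S)
      (chain_boundary (Suc p) (frag_extend (s p) a) + frag_extend (s (p - 1)) (chain_boundary p a) +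
       frag_cmul (coeff_val (r p) a) z - a)" if "singular_chain p X a" for p a
    using frag_extend_chain_identity[OF that id] by (simp flip: frag_extend_chain_boundary)
  have s_chain: "singular_chain (Suc p) X (frag_extend (s p) a)" if "singular_chain p X a" for p a
    using that s by (intro singular_chain_extend) (auto simp: singular_chain_def)
  \<comment> \<open>The homotopy identity is applied to \<open>z\<close> itself. The boundary of
    \<open>z\<close> lies in the subspace, where \<open>s\<close> is 0, so
    \<open>1 - coeff_val (r k) z\<close> times \<open>z\<close> is a relative boundary, and freeness
    makes the factor 0.\<close>
  have rz: "coeff_val (r k) z = 1"
  proof -
    have zk: "singular_chain k X z" "singular_chain (k - 1) (subtopology X S) (chain_boundary k z)"
      using z by (auto simp: singular_relcycle_def mod_subset_def)
    have "frag_extend (s (k - 1)) (chain_boundary k z) = 0"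
      by (rule frag_extend_zero_on[OF zk(2) s0])
    then have "singular_chain k (subtopology X S)
        (chain_boundary (Suc k) (frag_extend (s k) z) - frag_cmul (1 - coeff_val (r k) z) z)"
      using chain_id[OF zk(1)] by (simp add: frag_cmul_diff_distrib algebra_simps)
    then have "singular_relboundary k X S (frag_cmul (1 - coeff_val (r k) z) z)"
      using s_chain[OF zk(1)] by (auto simp: singular_relboundary_def mod_subset_def)
    from free[OF this] show ?thesis by simp
  qed
  \<comment> \<open>The argument of the inductive construction again: the homotopy identity at a
    boundary leaves a multiple of \<open>z\<close> that bounds.\<close>
  have r_boundary: "coeff_val (r p) (chain_boundary (Suc p) (frag_of \<tau>)) = 0"
    if \<tau>: "singular_simplex (Suc p) X \<tau>" for p \<tau>
  proof (cases "p = k")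
    case True
    let ?a = "chain_boundary (Suc p) (frag_of \<tau>)"
    have c\<tau>: "singular_chain (Suc p) X (frag_of \<tau>)" using \<tau> by (simp add: singular_chain_of)
    then have a: "singular_chain p X ?a" by (rule singular_chain_boundary_alt)
    have "singular_chain p (subtopology X S)
        (chain_boundary (Suc p) (frag_extend (s p) ?a) + frag_cmul (coeff_val (r p) ?a) z - ?a)"
      using chain_id[OF a] by (simp add: chain_boundary_boundary_alt[OF c\<tau>])
    then have "singular_relboundary p X S (frag_cmul (coeff_val (r p) ?a) z)"
      by (rule relboundary_of_homotopy_identity[OF c\<tau> s_chain[OF a]])
    then show ?thesis using free True by blast
  qed (simp add: coeff_val_def rk)

  have coeff_id: "coeff_chain p (subtopology X S)
      (coeff_boundary (Suc p) (coeff_extend (s p) c) + coeff_extend (s (p - 1)) (coeff_boundary p c) +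
       frag_tensor z (coeff_val (r p) c) - c)"
    if c: "coeff_chain p X c" for p and c :: "('a, 'g) coeff_chain"
  proof -
    have "coeff_chain p (subtopology X S) (coeff_extend (\<lambda>\<sigma>. chain_boundary (Suc p) (s p \<sigma>) +
        frag_extend (s (p - 1)) (chain_boundary p (frag_of \<sigma>)) + frag_cmul (r p \<sigma>) z - frag_of \<sigma>) c)"
      using c id by (intro coeff_chain_extend) (auto simp: coeff_chain_def)
    then show ?thesis
      by (simp add: coeff_extend_pointwise_add coeff_extend_pointwise_diff coeff_extend_cmul
          coeff_boundary_coeff_extend coeff_boundary_extend[of p] coeff_extend_extend)
  qed
  have coeff_s_chain: "coeff_chain (Suc p) X (coeff_extend (s p) c)"
    if "coeff_chain p X c" for p and c :: "('a, 'g) coeff_chain"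
    using that s by (intro coeff_chain_extend) (auto simp: coeff_chain_def)
  have coeff_s0: "coeff_extend (s p) c = 0" and coeff_r0: "coeff_val (r p) c = 0"
    if "coeff_chain p (subtopology X S) c" for p and c :: "('a, 'g) coeff_chain"
    unfolding coeff_extend_def coeff_val_def
    by (rule sum.neutral; use that s0 r0 in \<open>force simp: coeff_chain_def\<close>)+
  have coeff_r_boundary: "coeff_val (r p) (coeff_boundary (Suc p) d) = 0"
    if "coeff_chain (Suc p) X d" for p and d :: "('a, 'g) coeff_chain"
    unfolding coeff_boundary_extend coeff_val_extend
    unfolding coeff_val_def[of "\<lambda>\<tau>. coeff_val (r p) (chain_boundary (Suc p) (frag_of \<tau>))"]
    by (rule sum.neutral) (use that r_boundary in \<open>auto simp: coeff_chain_def\<close>)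
  have relboundary_iff: "coeff_relboundary p X S c \<longleftrightarrow> coeff_relcycle p X S c \<and> coeff_val (r p) c = 0"
    for p and c :: "('a, 'g) coeff_chain"
  proof
    assume "coeff_relboundary p X S c"
    then obtain d where d: "coeff_chain (Suc p) X d"
      and e: "coeff_chain p (subtopology X S) (coeff_boundary (Suc p) d - c)"
      by (auto simp: coeff_relboundary_def)
    define e' where "e' = coeff_boundary (Suc p) d - c"
    have c: "c = coeff_boundary (Suc p) d - e'" by (simp add: e'_def)
    have e': "coeff_chain p (subtopology X S) e'" using e by (simp add: e'_def)
    then have e'X: "coeff_chain p X e'"
      by (auto simp: coeff_chain_def singular_simplex_subtopology)
    have "coeff_chain p X c"
      unfolding c using coeff_chain_boundary[OF d] e'X by (intro coeff_chain_diff) auto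
    moreover have "coeff_chain (p - 1) (subtopology X S) (coeff_boundary p c)"
      unfolding c using coeff_chain_diff[OF coeff_chain_0 coeff_chain_boundary[OF e']]
      by (simp add: coeff_boundary_diff coeff_boundary_boundary[OF d])
    ultimately show "coeff_relcycle p X S c \<and> coeff_val (r p) c = 0"
      by (simp add: coeff_relcycle_def c coeff_val_diff coeff_r_boundary[OF d] coeff_r0[OF e'])
  next
    assume "coeff_relcycle p X S c \<and> coeff_val (r p) c = 0"
    then have c: "coeff_chain p X c" "coeff_chain (p - 1) (subtopology X S) (coeff_boundary p c)"
      and 0: "coeff_val (r p) c = 0"
      by (auto simp: coeff_relcycle_def)
    show "coeff_relboundary p X S c"
      using coeff_id[OF c(1)] coeff_s_chain[OF c(1)] coeff_s0[OF c(2)] 0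
      by (auto simp: coeff_relboundary_def)
  qed

  let ?Z = "\<lambda>p. \<lparr>carrier = Collect (coeff_relcycle p X S :: ('a, 'g) coeff_chain \<Rightarrow> bool),
      monoid.mult = (+), one = 0\<rparr>"
  have hom: "group_hom (?Z p) (additive_group TYPE('g)) (coeff_val (r p))" for p
    using comm_group_coeff_relcycle[of p X S, where 'g='g] comm_group_additive_group[where 'g='g]
    by (auto simp: group_hom_def group_hom_axioms_def comm_group_def hom_def additive_group_def coeff_val_add)
  have ker: "kernel (?Z p) (additive_group TYPE('g)) (coeff_val (r p)) = Collect (coeff_relboundary p X S)" for p
    by (auto simp: kernel_def relboundary_iff additive_group_def)
  show "coeff_homology_group TYPE('g) k X S \<cong> additive_group TYPE('g)"
  proof -
    have "coeff_val (r k) ` carrier (?Z k) = carrier (additive_group TYPE('g))"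
    proof -
      have "coeff_relcycle k X S (frag_tensor z g)" "coeff_val (r k) (frag_tensor z g) = g" for g :: 'g
        using z rz by (auto simp: coeff_relcycle_def singular_relcycle_def mod_subset_def
            coeff_boundary_frag_tensor coeff_chain_frag_tensor coeff_val_frag_tensor)
      then have "g \<in> coeff_val (r k) ` carrier (?Z k)" for g :: 'g
        by (intro image_eqI[where x="frag_tensor z g"]) auto
      then show ?thesis by (auto simp: additive_group_def)
    qed
    from group_hom.FactGroup_iso[OF hom this] show ?thesis
      by (simp add: coeff_homology_group_def ker)
  qed
  assume q: "q \<noteq> k"
  have "Collect (coeff_relboundary q X S) = carrier (?Z q)"
    by (auto simp: relboundary_iff coeff_val_def rk[OF q])
  then have "coeff_homology_group TYPE('g) q X S = ?Z q Mod carrier (?Z q)"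
    by (simp add: coeff_homology_group_def)
  then show "trivial_group (coeff_homology_group TYPE('g) q X S)"
    using trivial_group_self_factor[OF comm_group_coeff_relcycle] by simp
qed


section \<open>From integral homology groups to a generating cycle\<close>

lemma homologous_rel_set_hom:
  "homologous_rel_set p X S \<in> hom (relcycle_group p X S) (relative_homology_group (int p) X S)"
  using normal.r_coset_hom_Mod[OF normal_subgroup_singular_relboundary_relcycle, of p X S]
  by (simp add: nontrivial_relative_homology_group right_coset_singular_relboundary)

text \<open>The isomorphism is pulled back to an additive map \<phi> on relative cycles that
  vanishes precisely on relative boundaries. Any \<open>z\<close> with \<open>\<phi> z = 1\<close>
  generates: \<open>\<phi> c\<close> is the multiple of \<open>z\<close> homologous to
  \<open>c\<close>, and \<phi> detects whether a multiple bounds.\<close>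

theorem coeff_homology_of_integer_homology:
  assumes triv: "\<And>q. q \<noteq> k \<Longrightarrow> trivial_group (relative_homology_group (int q) X S)"
    and iso: "relative_homology_group (int k) X S \<cong> integer_group"
  shows "q \<noteq> k \<Longrightarrow> trivial_group (coeff_homology_group TYPE('g::ab_group_add) q X S)"
    and "coeff_homology_group TYPE('g) k X S \<cong> additive_group TYPE('g)"
proof -
  obtain g where g: "g \<in> Group.iso (relative_homology_group (int k) X S) integer_group"
    using iso by (auto simp: is_iso_def)
  define \<phi> where "\<phi> c = g (homologous_rel_set k X S c)" for c
  have "\<phi> \<in> hom (relcycle_group k X S) integer_group"
    using hom_compose[OF homologous_rel_set_hom iso_imp_homomorphism[OF g]] by (simp add: \<phi>_def[abs_def] o_def)
  then have add: "\<phi> (c + d) = \<phi> c + \<phi> d"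
    if "singular_relcycle k X S c" "singular_relcycle k X S d" for c d
    using that by (auto simp: hom_def)
  have surj: "\<exists>c. singular_relcycle k X S c \<and> \<phi> c = n" for n
  proof -
    have "n \<in> g ` carrier (relative_homology_group (int k) X S)"
      using g by (simp add: iso_def bij_betw_def)
    then show ?thesis by (auto simp: carrier_relative_homology_group \<phi>_def)
  qed
  have zero: "singular_relboundary k X S c" if "singular_relcycle k X S c" "\<phi> c = 0" for c
  proof -
    interpret gh: group_hom "relative_homology_group (int k) X S" integer_group g
      using iso_imp_homomorphism[OF g] by (simp add: group_hom_def group_hom_axioms_def)
    have "g (homologous_rel_set k X S c) = g (\<one>\<^bsub>relative_homology_group (int k) X S\<^esub>)"
      using that(2) gh.hom_one by (simp add: \<phi>_def)
    moreover have "homologous_rel_set k X S c \<in> carrier (relative_homology_group (int k) X S)"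
      using that(1) by (auto simp: carrier_relative_homology_group)
    ultimately have "homologous_rel_set k X S c = \<one>\<^bsub>relative_homology_group (int k) X S\<^esub>"
      using g gh.G.one_closed by (auto simp: iso_def bij_betw_def dest: inj_onD)
    then show ?thesis by (simp add: homologous_rel_set_eq_relboundary)
  qed
  have zero': "\<phi> c = 0" if "singular_relboundary k X S c" for c
  proof -
    interpret gh: group_hom "relative_homology_group (int k) X S" integer_group g
      using iso_imp_homomorphism[OF g] by (simp add: group_hom_def group_hom_axioms_def)
    have "homologous_rel_set k X S c = \<one>\<^bsub>relative_homology_group (int k) X S\<^esub>"
      using that by (simp add: homologous_rel_set_eq_relboundary)
    then show ?thesis using gh.hom_one by (simp add: \<phi>_def)
  qed
  obtain z where z: "singular_relcycle k X S z" "\<phi> z = 1" using surj by blast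
  have \<phi>z: "\<phi> (frag_cmul n z) = n" for n
  proof (induction n rule: int_induct[where k=0])
    case base
    then show ?case using add[of 0 0] by simp
  next
    case (step1 i)
    then show ?case
      using add[OF singular_relcycle_cmul[OF z(1)] z(1), of i] z(2) frag_cmul_distrib[of i 1 z] by simp
  next
    case (step2 i)
    have "frag_cmul i z = frag_cmul (i - 1) z + z"
      using frag_cmul_distrib[of "i - 1" 1 z] by simp
    then show ?case
      using add[OF singular_relcycle_cmul[OF z(1)] z(1), of "i - 1"] z(2) step2 by simp
  qed
  have gen: "\<exists>n. singular_relboundary k X S (c - frag_cmul n z)" if c: "singular_relcycle k X S c" for c
  proof -
    let ?n = "\<phi> c"
    have d: "singular_relcycle k X S (c - frag_cmul ?n z)"
      by (intro singular_relcycle_diff c singular_relcycle_cmul z)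
    have "\<phi> c = \<phi> (c - frag_cmul ?n z) + \<phi> (frag_cmul ?n z)"
      using add[OF d singular_relcycle_cmul[OF z(1)], of ?n] by simp
    then have "\<phi> (c - frag_cmul ?n z) = 0" by (simp add: \<phi>z)
    with zero[OF d] show ?thesis by blast
  qed
  have free: "n = 0" if "singular_relboundary k X S (frag_cmul n z)" for n
    using zero'[OF that] by (simp add: \<phi>z)
  have triv': "singular_relboundary q X S c" if "q \<noteq> k" "singular_relcycle q X S c" for q c
  proof -
    have "homologous_rel_set q X S c \<in> carrier (relative_homology_group (int q) X S)"
      using that(2) by (auto simp: carrier_relative_homology_group)
    then have "homologous_rel_set q X S c = singular_relboundary_set q X S"
      using triv[OF that(1)] by (simp add: trivial_group_def)
    then show ?thesis by (simp only: homologous_rel_set_eq_relboundary)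
  qed
  show "q \<noteq> k \<Longrightarrow> trivial_group (coeff_homology_group TYPE('g) q X S)"
    by (rule coeff_homology_concentrated(1)[OF triv' z(1) gen free])
  show "coeff_homology_group TYPE('g) k X S \<cong> additive_group TYPE('g)"
    by (rule coeff_homology_concentrated(2)[OF triv' z(1) gen free])
qed

subsection \<open>Sublevel sets near a nondegenerate critical point\<close>

text \<open>Adding \<open>k\<close> dimensions around a fixed closed set shifts the degree by
  \<open>k\<close>. Started at the one-point space, where the complement of the origin is empty,
  this identifies degree \<open>q\<close> of the pair with degree \<open>q - k\<close> of a point;
  the subtraction is in the integers, so negative degrees are covered.\<close>

lemma relative_homology_Euclidean_origin:
  fixes q k :: nat
  defines "E \<equiv> relative_homology_group (int q) (Euclidean_space k) (topspace (Euclidean_space k) - {\<lambda>_. 0})"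
  shows "q \<noteq> k \<Longrightarrow> trivial_group E" and "q = k \<Longrightarrow> E \<cong> integer_group"
proof -
  have top0: "topspace (Euclidean_space 0) = {\<lambda>_. 0}"
    by (auto simp: topspace_Euclidean_space)
  have "closedin (Euclidean_space 0) {\<lambda>_. 0}"
    using closedin_topspace[of "Euclidean_space 0"] by (simp add: top0)
  from relative_homology_group_Euclidean_complement_step[OF this, of "int q - int k" k]
  have iso: "homology_group (int q - int k) (Euclidean_space 0) \<cong> E"
    by (simp add: top0 E_def)
  show "trivial_group E" if "q \<noteq> k"
  proof (rule isomorphic_group_triviality1[OF iso])
    show "trivial_group (homology_group (int q - int k) (Euclidean_space 0))"
      using homology_dimension_axiom[OF top0, of "int q - int k"] that by simp
  qed (simp add: E_def)
  show "E \<cong> integer_group" if "q = k"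
    using iso homology_coefficients[OF top0] group.iso_sym[OF group_relative_homology_group iso]
    by (metis that diff_self iso_trans)
qed

text \<open>Excision of \<open>S - B\<close>, which is closed in \<open>S\<close> and contained in
  the open set \<open>S - {a}\<close>. It frees the critical group from the given neighbourhood and,
  on the other side, lets a small piece of \<open>V\<close> be replaced by all of
  \<open>V\<close>.\<close>

lemma relative_homology_punctured_local:
  fixes S B :: "'a::t1_space set"
  assumes "open B" "a \<in> B"
  shows "relative_homology_group p (top_of_set (S \<inter> B)) (S \<inter> B - {a}) \<cong>
    relative_homology_group p (top_of_set S) (S - {a})"
proof -
  have "closedin (top_of_set S) (S - B)"
    using assms(1) by (simp add: closedin_closed_Int Diff_eq closed_Compl)
  moreover have "openin (top_of_set S) (S - {a})"
    unfolding Diff_eq by (intro openin_open_Int open_Compl closed_singleton)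
  ultimately have "top_of_set S closure_of (S - B) \<subseteq> top_of_set S interior_of (S - {a})"
    using assms(2) by (auto simp: closure_of_closedin interior_of_openin)
  from homology_excision_axiom[OF this, of S p]
  have "relative_homology_group p (subtopology (top_of_set S) (S - (S - B))) (S - {a} - (S - B)) \<cong>
      relative_homology_group p (subtopology (top_of_set S) S) (S - {a})"
    by (auto intro: is_isoI)
  moreover have "S - (S - B) = S \<inter> B" "S - {a} - (S - B) = S \<inter> B - {a}" by auto
  ultimately show ?thesis by (simp add: subtopology_subtopology Int_absorb1)
qed

text \<open>The functionals \<open>f i\<close> are dual to the vectors \<open>e i\<close>, hence are
  continuous coordinates on the range of the projection, with the linear combination map as
  continuous inverse.\<close>

lemma relative_homology_frame:
  fixes e :: "nat \<Rightarrow> 'a::real_normed_vector" and f :: "nat \<Rightarrow> 'a \<Rightarrow> real"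
  assumes f: "\<And>i. i < k \<Longrightarrow> bounded_linear (f i)"
    and fe: "\<And>i j. i < k \<Longrightarrow> j < k \<Longrightarrow> f i (e j) = (if i = j then 1 else 0)"
    and V: "V = range (\<lambda>u. \<Sum>i<k. f i u *\<^sub>R e i)"
  shows "relative_homology_group p (top_of_set V) (V - {0}) \<cong>
    relative_homology_group p (Euclidean_space k) (topspace (Euclidean_space k) - {\<lambda>_. 0})"
proof -
  define F where "F u i = (if i < k then f i u else 0)" for u i
  define H where "H x = (\<Sum>i<k. x i *\<^sub>R e i)" for x :: "nat \<Rightarrow> real"
  have E: "Euclidean_space k = top_of_set {x. \<forall>i\<ge>k. x i = 0}"
    by (simp add: Euclidean_space_def euclidean_product_topology)
  have fH: "f i (H x) = x i" if "i < k" for i x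
  proof -
    interpret bounded_linear "f i" by (rule f[OF that])
    have "f i (H x) = (\<Sum>j<k. if j = i then x j else 0)"
      unfolding H_def sum scaleR by (intro sum.cong) (use that fe in auto)
    then show ?thesis using that by simp
  qed
  have FH: "F (H x) = x" if "\<forall>i\<ge>k. x i = 0" for x
    using that fH by (auto simp: F_def fun_eq_iff)
  have HV: "H x \<in> V" for x
  proof -
    have "(\<Sum>i<k. f i (H x) *\<^sub>R e i) = (\<Sum>i<k. x i *\<^sub>R e i)" by (simp add: fH)
    then have "H x = (\<Sum>i<k. f i (H x) *\<^sub>R e i)" by (simp only: H_def)
    then show ?thesis unfolding V by (rule range_eqI)
  qed
  have HF: "H (F u) = u" if uV: "u \<in> V" for u
  proof -
    obtain u' where "u = (\<Sum>i<k. f i u' *\<^sub>R e i)" using uV V by blast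
    then have u: "u = H (F u')" by (simp add: H_def F_def)
    show ?thesis unfolding u by (subst FH) (auto simp: F_def)
  qed
  have F0: "F 0 = (\<lambda>_. 0)"
    using f by (auto simp: F_def fun_eq_iff bounded_linear_def linear_0)
  have H0: "H (\<lambda>_. 0) = 0" by (simp add: H_def)
  have contF: "continuous_on V F"
  proof (rule continuous_on_coordinatewise_then_product)
    show "continuous_on V (\<lambda>u. F u i)" for i
      using linear_continuous_on[OF f] by (cases "i < k") (auto simp: F_def)
  qed
  have contH: "continuous_on T H" for T
    unfolding H_def
    by (intro continuous_intros continuous_on_subset[OF continuous_on_product_coordinates]) auto
  have "homeomorphic_maps (top_of_set V) (Euclidean_space k) F H"
    unfolding homeomorphic_maps_def E using contF contH HV HF FH by (auto simp: F_def)
  then have "group_isomorphisms (relative_homology_group p (top_of_set V) (V - {0}))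
      (relative_homology_group p (Euclidean_space k) (topspace (Euclidean_space k) - {\<lambda>_. 0}))
      (hom_induced p (top_of_set V) (V - {0}) (Euclidean_space k) (topspace (Euclidean_space k) - {\<lambda>_. 0}) F)
      (hom_induced p (Euclidean_space k) (topspace (Euclidean_space k) - {\<lambda>_. 0}) (top_of_set V) (V - {0}) H)"
  proof (rule homeomorphic_maps_relative_homology_group_isomorphisms)
    show "F \<in> V - {0} \<rightarrow> topspace (Euclidean_space k) - {\<lambda>_. 0}"
    proof (rule Pi_I)
      fix u assume u: "u \<in> V - {0}"
      have "F u \<noteq> (\<lambda>_. 0)"
      proof
        assume "F u = (\<lambda>_. 0)"
        then show False using HF[of u] u H0 by simp
      qed
      then show "F u \<in> topspace (Euclidean_space k) - {\<lambda>_. 0}"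
        by (simp add: topspace_Euclidean_space F_def)
    qed
    show "H \<in> topspace (Euclidean_space k) - {\<lambda>_. 0} \<rightarrow> V - {0}"
    proof (rule Pi_I)
      fix x assume x: "x \<in> topspace (Euclidean_space k) - {\<lambda>_. 0}"
      have "H x \<noteq> 0"
      proof
        assume "H x = 0"
        then show False using FH[of x] x F0 by (simp add: topspace_Euclidean_space)
      qed
      then show "H x \<in> V - {0}" using HV by simp
    qed
  qed
  then show ?thesis
    using group_isomorphisms_imp_iso is_isoI by blast
qed

text \<open>Positivity at \<open>s\<close> puts the point in the cone
  \<open>norm w \<le> K * (s * norm v)\<close>. The cone contains the rest of the segment, and
  inside it the points have size at most \<open>(1 + K) * (t * norm v)\<close>. So \<open>G\<close>
  changes by at most \<open>\<epsilon> * (1 + K)\<close> times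
  \<open>t * (t - s) * (norm v)\<^sup>2\<close>, which the growth of \<open>Q\<close> outweighs by
  the last bound on \<epsilon>.\<close>

lemma sublevel_split_monotone:
  fixes v w :: "'a::real_normed_vector" and Q G :: "'a \<Rightarrow> real"
  assumes Q: "\<And>s. Q (s *\<^sub>R v + w) = s\<^sup>2 * Q v + Q w"
      "c * (norm v)\<^sup>2 \<le> Q v" "Q v \<le> C * (norm v)\<^sup>2" "Q w \<le> - c * (norm w)\<^sup>2"
    and G: "\<And>u u'. norm u \<le> \<delta> \<Longrightarrow> norm u' \<le> \<delta> \<Longrightarrow> \<bar>G u - G u'\<bar> \<le> \<epsilon> * max (norm u) (norm u') * norm (u - u')"
      "G 0 = 0"
    and c: "c > 0" "C > 0" and \<epsilon>: "0 \<le> \<epsilon>" "\<epsilon> \<le> c / 4" "\<epsilon> * (1 + sqrt ((2 * C + c) / c)) \<le> c"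
    and small: "norm v + norm w \<le> \<delta>" and st: "0 \<le> s" "s \<le> t" "t \<le> 1"
    and pos: "Q (s *\<^sub>R v + w) + G (s *\<^sub>R v + w) > 0"
  shows "Q (t *\<^sub>R v + w) + G (t *\<^sub>R v + w) > 0"
proof -
  define a d K where "a = norm v" and "d = norm w" and "K = sqrt ((2 * C + c) / c)"
  have K: "K \<ge> 0" "K\<^sup>2 = (2 * C + c) / c" using c by (simp_all add: K_def)
  have ad: "a \<ge> 0" "d \<ge> 0" by (simp_all add: a_def d_def)
  have nrm: "norm (r *\<^sub>R v + w) \<le> r * a + d" if "0 \<le> r" for r
    using norm_triangle_ineq[of "r *\<^sub>R v" w] that by (simp add: a_def d_def)
  have nrm\<delta>: "norm (r *\<^sub>R v + w) \<le> \<delta>" if "0 \<le> r" "r \<le> 1" for r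
    using nrm[OF that(1)] mult_right_mono[OF that(2) ad(1)] small by (simp add: a_def d_def)
  have "G (s *\<^sub>R v + w) \<le> \<epsilon> * (norm (s *\<^sub>R v + w))\<^sup>2"
    using G(1)[of "s *\<^sub>R v + w" 0] nrm\<delta>[of s] st G(2) order_trans[OF norm_ge_zero nrm\<delta>[of s]]
    by (simp add: power2_eq_square max_absorb1 mult.assoc)
  also have "\<dots> \<le> \<epsilon> * (s * a + d)\<^sup>2"
    using nrm[OF st(1)] \<epsilon> by (intro mult_left_mono power_mono) auto
  also have "\<dots> \<le> \<epsilon> * (2 * (s * a)\<^sup>2 + 2 * d\<^sup>2)"
    using sum_squares_bound[of "s * a" d] \<epsilon> by (intro mult_left_mono) (auto simp: power2_sum)
  also have "\<dots> \<le> c / 4 * (2 * (s * a)\<^sup>2 + 2 * d\<^sup>2)"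
    using \<epsilon> by (intro mult_right_mono) auto
  finally have G1: "G (s *\<^sub>R v + w) \<le> c / 4 * (2 * (s * a)\<^sup>2 + 2 * d\<^sup>2)" .
  have "s\<^sup>2 * Q v \<le> s\<^sup>2 * (C * a\<^sup>2)"
    using Q(3) by (intro mult_left_mono) (auto simp: a_def)
  then have "0 < C * (s * a)\<^sup>2 - c * d\<^sup>2 + c / 4 * (2 * (s * a)\<^sup>2 + 2 * d\<^sup>2)"
    using pos Q(1)[of s] Q(4) G1 by (simp add: d_def power_mult_distrib mult.left_commute)
  \<comment> \<open>With \<epsilon> at most \<open>c / 4\<close>, the remainder consumes only half
    of the negative term \<open>c * d\<^sup>2\<close>; doubling what is left gives the aperture
    \<open>K\<^sup>2 = (2 * C + c) / c\<close> of the cone.\<close>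
  then have "c * d\<^sup>2 \<le> (2 * C + c) * (s * a)\<^sup>2"
    by (simp add: algebra_simps)
  then have "d\<^sup>2 \<le> (K * (s * a))\<^sup>2"
    using c by (simp add: power_mult_distrib K(2) field_simps)
  then have d: "d \<le> K * (s * a)"
    by (rule power2_le_imp_le) (use K st ad in simp)
  have "s * a \<le> t * a" using st ad by (intro mult_right_mono)
  then have d': "d \<le> K * (t * a)"
    using d mult_left_mono[of "s * a" "t * a" K] K by linarith
  have diff: "t *\<^sub>R v + w - (s *\<^sub>R v + w) = (t - s) *\<^sub>R v" by (simp add: algebra_simps)
  have "\<bar>G (t *\<^sub>R v + w) - G (s *\<^sub>R v + w)\<bar> \<le>
      \<epsilon> * max (norm (t *\<^sub>R v + w)) (norm (s *\<^sub>R v + w)) * ((t - s) * a)"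
    using G(1)[OF nrm\<delta>[of t] nrm\<delta>[of s]] st unfolding diff by (simp add: a_def)
  also have "\<dots> \<le> \<epsilon> * ((1 + K) * (t * a)) * ((t - s) * a)"
  proof (intro mult_right_mono mult_left_mono)
    show "max (norm (t *\<^sub>R v + w)) (norm (s *\<^sub>R v + w)) \<le> (1 + K) * (t * a)"
      using nrm[of t] nrm[of s] st d' \<open>s * a \<le> t * a\<close> by (simp add: distrib_right)
  qed (use \<epsilon> st ad in auto)
  also have "\<dots> = \<epsilon> * (1 + K) * (t * (t - s) * a\<^sup>2)"
    by (simp add: power2_eq_square)
  also have "\<dots> \<le> c * (t * (t - s) * a\<^sup>2)"
    using \<epsilon>(3) st by (intro mult_right_mono) (auto simp: K_def)
  finally have G2: "G (s *\<^sub>R v + w) - G (t *\<^sub>R v + w) \<le> c * (t * (t - s) * a\<^sup>2)" by linarith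
  \<comment> \<open>Replacing the factor \<open>t\<close> by \<open>t + s\<close> turns the bound on
    the remainder into the increment \<open>t\<^sup>2 - s\<^sup>2\<close> of the form.\<close>
  have "c * (t * (t - s) * a\<^sup>2) \<le> c * ((t + s) * (t - s) * a\<^sup>2)"
    using st c by (intro mult_left_mono mult_right_mono) auto
  also have "\<dots> = (t\<^sup>2 - s\<^sup>2) * (c * a\<^sup>2)"
    by (simp add: power2_eq_square algebra_simps)
  also have "\<dots> \<le> (t\<^sup>2 - s\<^sup>2) * Q v"
    using Q(2) st by (intro mult_left_mono) (auto simp: a_def power_mono)
  finally have "G (s *\<^sub>R v + w) - G (t *\<^sub>R v + w) \<le> (t\<^sup>2 - s\<^sup>2) * Q v"
    using G2 by linarith
  then show ?thesis
    using pos Q(1)[of s] Q(1)[of t] by (simp add: left_diff_distrib)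
qed


text \<open>Three isomorphisms: excision from \<open>U\<close> to \<open>B\<close>, deformation of
  \<open>S\<close> onto \<open>T\<close> along \<open>P\<close>, and excision backwards from
  \<open>T\<close> to the whole range of \<open>P\<close>. Punctured sets are respected because the
  functional is positive on the kernel of \<open>P\<close> near 0 except at 0 itself: a nonzero
  point of \<open>S\<close> has a nonzero projection, and the homotopy keeps this projection
  fixed.\<close>

theorem sublevel_homology:
  fixes P :: "'a::real_normed_vector \<Rightarrow> 'a" and Q G \<Psi> :: "'a \<Rightarrow> real"
  assumes P: "bounded_linear P" "\<And>u. P (P u) = P u"
    and Q: "\<And>s v w. P v = 0 \<Longrightarrow> P w = w \<Longrightarrow> Q (s *\<^sub>R v + w) = s\<^sup>2 * Q v + Q w"
      "\<And>v. P v = 0 \<Longrightarrow> c * (norm v)\<^sup>2 \<le> Q v" "\<And>v. Q v \<le> C * (norm v)\<^sup>2"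
      "\<And>w. P w = w \<Longrightarrow> Q w \<le> - c * (norm w)\<^sup>2"
    and c: "c > 0" "C > 0"
    and G: "\<And>\<epsilon>. \<epsilon> > 0 \<Longrightarrow> \<exists>\<delta>>0. \<forall>u u'. norm u \<le> \<delta> \<longrightarrow> norm u' \<le> \<delta> \<longrightarrow>
        \<bar>G u - G u'\<bar> \<le> \<epsilon> * max (norm u) (norm u') * norm (u - u')"
      "G 0 = 0"
    and \<Psi>: "\<And>u. \<Psi> u = Q u + G u"
    and U: "0 \<in> interior U"
  shows "relative_homology_group p (top_of_set ({u. \<Psi> u \<le> 0} \<inter> U)) ({u. \<Psi> u \<le> 0} \<inter> U - {0}) \<cong>
    relative_homology_group p (top_of_set (range P)) (range P - {0})"
proof -
  interpret P: bounded_linear P by fact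
  define K where "K = 1 + sqrt ((2 * C + c) / c)"
  have "K > 0" using c by (simp add: K_def add_pos_nonneg)
  \<comment> \<open>Both bounds are those of the propagation lemma; the first also gives
    \<open>\<epsilon> < c\<close>, which makes the signs of the functional on the two summands
    strict.\<close>
  define \<epsilon> where "\<epsilon> = min (c / 4) (c / K)"
  have \<epsilon>: "\<epsilon> > 0" "\<epsilon> \<le> c / 4" "\<epsilon> * K \<le> c" "\<epsilon> < c"
    using c \<open>K > 0\<close> by (auto simp: \<epsilon>_def min_def field_simps)
  obtain \<delta> where \<delta>: "\<delta> > 0" "\<And>u u'. norm u \<le> \<delta> \<Longrightarrow> norm u' \<le> \<delta> \<Longrightarrow>
      \<bar>G u - G u'\<bar> \<le> \<epsilon> * max (norm u) (norm u') * norm (u - u')"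
    using G(1)[OF \<epsilon>(1)] by blast
  obtain r where r: "r > 0" "r \<le> \<delta>" "ball 0 r \<subseteq> U"
  proof -
    obtain r' where "r' > 0" "ball 0 r' \<subseteq> U" using U mem_interior by blast
    then show ?thesis using \<delta>(1) by (intro that[of "min r' \<delta>"]) auto
  qed
  \<comment> \<open>The sum of the two norms, unlike \<open>norm u\<close>, cannot increase when
    \<open>u - P u\<close> is scaled down and \<open>P u\<close> is kept. It bounds
    \<open>norm u\<close>, so \<open>B\<close> lies in the ball of radius \<open>r\<close>.\<close>
  define B where "B = {u. norm (u - P u) + norm (P u) < r}"
  have BU: "B \<subseteq> U"
  proof
    fix u assume "u \<in> B"
    then have "norm u < r"
      using norm_triangle_ineq[of "u - P u" "P u"] by (simp add: B_def)
    with r show "u \<in> U" by (auto simp: subset_iff)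
  qed
  have B: "open B" "0 \<in> B"
    unfolding B_def by (intro open_Collect_less continuous_intros P.continuous_on) (use r in \<open>auto simp: P.zero\<close>)
  define S where "S = {u. \<Psi> u \<le> 0} \<inter> B"
  define T where "T = range P \<inter> B"
  have PT: "P w = w" if "w \<in> T" for w using that P(2) by (auto simp: T_def)
  have small: "norm u \<le> \<delta>" if "norm u < r" for u :: 'a using that r by simp
  have G0: "\<bar>G u\<bar> \<le> \<epsilon> * (norm u)\<^sup>2" if "norm u < r" for u
    using \<delta>(2)[OF small[OF that], of 0] \<delta>(1) G(2) by (simp add: power2_eq_square max_absorb1 mult.assoc)
  \<comment> \<open>The scalar 2 gives \<open>Q 0 = 5 * Q 0\<close>.\<close>
  have Q0: "Q 0 = 0" using Q(1)[of 0 0 2] by (simp add: P.zero)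
  have neg: "\<Psi> w < 0" if "w \<in> T" "w \<noteq> 0" for w
  proof -
    have "norm w < r" using that PT[OF that(1)] by (auto simp: T_def B_def)
    then have "\<Psi> w \<le> - c * (norm w)\<^sup>2 + \<epsilon> * (norm w)\<^sup>2"
      using Q(4)[OF PT[OF that(1)]] G0[of w] by (simp add: \<Psi>)
    also have "\<dots> = - ((c - \<epsilon>) * (norm w)\<^sup>2)" by (simp add: algebra_simps)
    also have "\<dots> < 0" using \<epsilon> that by simp
    finally show ?thesis .
  qed
  have pos: "\<Psi> v > 0" if "P v = 0" "norm v < r" "v \<noteq> 0" for v
  proof -
    have "0 < (c - \<epsilon>) * (norm v)\<^sup>2" using \<epsilon> that by simp
    also have "\<dots> \<le> \<Psi> v" using Q(2)[OF that(1)] G0[OF that(2)] by (simp add: \<Psi> algebra_simps)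
    finally show ?thesis .
  qed
  have TS: "T \<subseteq> S"
  proof
    fix w assume "w \<in> T"
    then show "w \<in> S" using neg[of w] by (cases "w = 0") (auto simp: S_def T_def \<Psi> G Q0)
  qed
  have P0: "P u \<noteq> 0" if "u \<in> S" "u \<noteq> 0" for u
    using pos[of u] that by (auto simp: S_def B_def)
  have seg: "s *\<^sub>R (u - P u) + P u \<in> S" if u: "u \<in> S" and s: "0 \<le> s" "s \<le> 1" for u s
  proof -
    let ?v = "u - P u" and ?w = "P u"
    have vw: "P ?v = 0" "P ?w = ?w" by (simp_all add: P.diff P(2))
    then have P': "P (s *\<^sub>R ?v + ?w) = ?w" by (simp add: P.add P.scaleR)
    have uB: "norm ?v + norm ?w < r" using u by (simp add: S_def B_def)
    have "norm (s *\<^sub>R ?v) \<le> norm ?v" using s by (simp add: mult_left_le_one_le)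
    then have inB: "s *\<^sub>R ?v + ?w \<in> B" using uB by (simp add: B_def P')
    \<comment> \<open>A positive value on the segment would propagate to its endpoint
      \<open>u\<close>, which lies in the sublevel set.\<close>
    have "\<not> \<Psi> (s *\<^sub>R ?v + ?w) > 0"
    proof
      assume p: "\<Psi> (s *\<^sub>R ?v + ?w) > 0"
      have "Q (1 *\<^sub>R ?v + ?w) + G (1 *\<^sub>R ?v + ?w) > 0"
      proof (rule sublevel_split_monotone[where s=s and c=c and C=C and \<delta>=\<delta> and \<epsilon>=\<epsilon>])
        show "norm ?v + norm ?w \<le> \<delta>" using uB r by simp
        show "\<epsilon> * (1 + sqrt ((2 * C + c) / c)) \<le> c" using \<epsilon>(3) by (simp add: K_def)
      qed (use vw Q c \<epsilon> \<delta>(2) G(2) s p in \<open>auto simp: \<Psi>\<close>)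
      then have "\<Psi> u > 0" by (simp add: \<Psi>)
      then show False using u by (simp add: S_def)
    qed
    then show ?thesis using inB by (simp add: S_def)
  qed
  have iso: "relative_homology_group p (top_of_set S) (S - {0}) \<cong> relative_homology_group p (top_of_set T) (T - {0})"
  proof (rule deformation_retract_imp_isomorphic_relative_homology_groups[where r=P])
    have PST: "P u \<in> T" if "u \<in> S" for u
    proof -
      have "P u \<in> S" using seg[OF that, of 0] by simp
      then show ?thesis by (auto simp: T_def S_def)
    qed
    show "retraction_maps (top_of_set S) (top_of_set T) P id"
      unfolding retraction_maps_def using PST TS PT by (auto intro: P.continuous_on continuous_on_id)
    show "P \<in> S - {0} \<rightarrow> T - {0}" using PST P0 by auto
    show "homotopic_with (\<lambda>h. h ` (S - {0}) \<subseteq> S - {0}) (top_of_set S) (top_of_set S) P id"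
      unfolding homotopic_with_def
    proof (intro exI[of _ "\<lambda>(s, u). s *\<^sub>R (u - P u) + P u"] conjI ballI allI)
      show "continuous_map (prod_topology (top_of_set {0..1}) (top_of_set S)) (top_of_set S)
          (\<lambda>(s, u). s *\<^sub>R (u - P u) + P u)"
        using seg by (auto simp: case_prod_unfold intro!: continuous_intros P.continuous_on)
      fix s :: real assume s: "s \<in> {0..1}"
      have "s *\<^sub>R (u - P u) + P u \<noteq> 0" if "u \<in> S" "u \<noteq> 0" for u
      proof
        assume "s *\<^sub>R (u - P u) + P u = 0"
        then have "P (s *\<^sub>R (u - P u) + P u) = 0" by (simp add: P.zero)
        then have "P u = 0" by (simp add: P.add P.scaleR P.diff P(2))
        with P0 that show False by blast
      qed
      then show "(\<lambda>u. case (s, u) of (s, u) \<Rightarrow> s *\<^sub>R (u - P u) + P u) ` (S - {0}) \<subseteq> S - {0}"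
        using seg s by auto
    qed auto
  qed (use TS in auto)
  have exS: "relative_homology_group p (top_of_set ({u. \<Psi> u \<le> 0} \<inter> U)) ({u. \<Psi> u \<le> 0} \<inter> U - {0}) \<cong>
      relative_homology_group p (top_of_set S) (S - {0})"
  proof -
    have "S = {u. \<Psi> u \<le> 0} \<inter> U \<inter> B" using BU by (auto simp: S_def)
    then show ?thesis
      using group.iso_sym[OF group_relative_homology_group
          relative_homology_punctured_local[OF B, of p "{u. \<Psi> u \<le> 0} \<inter> U"]] by simp
  qed
  have exT: "relative_homology_group p (top_of_set T) (T - {0}) \<cong>
      relative_homology_group p (top_of_set (range P)) (range P - {0})"
    unfolding T_def by (rule relative_homology_punctured_local[OF B])
  show ?thesis by (rule iso_trans[OF iso_trans[OF exS iso] exT])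
qed

subsection \<open>Quadratic forms\<close>

text \<open>The form is an argument because three forms are used: the inner product, \<beta> on a
  subspace where it is positive, and its negative on a subspace where \<beta> is negative.\<close>

definition form_orthonormal :: "('a \<Rightarrow> 'a \<Rightarrow> real) \<Rightarrow> nat \<Rightarrow> (nat \<Rightarrow> 'a) \<Rightarrow> bool"
  where "form_orthonormal \<beta> n e \<longleftrightarrow> (\<forall>i<n. \<forall>j<n. \<beta> (e i) (e j) = (if i = j then 1 else 0))"

locale symmetric_form =
  fixes \<beta> :: "'a::real_vector \<Rightarrow> 'a \<Rightarrow> real"
  assumes bil: "bilinear \<beta>" and sym: "\<beta> u v = \<beta> v u"
begin

lemmas form_simps = bilinear_ladd[OF bil] bilinear_radd[OF bil] bilinear_lmul[OF bil] bilinear_rmul[OF bil]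
  bilinear_lsub[OF bil] bilinear_rsub[OF bil] bilinear_lzero[OF bil] bilinear_rzero[OF bil]

lemma form_sum_left: "\<beta> (\<Sum>i\<in>I. c i *\<^sub>R f i) v = (\<Sum>i\<in>I. c i * \<beta> (f i) v)"
  by (induction I rule: infinite_finite_induct) (simp_all add: form_simps)

lemma form_coordinate:
  assumes "form_orthonormal \<beta> n e" "j < n"
  shows "\<beta> (\<Sum>i<n. c i *\<^sub>R e i) (e j) = c j"
proof -
  have "\<beta> (\<Sum>i<n. c i *\<^sub>R e i) (e j) = (\<Sum>i<n. if i = j then c i else 0)"
    unfolding form_sum_left by (intro sum.cong) (use assms in \<open>auto simp: form_orthonormal_def\<close>)
  then show ?thesis using assms(2) by simp
qed

lemma form_sum_squares:
  assumes "form_orthonormal \<beta> n e"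
  shows "\<beta> (\<Sum>i<n. c i *\<^sub>R e i) (\<Sum>i<n. c i *\<^sub>R e i) = (\<Sum>i<n. (c i)\<^sup>2)"
  unfolding form_sum_left[of c e "{..<n}" "\<Sum>i<n. c i *\<^sub>R e i"]
  by (intro sum.cong) (auto simp: sym[of "e _"] form_coordinate[OF assms] power2_eq_square)

lemma form_orthonormal_inj: "form_orthonormal \<beta> n e \<Longrightarrow> inj_on e {..<n}"
  unfolding form_orthonormal_def inj_on_def by (metis lessThan_iff zero_neq_one)

lemma form_orthonormal_independent:
  assumes "form_orthonormal \<beta> n e"
  shows "independent (e ` {..<n})"
proof (rule independent_if_scalars_zero)
  fix f x assume 0: "(\<Sum>x\<in>e ` {..<n}. f x *\<^sub>R x) = 0" and "x \<in> e ` {..<n}"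
  then obtain j where j: "j < n" "x = e j" by auto
  have "(\<Sum>i<n. f (e i) *\<^sub>R e i) = 0"
    using 0 by (simp add: sum.reindex[OF form_orthonormal_inj[OF assms]])
  then show "f x = 0"
    using form_coordinate[OF assms j(1), of "\<lambda>i. f (e i)"] j by (simp add: form_simps)
qed simp

lemma form_orthonormal_dim:
  assumes "form_orthonormal \<beta> n e"
  shows "dim (span (e ` {..<n})) = n"
  unfolding dim_span_eq_card_independent[OF form_orthonormal_independent[OF assms]]
  by (simp add: card_image[OF form_orthonormal_inj[OF assms]])

lemma form_orthonormal_span:
  assumes "form_orthonormal \<beta> n e" "u \<in> span (e ` {..<n})"
  shows "u = (\<Sum>i<n. \<beta> u (e i) *\<^sub>R e i)"
proof -
  have "subspace {u. u = (\<Sum>i<n. \<beta> u (e i) *\<^sub>R e i)}"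
    by (auto simp: subspace_def form_simps scaleR_add_left sum.distrib scaleR_sum_right[symmetric]
        simp flip: scaleR_scaleR)
  moreover have "e ` {..<n} \<subseteq> {u. u = (\<Sum>i<n. \<beta> u (e i) *\<^sub>R e i)}"
  proof clarify
    fix j assume j: "j < n"
    have "(\<Sum>i<n. \<beta> (e j) (e i) *\<^sub>R e i) = (\<Sum>i<n. if i = j then e i else 0)"
      by (intro sum.cong) (use assms(1) j in \<open>auto simp: form_orthonormal_def\<close>)
    then show "e j = (\<Sum>i<n. \<beta> (e j) (e i) *\<^sub>R e i)" using j by simp
  qed
  ultimately show ?thesis using assms(2) span_minimal by blast
qed

text \<open>The Gram-Schmidt step. It only needs the form to be positive at \<open>w\<close>, so it
  can also be used to contradict the maximality of a family.\<close>

lemma form_orthonormal_snoc: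
  assumes "form_orthonormal \<beta> n e" "\<And>i. i < n \<Longrightarrow> \<beta> w (e i) = 0" "\<beta> w w > 0"
  shows "form_orthonormal \<beta> (Suc n) (e(n := w /\<^sub>R sqrt (\<beta> w w)))"
proof -
  have "inverse (sqrt x) * (inverse (sqrt x) * x) = 1" if "x > 0" for x :: real
    using that by (simp add: field_simps)
  with assms show ?thesis
    by (auto simp: form_orthonormal_def less_Suc_eq form_simps sym[of "e _" w])
qed

text \<open>Maximality replaces recursion: orthonormal families in \<open>S\<close> are independent,
  so their length is at most \<open>card F\<close>. For a longest one, the residue of
  \<open>u\<close> after subtracting its coordinates is orthogonal to the family and would prolong
  it unless it is 0.\<close>

lemma form_orthonormal_basis:
  assumes S: "subspace S" "S \<subseteq> span F" "finite F"
    and pos: "\<And>u. u \<in> S \<Longrightarrow> u \<noteq> 0 \<Longrightarrow> \<beta> u u > 0"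
  obtains e where "form_orthonormal \<beta> (dim S) e" "\<And>i. i < dim S \<Longrightarrow> e i \<in> S"
    "\<And>u. u \<in> S \<Longrightarrow> u = (\<Sum>i<dim S. \<beta> u (e i) *\<^sub>R e i)"
proof -
  define N where "N = {n. \<exists>e. form_orthonormal \<beta> n e \<and> (\<forall>i<n. e i \<in> S)}"
  have bound: "n \<le> card F" if n: "n \<in> N" for n
  proof -
    obtain e where e: "form_orthonormal \<beta> n e" "\<forall>i<n. e i \<in> S" using n by (auto simp: N_def)
    then have "e ` {..<n} \<subseteq> span F" using S by auto
    from independent_span_bound[OF S(3) form_orthonormal_independent[OF e(1)] this]
    show ?thesis by (simp add: card_image[OF form_orthonormal_inj[OF e(1)]])
  qed
  have "finite N" by (rule finite_subset[of _ "{..card F}"]) (use bound in auto)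
  moreover have "0 \<in> N" by (auto simp: N_def form_orthonormal_def)
  ultimately have "Max N \<in> N" by (intro Max_in) auto
  define n where "n = Max N"
  obtain e where e: "form_orthonormal \<beta> n e" "\<And>i. i < n \<Longrightarrow> e i \<in> S"
    using \<open>Max N \<in> N\<close> by (auto simp: N_def n_def)
  have expand: "u = (\<Sum>i<n. \<beta> u (e i) *\<^sub>R e i)" if u: "u \<in> S" for u
  proof (rule ccontr)
    define w where "w = u - (\<Sum>i<n. \<beta> u (e i) *\<^sub>R e i)"
    assume "u \<noteq> (\<Sum>i<n. \<beta> u (e i) *\<^sub>R e i)"
    then have w0: "w \<noteq> 0" by (simp add: w_def)
    have wS: "w \<in> S"
      unfolding w_def using u e(2) S(1) by (intro subspace_diff subspace_sum subspace_scale) auto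
    have "\<beta> w (e i) = 0" if "i < n" for i
      unfolding w_def by (simp add: bilinear_lsub[OF bil] form_coordinate[OF e(1) that])
    from form_orthonormal_snoc[OF e(1) this pos[OF wS w0]]
    have "Suc n \<in> N" unfolding N_def
      using e(2) wS S(1)
      by (intro CollectI exI[of _ "e(n := w /\<^sub>R sqrt (\<beta> w w))"]) (auto simp: less_Suc_eq subspace_scale)
    then show False using Max_ge[OF \<open>finite N\<close>, of "Suc n"] by (simp add: n_def)
  qed
  have "S = span (e ` {..<n})"
  proof
    show "S \<subseteq> span (e ` {..<n})"
    proof
      fix u assume "u \<in> S"
      have "(\<Sum>i<n. \<beta> u (e i) *\<^sub>R e i) \<in> span (e ` {..<n})"
        by (intro span_sum span_scale span_base) auto
      then show "u \<in> span (e ` {..<n})" using expand[OF \<open>u \<in> S\<close>] by simp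
    qed
    show "span (e ` {..<n}) \<subseteq> S" using e(2) S(1) by (intro span_minimal) auto
  qed
  then have "dim S = n" using form_orthonormal_dim[OF e(1)] by simp
  with e expand that show thesis by blast
qed

end

text \<open>The projection is given by Fourier coefficients in an orthonormal basis of the span,
  which is valid in any inner product space, complete or not.\<close>

lemma orthogonal_decomposition:
  fixes u :: "'a::real_inner"
  assumes "finite F"
  obtains m where "m \<in> span F" "\<And>y. y \<in> span F \<Longrightarrow> (u - m) \<bullet> y = 0"
proof -
  interpret symmetric_form "inner :: 'a \<Rightarrow> 'a \<Rightarrow> real"
    by standard (simp_all add: bilinear_def inner_commute linear_iff inner_add_left inner_add_right)
  obtain e where e: "form_orthonormal inner (dim (span F)) e" "\<And>i. i < dim (span F) \<Longrightarrow> e i \<in> span F"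
      "\<And>y. y \<in> span F \<Longrightarrow> y = (\<Sum>i<dim (span F). (y \<bullet> e i) *\<^sub>R e i)"
    by (rule form_orthonormal_basis[of "span F" F]) (use assms in auto)
  let ?m = "\<Sum>i<dim (span F). (u \<bullet> e i) *\<^sub>R e i"
  have "(u - ?m) \<bullet> e j = 0" if "j < dim (span F)" for j
    using form_coordinate[OF e(1) that] by (simp add: inner_diff_left)
  then have "(u - ?m) \<bullet> (\<Sum>i<dim (span F). c i *\<^sub>R e i) = 0" for c
    by (simp add: inner_sum_right)
  then have "(u - ?m) \<bullet> y = 0" if "y \<in> span F" for y
    using e(3)[OF that] by metis
  moreover have "?m \<in> span F" using e(2) by (intro span_sum span_scale) auto
  ultimately show thesis using that by blast
qed


section \<open>Splitting along a maximal negative subspace\<close>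

lemma quadratic_nonneg_imp_linear_zero:
  fixes p q :: real
  assumes "\<And>t. 0 \<le> 2 * t * p + t\<^sup>2 * q" "q \<ge> 0"
  shows "p = 0"
proof -
  \<comment> \<open>Close to the minimizer \<open>- p / q\<close>, but defined for
    \<open>q = 0\<close> too; the expression becomes
    \<open>- p\<^sup>2 * (q + 2) / (q + 1)\<^sup>2\<close>.\<close>
  define t where "t = - p / (q + 1)"
  have t: "t * (q + 1) = - p" using assms(2) by (simp add: t_def)
  have "0 \<le> (2 * t * p + t\<^sup>2 * q) * (q + 1)\<^sup>2"
    using assms by (intro mult_nonneg_nonneg) auto
  also have "\<dots> = 2 * (t * (q + 1)) * p * (q + 1) + (t * (q + 1))\<^sup>2 * q"
    by (simp add: power2_eq_square algebra_simps)
  also have "\<dots> = - (p\<^sup>2 * (q + 2))"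
    unfolding t by (simp add: power2_eq_square algebra_simps)
  finally have "p\<^sup>2 * (q + 2) \<le> 0" by simp
  then show ?thesis using assms(2) by (simp add: mult_le_0_iff)
qed

lemma symmetric_form_inner_perturbation:
  fixes g :: "'b \<Rightarrow> 'a::real_inner"
  assumes \<beta>_def: "\<And>u v. \<beta> u v = u \<bullet> v - (\<Sum>j\<in>J. b j * (u \<bullet> g j) * (v \<bullet> g j))"
  shows "symmetric_form \<beta>"
proof
  show "bilinear \<beta>"
    unfolding bilinear_def linear_iff \<beta>_def
    by (simp add: inner_add_left inner_add_right algebra_simps sum.distrib sum_distrib_left)
  show "\<beta> u v = \<beta> v u" for u v
    unfolding \<beta>_def by (simp add: inner_commute mult.commute mult.left_commute)
qed

text \<open>On the orthogonal complement of the span \<open>M\<close> of the vectors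
  \<open>g j\<close> the form is the inner product, and the two spaces are also orthogonal for
  \<beta>. Hence only \<open>M\<close> matters. Inside \<open>M\<close> the \<beta>-complement
  \<open>W\<close> of a maximal negative subspace is nonnegative by maximality, positive by
  nondegeneracy, and coercive because its dimension is finite.\<close>

lemma nondegenerate_splitting:
  fixes g :: "'b \<Rightarrow> 'a::real_inner" and b :: "'b \<Rightarrow> real" and \<beta> :: "'a \<Rightarrow> 'a \<Rightarrow> real"
  assumes \<beta>_def: "\<And>u v. \<beta> u v = u \<bullet> v - (\<Sum>j\<in>J. b j * (u \<bullet> g j) * (v \<bullet> g j))"
    and k_def: "k = morse_index (\<lambda>u. \<beta> u u / 2) (span (g ` J))"
    and J: "finite J" and nondeg: "\<And>u. (\<And>v. \<beta> u v = 0) \<Longrightarrow> u = 0"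
  obtains e c where "c > 0" "\<And>i j. i < k \<Longrightarrow> j < k \<Longrightarrow> \<beta> (e i) (e j) = (if i = j then - 1 else 0)"
    "\<And>v. (\<And>i. i < k \<Longrightarrow> \<beta> v (e i) = 0) \<Longrightarrow> c * (norm v)\<^sup>2 \<le> \<beta> v v" "k \<le> card J"
proof -
  define M where "M = span (g ` J)"
  interpret pos: symmetric_form \<beta> by (rule symmetric_form_inner_perturbation[OF \<beta>_def])
  note bil = pos.bil and sym = pos.sym
  \<comment> \<open>The sign change makes the form positive on the negative subspace, so the lemmas
    on orthonormal families apply there.\<close>
  define \<gamma> where "\<gamma> u v = - \<beta> u v" for u v
  have bil': "bilinear \<gamma>"
    unfolding bilinear_def linear_iff \<gamma>_def by (simp add: pos.form_simps)
  interpret neg: symmetric_form \<gamma> by standard (rule bil', simp add: \<gamma>_def sym)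

  define D where "D = {dim V |V. subspace V \<and> V \<subseteq> M \<and> (\<forall>w\<in>V. w \<noteq> 0 \<longrightarrow> \<beta> w w / 2 < 0)}"
  have k: "k = Max D" by (simp add: k_def morse_index_def D_def M_def)
  have D_le: "n \<le> card J" if n: "n \<in> D" for n
  proof -
    obtain V where "V \<subseteq> span (g ` J)" "n = dim V" using n by (auto simp: D_def M_def)
    then have "n \<le> card (g ` J)" using J by (auto intro: dim_le_card)
    then show ?thesis using card_image_le[OF J, of g] by linarith
  qed
  \<comment> \<open>\<open>Max\<close> in the Morse index has its meaning only for a finite nonempty
    set; the zero subspace supplies an element.\<close>
  have finD: "finite D" by (rule finite_subset[of _ "{..card J}"]) (use D_le in auto)
  have "dim {0::'a} \<in> D"
    unfolding D_def M_def by (intro CollectI exI[of _ "{0}"]) (auto simp: subspace_single_0 span_zero)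
  then have kD: "k \<in> D" unfolding k using finD by (intro Max_in) auto
  then have "\<exists>V. k = dim V \<and> subspace V \<and> V \<subseteq> M \<and> (\<forall>w\<in>V. w \<noteq> 0 \<longrightarrow> \<beta> w w / 2 < 0)"
    unfolding D_def by (rule CollectD)
  then obtain V where dimV: "k = dim V"
    and V: "subspace V" "V \<subseteq> M" "\<forall>w\<in>V. w \<noteq> 0 \<longrightarrow> \<beta> w w / 2 < 0"
    by (elim exE conjE)
  have V_pos: "\<gamma> w w > 0" if "w \<in> V" "w \<noteq> 0" for w
    using V(3) that by (simp add: \<gamma>_def)
  obtain e where e: "form_orthonormal \<gamma> k e" "\<And>i. i < k \<Longrightarrow> e i \<in> V"
  proof (rule neg.form_orthonormal_basis[OF V(1) _ _ V_pos])
    show "V \<subseteq> span (g ` J)" using V(2) by (simp only: M_def)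
    show "finite (g ` J)" using J by simp
  qed (use that in \<open>auto simp: dimV\<close>)
  have eM: "e i \<in> M" if "i < k" for i using e(2)[OF that] V(2) by blast

  define W where "W = {w \<in> M. \<forall>i<k. \<beta> w (e i) = 0}"
  have subW: "subspace W"
    unfolding W_def M_def
    by (auto simp: subspace_def pos.form_simps span_zero span_add span_scale)
  have WM: "W \<subseteq> M" by (auto simp: W_def)
  \<comment> \<open>A vector of \<open>W\<close> with negative value would prolong the family
    \<open>e\<close> and span, together with it, a negative subspace of dimension
    \<open>Suc k\<close>.\<close>
  have W_nonneg: "\<beta> w w \<ge> 0" if w: "w \<in> W" for w
  proof (rule ccontr)
    assume "\<not> \<beta> w w \<ge> 0"
    then have "\<gamma> w w > 0" by (simp add: \<gamma>_def)
    moreover have "\<gamma> w (e i) = 0" if "i < k" for i using w that by (simp add: W_def \<gamma>_def)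
    ultimately obtain e' where e': "form_orthonormal \<gamma> (Suc k) e'"
      and e'_eq: "e' = e(k := w /\<^sub>R sqrt (\<gamma> w w))"
      using neg.form_orthonormal_snoc[OF e(1)] by blast
    let ?V = "span (e' ` {..<Suc k})"
    have "?V \<subseteq> M"
      unfolding M_def e'_eq using eM w WM
      by (intro span_minimal) (auto simp: M_def less_Suc_eq span_scale)
    moreover have "\<beta> u u / 2 < 0" if u: "u \<in> ?V" "u \<noteq> 0" for u
    proof -
      have u_eq: "u = (\<Sum>i<Suc k. \<gamma> u (e' i) *\<^sub>R e' i)"
        by (rule neg.form_orthonormal_span[OF e' u(1)])
      have "\<exists>i<Suc k. \<gamma> u (e' i) \<noteq> 0"
      proof (rule ccontr)
        assume "\<not> (\<exists>i<Suc k. \<gamma> u (e' i) \<noteq> 0)"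
        then have "(\<Sum>i<Suc k. \<gamma> u (e' i) *\<^sub>R e' i) = 0" by (intro sum.neutral) auto
        with u_eq u(2) show False by simp
      qed
      then obtain i where "i < Suc k" "\<gamma> u (e' i) \<noteq> 0" by blast
      then have "0 < (\<Sum>i<Suc k. (\<gamma> u (e' i))\<^sup>2)"
        by (intro sum_pos2[of _ i]) (auto simp del: sum.lessThan_Suc)
      also have "\<dots> = \<gamma> u u"
        using neg.form_sum_squares[OF e', of "\<lambda>i. \<gamma> u (e' i)"] u_eq by metis
      finally show ?thesis by (simp add: \<gamma>_def)
    qed
    ultimately have "dim ?V \<in> D" unfolding D_def by blast
    then have "Suc k \<in> D" by (simp only: neg.form_orthonormal_dim[OF e'])
    then show False using Max_ge[OF finD] k by fastforce
  qed
  have orth: "\<beta> n y = n \<bullet> y" if "\<And>y. y \<in> M \<Longrightarrow> n \<bullet> y = 0" for n y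
  proof -
    have "n \<bullet> g j = 0" if "j \<in> J" for j
      using that by (intro \<open>\<And>y. y \<in> M \<Longrightarrow> n \<bullet> y = 0\<close>) (auto simp: M_def span_base)
    then show ?thesis by (simp add: \<beta>_def)
  qed
  \<comment> \<open>A null vector \<open>w\<close> of a nonnegative form is orthogonal to all of
    \<open>W\<close>. It is also orthogonal to the vectors \<open>e i\<close>, hence to
    \<open>M\<close>, and to the orthogonal complement of \<open>M\<close>, where the form is the
    inner product; so it lies in the radical.\<close>
  have W_pos: "\<beta> w w > 0" if w: "w \<in> W" "w \<noteq> 0" for w
  proof (rule ccontr)
    assume "\<not> \<beta> w w > 0"
    then have w0: "\<beta> w w = 0" using W_nonneg[OF w(1)] by simp
    have W0: "\<beta> w y = 0" if y: "y \<in> W" for y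
    proof (rule quadratic_nonneg_imp_linear_zero)
      show "0 \<le> \<beta> y y" by (rule W_nonneg[OF y])
      fix t :: real
      have "w + t *\<^sub>R y \<in> W" using subW w y by (simp add: subspace_add subspace_scale)
      from W_nonneg[OF this] show "0 \<le> 2 * t * \<beta> w y + t\<^sup>2 * \<beta> y y"
        by (simp add: pos.form_simps w0 sym[of y w] power2_eq_square algebra_simps)
    qed
    have M0: "\<beta> w v = 0" if v: "v \<in> M" for v
    proof -
      let ?s = "\<Sum>i<k. \<gamma> v (e i) *\<^sub>R e i"
      have "v - ?s \<in> M"
        unfolding M_def using v eM by (intro span_diff span_sum span_scale) (auto simp: M_def)
      moreover have "\<beta> (v - ?s) (e i) = 0" if "i < k" for i
      proof -
        have "\<gamma> (v - ?s) (e i) = 0"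
          using neg.form_coordinate[OF e(1) that] by (simp add: bilinear_lsub[OF bil'])
        then show ?thesis by (simp add: \<gamma>_def)
      qed
      ultimately have "v - ?s \<in> W" by (simp add: W_def)
      then have "\<beta> w (v - ?s) = 0" by (rule W0)
      moreover have "\<beta> w ?s = 0"
        unfolding sym[of w] pos.form_sum_left using w(1)
        by (intro sum.neutral) (auto simp: W_def sym[of "e _" w])
      ultimately show ?thesis by (simp add: pos.form_simps)
    qed
    have "\<beta> w u = 0" for u
    proof -
      obtain m where m: "m \<in> M" "\<And>y. y \<in> M \<Longrightarrow> (u - m) \<bullet> y = 0"
        using orthogonal_decomposition[of "g ` J" u] J unfolding M_def by blast
      have "\<beta> w (u - m) = 0"
        unfolding sym[of w] using orth[OF m(2)] m(2) w(1) WM by auto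
      then show ?thesis using M0[OF m(1)] by (simp add: pos.form_simps)
    qed
    from nondeg[OF this] show False using w(2) by simp
  qed

  obtain d where d: "form_orthonormal \<beta> (dim W) d" "\<And>w. w \<in> W \<Longrightarrow> w = (\<Sum>i<dim W. \<beta> w (d i) *\<^sub>R d i)"
  proof (rule pos.form_orthonormal_basis[OF subW _ _ W_pos])
    show "W \<subseteq> span (g ` J)" using WM by (simp only: M_def)
    show "finite (g ` J)" using J by simp
  qed (use that in auto)
  \<comment> \<open>The constant comes from expanding \<open>w\<close> in a \<beta>-orthonormal
    basis of \<open>W\<close> and applying Cauchy-Schwarz to the sum.\<close>
  define K where "K = (\<Sum>i<dim W. (norm (d i))\<^sup>2)"
  have K: "K \<ge> 0" by (simp add: K_def sum_nonneg)
  have W_coercive: "(norm w)\<^sup>2 \<le> K * \<beta> w w" if w: "w \<in> W" for w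
  proof -
    have "norm w \<le> (\<Sum>i<dim W. \<bar>\<beta> w (d i)\<bar> * norm (d i))"
      by (subst d(2)[OF w], rule order_trans[OF norm_sum]) simp
    then have "(norm w)\<^sup>2 \<le> (\<Sum>i<dim W. \<bar>\<beta> w (d i)\<bar> * norm (d i))\<^sup>2"
      by (intro power_mono) auto
    also have "\<dots> \<le> (\<Sum>i<dim W. \<bar>\<beta> w (d i)\<bar>\<^sup>2) * (\<Sum>i<dim W. (norm (d i))\<^sup>2)"
      by (rule Cauchy_Schwarz_ineq_sum)
    also have "(\<Sum>i<dim W. \<bar>\<beta> w (d i)\<bar>\<^sup>2) = \<beta> w w"
      using pos.form_sum_squares[OF d(1), of "\<lambda>i. \<beta> w (d i)"] d(2)[OF w] by simp
    finally show ?thesis by (simp add: K_def mult.commute)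
  qed
  show thesis
  \<comment> \<open>The form dominates the squared norm with factor 1 on the complement of
    \<open>M\<close> and with \<open>1 / K\<close> on \<open>W\<close>; \<open>1 + K\<close> serves
    both and avoids division by 0 when \<open>W\<close> is trivial.\<close>
  proof (rule that[of "1 / (1 + K)" e])
    show "1 / (1 + K) > 0" using K by simp
    show "\<beta> (e i) (e j) = (if i = j then - 1 else 0)" if "i < k" "j < k" for i j
    proof -
      have "\<gamma> (e i) (e j) = (if i = j then 1 else 0)"
        using e(1) that by (simp add: form_orthonormal_def)
      then show ?thesis by (auto simp: \<gamma>_def split: if_splits)
    qed
    show "k \<le> card J" by (rule D_le[OF kD])
    fix v assume v: "\<And>i. i < k \<Longrightarrow> \<beta> v (e i) = 0"
    obtain m where m: "m \<in> M" "\<And>y. y \<in> M \<Longrightarrow> (v - m) \<bullet> y = 0"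
      using orthogonal_decomposition[of "g ` J" v] J unfolding M_def by blast
    define n where "n = v - m"
    have n: "\<beta> n y = n \<bullet> y" for y unfolding n_def by (rule orth[OF m(2)])
    have nM: "n \<bullet> y = 0" if "y \<in> M" for y using m(2)[OF that] by (simp add: n_def)
    have v_eq: "v = m + n" by (simp add: n_def)
    have "\<beta> m (e i) = 0" if "i < k" for i
      using v[OF that] nM[OF eM[OF that]] by (simp add: v_eq pos.form_simps n)
    then have "m \<in> W" using m(1) by (simp add: W_def)
    have "(norm v)\<^sup>2 = (norm m)\<^sup>2 + (norm n)\<^sup>2"
      using nM[OF m(1)] by (simp add: v_eq power2_norm_eq_inner inner_add_left inner_add_right inner_commute)
    also have "\<dots> \<le> K * \<beta> m m + \<beta> n n"
      using W_coercive[OF \<open>m \<in> W\<close>] by (simp add: n power2_norm_eq_inner)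
    also have "\<dots> \<le> (1 + K) * (\<beta> m m + \<beta> n n)"
      using K W_nonneg[OF \<open>m \<in> W\<close>] by (simp add: n algebra_simps)
    also have "\<beta> m m + \<beta> n n = \<beta> v v"
      using nM[OF m(1)] by (simp add: v_eq pos.form_simps sym[of m n] n)
    finally show "1 / (1 + K) * (norm v)\<^sup>2 \<le> \<beta> v v"
      using K by (simp add: field_simps)
  qed
qed

subsection \<open>Critical groups\<close>

theorem critical_group_nondegenerate:
  fixes g :: "'b \<Rightarrow> 'a::real_inner" and b :: "'b \<Rightarrow> real" 
    and \<beta> :: "'a \<Rightarrow> 'a \<Rightarrow> real" and G \<Psi> :: "'a \<Rightarrow> real"
  assumes \<beta>_def: "\<And>u v. \<beta> u v = u \<bullet> v - (\<Sum>j\<in>J. b j * (u \<bullet> g j) * (v \<bullet> g j))"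
    and k_def: "k = morse_index (\<lambda>u. \<beta> u u / 2) (span (g ` J))"
    and J: "finite J" and nondeg: "\<And>u. (\<And>v. \<beta> u v = 0) \<Longrightarrow> u = 0"
    and G: "\<And>\<epsilon>. \<epsilon> > 0 \<Longrightarrow> \<exists>\<delta>>0. \<forall>u u'. norm u \<le> \<delta> \<longrightarrow> norm u' \<le> \<delta> \<longrightarrow>
        \<bar>G u - G u'\<bar> \<le> \<epsilon> * max (norm u) (norm u') * norm (u - u')"
      "G 0 = 0"
    and \<Psi>: "\<And>u. \<Psi> u = \<beta> u u / 2 + G u"
    and U: "0 \<in> interior U"
  shows "q \<noteq> k \<Longrightarrow> trivial_group (critical_group TYPE('g::ab_group_add) q \<Psi> U)"
    and "critical_group TYPE('g) k \<Psi> U \<cong> additive_group TYPE('g)"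
    and "k \<le> card J"
proof -
  interpret symmetric_form \<beta> by (rule symmetric_form_inner_perturbation[OF \<beta>_def])
  obtain e c where c: "c > 0"
    and e: "\<And>i j. i < k \<Longrightarrow> j < k \<Longrightarrow> \<beta> (e i) (e j) = (if i = j then - 1 else 0)"
    and coercive: "\<And>v. (\<And>i. i < k \<Longrightarrow> \<beta> v (e i) = 0) \<Longrightarrow> c * (norm v)\<^sup>2 \<le> \<beta> v v"
    and k_le: "k \<le> card J"
  proof (rule nondegenerate_splitting[OF \<beta>_def k_def J])
    show "u = 0" if "\<And>v. \<beta> u v = 0" for u using that by (rule nondeg)
    fix e c
    assume "c > 0" "\<And>i j. i < k \<Longrightarrow> j < k \<Longrightarrow> \<beta> (e i) (e j) = (if i = j then - 1 else 0)"
      "\<And>v. (\<And>i. i < k \<Longrightarrow> \<beta> v (e i) = 0) \<Longrightarrow> c * (norm v)\<^sup>2 \<le> \<beta> v v" "k \<le> card J"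
    then show thesis by (rule that)
  qed
  show "k \<le> card J" by (rule k_le)
  \<comment> \<open>The minus sign compensates \<open>\<beta> (e i) (e i) = - 1\<close>: these are
    the coordinates dual to the vectors \<open>e i\<close>, and the kernel of the resulting
    \<open>P\<close> is the \<beta>-complement of their span.\<close>
  define f where "f i u = - \<beta> u (e i)" for i u
  define P where "P u = (\<Sum>i<k. f i u *\<^sub>R e i)" for u
  have f: "bounded_linear (f i)" for i
  proof -
    have "f i = (\<lambda>u. (\<Sum>j\<in>J. b j * (u \<bullet> g j) * (e i \<bullet> g j)) - u \<bullet> e i)"
      by (simp add: f_def \<beta>_def fun_eq_iff)
    moreover have "bounded_linear (\<lambda>u. (\<Sum>j\<in>J. b j * (u \<bullet> g j) * (e i \<bullet> g j)) - u \<bullet> e i)"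
      by (intro bounded_linear_sub bounded_linear_sum bounded_linear_mult_left[THEN bounded_linear_compose]
          bounded_linear_mult_right[THEN bounded_linear_compose] bounded_linear_inner_left)
    ultimately show ?thesis by simp
  qed
  have fe: "f i (e j) = (if i = j then 1 else 0)" if "i < k" "j < k" for i j
    using e[OF that(2,1)] by (auto simp: f_def)
  have fP: "f i (P u) = f i u" if "i < k" for i u
  proof -
    interpret fi: bounded_linear "f i" by (rule f)
    have "f i (P u) = (\<Sum>j<k. if j = i then f j u else 0)"
      unfolding P_def fi.sum fi.scaleR by (intro sum.cong) (use that fe in auto)
    then show ?thesis using that by simp
  qed
  have P: "bounded_linear P"
    unfolding P_def by (intro bounded_linear_sum bounded_linear_scaleR_left[THEN bounded_linear_compose] f)
  have PP: "P (P u) = P u" for u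
    unfolding P_def[of "P u"] using fP by (simp add: P_def)
  have ker: "\<beta> v (e i) = 0" if "P v = 0" "i < k" for v i
    using fP[OF that(2), of v] that(1) by (simp add: f_def form_simps)
  \<comment> \<open>The constant stays a parameter because a single one, fixed later, must serve
    both this bound and the coercivity on the kernel of \<open>P\<close>.\<close>
  have negative: "\<beta> w w \<le> - c' * (norm w)\<^sup>2"
    if "P w = w" and c': "c' * (1 + (\<Sum>i<k. (norm (e i))\<^sup>2)) \<le> 1" "c' \<ge> 0" for w c'
  proof -
    let ?K = "\<Sum>i<k. (norm (e i))\<^sup>2"
    have w: "w = (\<Sum>i<k. f i w *\<^sub>R e i)" using that(1) by (simp add: P_def)
    have "\<beta> w w = (\<Sum>i<k. f i w * \<beta> (e i) w)"
      using form_sum_left[of "\<lambda>i. f i w" e "{..<k}" w] w by metis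
    also have "\<dots> = - (\<Sum>i<k. (f i w)\<^sup>2)"
      by (simp add: f_def sym[of "e _" w] power2_eq_square sum_negf)
    finally have ww: "\<beta> w w = - (\<Sum>i<k. (f i w)\<^sup>2)" .
    have "norm w \<le> (\<Sum>i<k. \<bar>f i w\<bar> * norm (e i))"
      by (subst w, rule order_trans[OF norm_sum]) simp
    then have "(norm w)\<^sup>2 \<le> (\<Sum>i<k. \<bar>f i w\<bar> * norm (e i))\<^sup>2"
      by (intro power_mono) auto
    also have "\<dots> \<le> (\<Sum>i<k. \<bar>f i w\<bar>\<^sup>2) * ?K"
      by (rule Cauchy_Schwarz_ineq_sum)
    also have "\<dots> = - \<beta> w w * ?K" by (simp add: ww)
    also have "\<dots> \<le> - \<beta> w w * (1 + ?K)"
      by (intro mult_left_mono) (auto simp: ww sum_nonneg)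
    finally have "c' * (norm w)\<^sup>2 \<le> c' * (- \<beta> w w * (1 + ?K))"
      using c'(2) by (intro mult_left_mono)
    also have "\<dots> = - \<beta> w w * (c' * (1 + ?K))" by simp
    also have "\<dots> \<le> - \<beta> w w * 1"
      using c'(1) by (intro mult_left_mono) (auto simp: ww sum_nonneg)
    finally show ?thesis by simp
  qed
  define C where "C = 1 + (\<Sum>j\<in>J. \<bar>b j\<bar> * (norm (g j))\<^sup>2)"
  have C: "C \<ge> 1" by (simp add: C_def sum_nonneg)
  have upper: "\<beta> v v \<le> C * (norm v)\<^sup>2" for v
  proof -
    have "- (\<Sum>j\<in>J. b j * (v \<bullet> g j) * (v \<bullet> g j)) \<le> (\<Sum>j\<in>J. \<bar>b j\<bar> * (norm (g j))\<^sup>2 * (norm v)\<^sup>2)"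
      unfolding sum_negf[symmetric]
    proof (rule sum_mono)
      fix j
      have "- (b j * (v \<bullet> g j) * (v \<bullet> g j)) \<le> \<bar>b j\<bar> * (v \<bullet> g j)\<^sup>2"
        using mult_right_mono[OF abs_ge_minus_self[of "b j"] zero_le_power2[of "v \<bullet> g j"]]
        by (simp add: power2_eq_square mult.assoc)
      also have "\<dots> \<le> \<bar>b j\<bar> * (norm v * norm (g j))\<^sup>2"
        using power_mono[OF Cauchy_Schwarz_ineq2[of v "g j"], of 2] by (intro mult_left_mono) auto
      finally show "- (b j * (v \<bullet> g j) * (v \<bullet> g j)) \<le> \<bar>b j\<bar> * (norm (g j))\<^sup>2 * (norm v)\<^sup>2"
        by (simp add: power_mult_distrib mult_ac)
    qed
    then show ?thesis
      by (simp add: \<beta>_def C_def distrib_right sum_distrib_right power2_norm_eq_inner)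
  qed
  define c' where "c' = min c (1 / (1 + (\<Sum>i<k. (norm (e i))\<^sup>2)))"
  have K: "1 + (\<Sum>i<k. (norm (e i))\<^sup>2) > 0" by (intro add_pos_nonneg sum_nonneg) auto
  have c': "c' > 0" "c' \<le> c" "c' * (1 + (\<Sum>i<k. (norm (e i))\<^sup>2)) \<le> 1"
  proof -
    show "c' > 0" "c' \<le> c" using c K by (simp_all add: c'_def)
    have "c' \<le> 1 / (1 + (\<Sum>i<k. (norm (e i))\<^sup>2))" by (simp add: c'_def)
    then show "c' * (1 + (\<Sum>i<k. (norm (e i))\<^sup>2)) \<le> 1" using K by (simp add: field_simps)
  qed
  let ?X = "{u. \<Psi> u \<le> 0} \<inter> U"
  have iso: "relative_homology_group p (top_of_set ?X) (?X - {0}) \<cong>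
      relative_homology_group p (Euclidean_space k) (topspace (Euclidean_space k) - {\<lambda>_. 0})" for p
  proof (rule iso_trans)
    show "relative_homology_group p (top_of_set ?X) (?X - {0}) \<cong>
        relative_homology_group p (top_of_set (range P)) (range P - {0})"
    proof (rule sublevel_homology[OF P PP _ _ _ _ _ _ G \<Psi> U, where c="c' / 2" and C="C / 2"])
      show "c' / 2 > 0" "C / 2 > 0" using c' C by simp_all
      show "\<beta> v v / 2 \<le> C / 2 * (norm v)\<^sup>2" for v using upper[of v] by simp
      show "c' / 2 * (norm v)\<^sup>2 \<le> \<beta> v v / 2" if "P v = 0" for v
        using coercive[OF ker[OF that]] mult_right_mono[OF c'(2), of "(norm v)\<^sup>2"] by simp
      show "\<beta> w w / 2 \<le> - (c' / 2) * (norm w)\<^sup>2" if "P w = w" for w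
        using negative[OF that c'(3)] c'(1) by simp
      show "\<beta> (s *\<^sub>R v + w) (s *\<^sub>R v + w) / 2 = s\<^sup>2 * (\<beta> v v / 2) + \<beta> w w / 2"
        if "P v = 0" "P w = w" for s v w
      proof -
        \<comment> \<open>The mixed term: \<open>w\<close> is a combination of the vectors
          \<open>e i\<close>, to which the kernel of \<open>P\<close> is \<beta>-orthogonal.\<close>
        have "\<beta> w v = (\<Sum>i<k. f i w * \<beta> (e i) v)"
          using form_sum_left[of "\<lambda>i. f i w" e "{..<k}" v] that(2) by (metis P_def)
        also have "\<dots> = 0"
          using ker[OF that(1)] by (intro sum.neutral) (auto simp: sym[of "e _" v])
        finally have "\<beta> w v = 0" .
        then show ?thesis by (simp add: form_simps sym[of v w] power2_eq_square field_simps)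
      qed
    qed
    show "relative_homology_group p (top_of_set (range P)) (range P - {0}) \<cong>
        relative_homology_group p (Euclidean_space k) (topspace (Euclidean_space k) - {\<lambda>_. 0})"
      by (rule relative_homology_frame[where e=e and f=f]) (use f fe in \<open>auto simp: P_def[abs_def]\<close>)
  qed
  have triv: "trivial_group (relative_homology_group (int q) (top_of_set ?X) (?X - {0}))" if "q \<noteq> k" for q
    using isomorphic_group_triviality[OF iso] relative_homology_Euclidean_origin(1)[OF that] by simp
  have gen: "relative_homology_group (int k) (top_of_set ?X) (?X - {0}) \<cong> integer_group"
    by (rule iso_trans[OF iso relative_homology_Euclidean_origin(2)[OF refl]])
  show "q \<noteq> k \<Longrightarrow> trivial_group (critical_group TYPE('g) q \<Psi> U)"
    unfolding critical_group_def by (rule coeff_homology_of_integer_homology(1)[OF triv gen])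
  show "critical_group TYPE('g) k \<Psi> U \<cong> additive_group TYPE('g)"
    unfolding critical_group_def by (rule coeff_homology_of_integer_homology(2)[OF triv gen])
qed

subsection \<open>Green functions\<close>

text \<open>The Green function of \<open>- u''\<close> on the unit interval with zero boundary
  values and pole \<open>a\<close>. The value 0 outside is the convention for representatives of
  elements of \<open>H10\<close>.\<close>

definition green_fun :: "real \<Rightarrow> real \<Rightarrow> real"
  where "green_fun a t = (if t \<in> {0<..<1} then min t a - a * t else 0)"

text \<open>At the kink the left slope is taken. The slope drops by 1 across \<open>a\<close>, which
  is the origin of the interface conditions.\<close>

definition green_deriv :: "real \<Rightarrow> real \<Rightarrow> real"
  where "green_deriv a t = (if t \<le> a then 1 - a else - a)"

definition green :: "real \<Rightarrow> H10"
  where "green a = Abs_H10 (green_fun a)"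

lemma green_fun_eq: "0 < a \<Longrightarrow> a < 1 \<Longrightarrow> t \<in> {0..1} \<Longrightarrow> green_fun a t = min t a - a * t"
  by (auto simp: green_fun_def min_def)

lemma green_fun_cont: "0 < a \<Longrightarrow> a < 1 \<Longrightarrow> continuous_on {0..1} (green_fun a)"
  using continuous_on_cong[OF refl, of "{0..1}" "green_fun a" "\<lambda>t. min t a - a * t"]
  by (auto simp: green_fun_eq intro!: continuous_intros)

lemma green_deriv_measurable [measurable]: "green_deriv a \<in> borel_measurable unit_ival"
proof -
  have "green_deriv a \<in> borel_measurable borel" unfolding green_deriv_def by measurable
  then show ?thesis by (intro measurable_restrict_space1 measurable_completion) simp
qed

lemma green_deriv_bound: "0 < a \<Longrightarrow> a < 1 \<Longrightarrow> \<bar>green_deriv a t\<bar> \<le> 1"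
  by (auto simp: green_deriv_def)

lemma green_deriv_locally_const:
  assumes "t \<noteq> a"
  shows "\<forall>\<^sub>F s in nhds t. green_deriv a s = green_deriv a t"
proof (cases "t < a")
  case True
  then show ?thesis
    unfolding eventually_nhds by (intro exI[of _ "{..<a}"]) (auto simp: green_deriv_def)
next
  case False
  then show ?thesis
    unfolding eventually_nhds using assms by (intro exI[of _ "{a<..}"]) (auto simp: green_deriv_def)
qed

lemma green_fun_has_deriv:
  assumes a: "0 < a" "a < 1" and t: "t \<in> {0<..<1}" "t \<noteq> a"
  shows "(green_fun a has_real_derivative green_deriv a t) (at t)"
proof (cases "t < a")
  case True
  have "((\<lambda>t. t - a * t) has_real_derivative 1 - a) (at t)"
    by (auto intro!: derivative_eq_intros)
  then have "(green_fun a has_real_derivative 1 - a) (at t)"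
    by (rule has_field_derivative_transform_within_open[where S="{0<..<a}"])
       (use True t a in \<open>auto simp: green_fun_def\<close>)
  then show ?thesis using True by (simp add: green_deriv_def)
next
  case False
  have "((\<lambda>t. a - a * t) has_real_derivative - a) (at t)"
    by (auto intro!: derivative_eq_intros)
  then have "(green_fun a has_real_derivative - a) (at t)"
    by (rule has_field_derivative_transform_within_open[where S="{a<..<1}"])
       (use False t a in \<open>auto simp: green_fun_def\<close>)
  then show ?thesis using False t by (simp add: green_deriv_def)
qed

text \<open>Integration by parts across one kink: the fundamental theorem tolerates the exceptional
  point \<open>a\<close>, and the boundary terms vanish with \<open>green_fun\<close>.\<close>

lemma weak_L2_deriv_green:
  assumes a: "0 < a" "a < 1"
  shows "weak_L2_deriv (green_fun a) (green_deriv a)"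
  unfolding weak_L2_deriv_def
proof (intro conjI allI impI)
  interpret finite_measure unit_ival by (rule finite_measure_unit_ival)
  show "green_deriv a \<in> borel_measurable unit_ival" by measurable
  show sq: "integrable unit_ival (\<lambda>t. (green_deriv a t)\<^sup>2)"
    by (intro integrable_const_bound[where B=1]) (auto simp: abs_square_le_1 green_deriv_bound[OF a])
  have ig: "integrable unit_ival (green_deriv a)"
    using green_deriv_bound[OF a] by (intro integrable_const_bound[where B=1]) auto
  fix \<phi> \<phi>' assume \<phi>: "C1_test \<phi> \<phi>'"
  have i1: "integrable unit_ival (\<lambda>t. green_fun a t * \<phi>' t)"
    by (intro integrable_unit_ival_cont continuous_on_mult green_fun_cont a C1_test_cont(2)[OF \<phi>])
  have i2: "integrable unit_ival (\<lambda>t. green_deriv a t * \<phi> t)"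
    by (rule weak_L2_deriv_integrable_test[OF ig \<phi>])
  have "((\<lambda>t. green_fun a t * \<phi>' t + green_deriv a t * \<phi> t) has_integral
      (green_fun a 1 * \<phi> 1 - green_fun a 0 * \<phi> 0)) {0..1}"
  proof (rule fundamental_theorem_of_calculus_interior_strong[where S="{a}"])
    show "continuous_on {0..1} (\<lambda>t. green_fun a t * \<phi> t)"
      by (intro continuous_on_mult green_fun_cont a C1_test_cont(1)[OF \<phi>])
    fix t assume "t \<in> {0<..<1} - {a}"
    then have "(green_fun a has_real_derivative green_deriv a t) (at t)"
      by (intro green_fun_has_deriv a) auto
    moreover have "(\<phi> has_real_derivative \<phi>' t) (at t)" using \<phi> by (simp add: C1_test_def)
    ultimately have "((\<lambda>t. green_fun a t * \<phi> t) has_real_derivative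
        (green_fun a t * \<phi>' t + green_deriv a t * \<phi> t)) (at t)"
      by (auto intro!: derivative_eq_intros)
    then show "((\<lambda>t. green_fun a t * \<phi> t) has_vector_derivative
        (green_fun a t * \<phi>' t + green_deriv a t * \<phi> t)) (at t)"
      by (simp add: has_real_derivative_iff_has_vector_derivative)
  qed auto
  then have "((\<lambda>t. green_fun a t * \<phi>' t + green_deriv a t * \<phi> t) has_integral 0) {0<..<1}"
    by (simp add: green_fun_def has_integral_Icc_iff_Ioo)
  moreover have "((\<lambda>t. green_fun a t * \<phi>' t + green_deriv a t * \<phi> t) has_integral
      (LINT t|unit_ival. green_fun a t * \<phi>' t + green_deriv a t * \<phi> t)) {0<..<1}"
    by (rule has_integral_integral_lebesgue_on[OF Bochner_Integration.integrable_add[OF i1 i2]]) simp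
  ultimately have "(LINT t|unit_ival. green_fun a t * \<phi>' t + green_deriv a t * \<phi> t) = 0"
    using has_integral_unique by blast
  then show "(LINT t|unit_ival. green_fun a t * \<phi>' t) = - (LINT t|unit_ival. green_deriv a t * \<phi> t)"
    using i1 i2 by simp
qed

lemma fun_of_green:
  assumes "0 < a" "a < 1"
  shows "fun_of (green a) = green_fun a"
  unfolding green_def
  using green_fun_cont[OF assms] weak_L2_deriv_green[OF assms]
  by (intro Abs_H10_inverse) (auto simp: H10_functions_def green_fun_def)

text \<open>The reproducing property. The fundamental theorem for weak derivatives concerns
  endpoints inside the open interval, so the integral is cut off near 0 and 1 and split at
  \<open>a\<close>. In the limit the boundary values of \<open>u\<close> vanish, and the slopes
  \<open>1 - a\<close> and \<open>- a\<close> contribute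
  \<open>(1 - a) * fun_of u a + a * fun_of u a\<close>.\<close>

lemma inner_green:
  assumes a: "0 < a" "a < 1"
  shows "u \<bullet> green a = fun_of u a"
proof -
  let ?w = "weak_deriv u"
  have iw: "integrable unit_ival ?w" by (rule weak_L2_deriv_integrable[OF weak_deriv])
  have "u \<bullet> green a = (LINT t|unit_ival. ?w t * green_deriv a t)"
    unfolding inner_H10_def
    using weak_deriv_AE[of "green a" "green_deriv a"] weak_L2_deriv_green[OF a]
    by (intro integral_cong_AE) (auto simp: fun_of_green[OF a])
  define \<mu> where "\<mu> = min a (1 - a)"
  have \<mu>: "\<mu> > 0" "\<mu> \<le> a" "\<mu> \<le> 1 - a" using a by (auto simp: \<mu>_def)
  \<comment> \<open>The shift by \<open>N\<close> keeps both cut-off points on the correct sides of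
    \<open>a\<close> from \<open>n = 0\<close> on.\<close>
  define N :: nat where "N = nat \<lceil>1 / \<mu>\<rceil> + 1"
  have N: "1 / real (n + N) < a" "1 / real (n + N) < 1 - a" for n
  proof -
    have "1 / \<mu> < real (n + N)" unfolding N_def by linarith
    then have "1 < real (n + N) * \<mu>" using \<mu>(1) by (simp only: divide_less_eq if_True)
    moreover have "0 < real (n + N)" by (simp add: N_def)
    ultimately have "1 / real (n + N) < \<mu>" by (simp only: divide_less_eq if_True mult.commute)
    then show "1 / real (n + N) < a" "1 / real (n + N) < 1 - a" using \<mu> by linarith+
  qed
  have Npos: "real (n + N) > 0" for n by (simp add: N_def)
  let ?l = "\<lambda>n. 1 / real (n + N)" and ?r = "\<lambda>n. 1 - 1 / real (n + N)"
  have [measurable]: "(indicator {c<..d} :: real \<Rightarrow> real) \<in> borel_measurable unit_ival" for c d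
    by (intro measurable_restrict_space1 measurable_completion) simp
  have step: "(LINT t|unit_ival. ?w t * green_deriv a t * indicator {?l n<..?r n} t) =
      (1 - a) * (fun_of u a - fun_of u (?l n)) - a * (fun_of u (?r n) - fun_of u a)" for n
  proof -
    have i: "integrable unit_ival (\<lambda>t. ?w t * indicator {c<..d} t)" for c d
    proof (rule Bochner_Integration.integrable_bound[OF iw])
      show "(\<lambda>t. ?w t * indicator {c<..d} t) \<in> borel_measurable unit_ival" by measurable
    qed (auto simp: indicator_def)
    have "?w t * green_deriv a t * indicator {?l n<..?r n} t =
        (1 - a) * (?w t * indicator {?l n<..a} t) - a * (?w t * indicator {a<..?r n} t)" for t
      using N[of n] by (auto simp: green_deriv_def indicator_def)
    then have "(LINT t|unit_ival. ?w t * green_deriv a t * indicator {?l n<..?r n} t) =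
        (1 - a) * (LINT t|unit_ival. ?w t * indicator {?l n<..a} t) -
        a * (LINT t|unit_ival. ?w t * indicator {a<..?r n} t)"
      using i by simp
    also have "(LINT t|unit_ival. ?w t * indicator {?l n<..a} t) = fun_of u a - fun_of u (?l n)"
      using N[of n] Npos[of n] a by (intro weak_L2_deriv_FTC[symmetric, OF fun_of_cont weak_deriv]) auto
    also have "(LINT t|unit_ival. ?w t * indicator {a<..?r n} t) = fun_of u (?r n) - fun_of u a"
      using N[of n] Npos[of n] a by (intro weak_L2_deriv_FTC[symmetric, OF fun_of_cont weak_deriv]) auto
    finally show ?thesis .
  qed
  have l0: "?l \<longlonglongrightarrow> 0"
    using LIMSEQ_ignore_initial_segment[OF lim_1_over_n, of N] by simp
  have r1: "?r \<longlonglongrightarrow> 1" using tendsto_diff[OF tendsto_const l0, of 1] by simp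
  have lr: "?l n \<in> {0..1}" "?r n \<in> {0..1}" for n using N[of n] a by auto
  have "(\<lambda>n. LINT t|unit_ival. ?w t * green_deriv a t * indicator {?l n<..?r n} t) \<longlonglongrightarrow>
      (LINT t|unit_ival. ?w t * green_deriv a t)"
  proof (rule integral_dominated_convergence)
    show "integrable unit_ival (\<lambda>t. \<bar>?w t\<bar>)" using iw by simp
    show "AE t in unit_ival. norm (?w t * green_deriv a t * indicator {?l n<..?r n} t) \<le> \<bar>?w t\<bar>" for n
    proof (rule AE_I2)
      fix t
      show "norm (?w t * green_deriv a t * indicator {?l n<..?r n} t) \<le> \<bar>?w t\<bar>"
        using green_deriv_bound[OF a, of t] by (auto simp: indicator_def abs_mult mult_left_le)
    qed
    show "AE t in unit_ival. (\<lambda>n. ?w t * green_deriv a t * indicator {?l n<..?r n} t) \<longlonglongrightarrow> ?w t * green_deriv a t"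
    proof (rule AE_I2)
      fix t :: real assume "t \<in> space unit_ival"
      then have t: "0 < t" "t < 1" by auto
      have "\<forall>\<^sub>F n in sequentially. ?l n < t" "\<forall>\<^sub>F n in sequentially. t < ?r n"
        using order_tendstoD(2)[OF l0 t(1)] order_tendstoD(1)[OF r1 t(2)] by auto
      then have "\<forall>\<^sub>F n in sequentially. ?w t * green_deriv a t * indicator {?l n<..?r n} t = ?w t * green_deriv a t"
        by eventually_elim auto
      then show "(\<lambda>n. ?w t * green_deriv a t * indicator {?l n<..?r n} t) \<longlonglongrightarrow> ?w t * green_deriv a t"
        by (rule tendsto_eventually)
    qed
  qed measurable
  moreover have "(\<lambda>n. (1 - a) * (fun_of u a - fun_of u (?l n)) - a * (fun_of u (?r n) - fun_of u a)) \<longlonglongrightarrow>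
      (1 - a) * (fun_of u a - fun_of u 0) - a * (fun_of u 1 - fun_of u a)"
    using continuous_on_tendsto_compose[OF fun_of_cont[of u] l0] continuous_on_tendsto_compose[OF fun_of_cont[of u] r1] lr
    by (intro tendsto_intros) auto
  ultimately have "(LINT t|unit_ival. ?w t * green_deriv a t) =
      (1 - a) * (fun_of u a - fun_of u 0) - a * (fun_of u 1 - fun_of u a)"
    unfolding step by (rule LIMSEQ_unique)
  also have "\<dots> = fun_of u a"
    using fun_of_outside[of 0 u] fun_of_outside[of 1 u] by (simp add: algebra_simps)
  finally show ?thesis using \<open>u \<bullet> green a = _\<close> by simp
qed

text \<open>Evaluation at \<open>t\<close> is the inner product with \<open>green t\<close>, whose
  squared norm is by the same property its own value \<open>t - t * t\<close> at \<open>t\<close>.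
  This uniform bound transfers the pointwise assumptions at 0 to small balls of
  \<open>H10\<close>.\<close>

lemma fun_of_le_norm: "\<bar>fun_of u t\<bar> \<le> norm u"
proof (cases "t \<in> {0<..<1}")
  case True
  then have t: "0 < t" "t < 1" by auto
  have "(norm (green t))\<^sup>2 = green_fun t t"
    by (simp add: power2_norm_eq_inner inner_green[OF t] fun_of_green[OF t])
  also have "\<dots> = t - t * t" using t by (simp add: green_fun_def)
  also have "\<dots> \<le> 1" using t mult_pos_pos[OF t(1) t(1)] by linarith
  finally have "(norm (green t))\<^sup>2 \<le> 1\<^sup>2" by simp
  then have "norm (green t) \<le> 1" by (rule power2_le_imp_le) simp
  then have "\<bar>u \<bullet> green t\<bar> \<le> norm u"
    using Cauchy_Schwarz_ineq2[of u "green t"] mult_left_le[of "norm (green t)" "norm u"] by simp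
  then show ?thesis by (simp add: inner_green[OF t])
next
  case False
  then show ?thesis by (simp add: fun_of_outside)
qed

subsection \<open>The functional\<close>

lemma primitive_zero [simp]: "primitive g 0 = 0"
  by (simp add: primitive_def zero_ereal_def)

text \<open>The mean value inequality on \<open>{- r..r}\<close> with
  \<open>r = max \<bar>a\<bar> \<bar>b\<bar>\<close>, where the derivative
  \<open>g s - c * s\<close> is at most \<open>\<epsilon> * r\<close>. It is used with
  \<open>c = 0\<close> for \<open>f t\<close> and with \<open>c = b j\<close> for
  \<open>\<iota> j\<close>.\<close>

lemma primitive_remainder_Lipschitz:
  assumes g: "continuous_on UNIV g" and small: "\<And>s. \<bar>s\<bar> \<le> \<delta> \<Longrightarrow> \<bar>g s - c * s\<bar> \<le> \<epsilon> * \<bar>s\<bar>"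
    and ab: "\<bar>a\<bar> \<le> \<delta>" "\<bar>b\<bar> \<le> \<delta>" and "\<epsilon> \<ge> 0"
  shows "\<bar>(primitive g a - c * a\<^sup>2 / 2) - (primitive g b - c * b\<^sup>2 / 2)\<bar> \<le> \<epsilon> * max \<bar>a\<bar> \<bar>b\<bar> * \<bar>a - b\<bar>"
proof -
  define r where "r = max \<bar>a\<bar> \<bar>b\<bar>"
  have r: "0 \<le> r" "r \<le> \<delta>" "a \<in> {- r..r}" "b \<in> {- r..r}" using ab by (auto simp: r_def)
  have "norm ((primitive g a - c * a\<^sup>2 / 2) - (primitive g b - c * b\<^sup>2 / 2)) \<le> (\<epsilon> * r) * norm (a - b)"
  proof (rule field_differentiable_bound[where S="{- r..r}" and f'="\<lambda>s. g s - c * s"])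
    fix s assume s: "s \<in> {- r..r}"
    have "((\<lambda>u. LBINT y=0..u. g y) has_vector_derivative g s) (at s within {- r..r})"
      using interval_integral_FTC2[of "- r" 0 r g s] r s continuous_on_subset[OF g]
      by (simp add: zero_ereal_def)
    then have "(primitive g has_real_derivative g s) (at s within {- r..r})"
      by (simp add: primitive_def[abs_def] has_real_derivative_iff_has_vector_derivative)
    then show "((\<lambda>s. primitive g s - c * s\<^sup>2 / 2) has_field_derivative (g s - c * s)) (at s within {- r..r})"
      by (auto intro!: derivative_eq_intros)
    have "\<bar>g s - c * s\<bar> \<le> \<epsilon> * \<bar>s\<bar>" using s r by (intro small) auto
    also have "\<dots> \<le> \<epsilon> * r" using s \<open>\<epsilon> \<ge> 0\<close> by (intro mult_left_mono) auto
    finally show "norm (g s - c * s) \<le> \<epsilon> * r" by simp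
  qed (use r in auto)
  then show ?thesis by (simp add: r_def)
qed

definition Phi_remainder ::
    "nat \<Rightarrow> (nat \<Rightarrow> real) \<Rightarrow> (nat \<Rightarrow> real) \<Rightarrow> (real \<Rightarrow> real \<Rightarrow> real) \<Rightarrow> (nat \<Rightarrow> real \<Rightarrow> real) \<Rightarrow> H10 \<Rightarrow> real"
  where "Phi_remainder m x b f \<iota> u =
    - (LINT t|unit_ival. primitive (f t) (fun_of u t))
    - (\<Sum>j=1..m. primitive (\<iota> j) (fun_of u (x j)) - b j * (fun_of u (x j))\<^sup>2 / 2)"

lemma Phi_remainder_Lipschitz:
  assumes f: "caratheodory f" and \<iota>: "\<And>j. j \<in> {1..m} \<Longrightarrow> continuous_on UNIV (\<iota> j)"
    and int: "\<And>u :: H10. integrable unit_ival (\<lambda>t. primitive (f t) (fun_of u t))"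
    and f0: "\<And>\<epsilon>. \<epsilon> > 0 \<Longrightarrow> \<exists>\<delta>>0. AE t in unit_ival. \<forall>s. \<bar>s\<bar> \<le> \<delta> \<longrightarrow> \<bar>f t s\<bar> \<le> \<epsilon> * \<bar>s\<bar>"
    and \<iota>0: "\<And>j \<epsilon>. j \<in> {1..m} \<Longrightarrow> \<epsilon> > 0 \<Longrightarrow> \<exists>\<delta>>0. \<forall>s. \<bar>s\<bar> \<le> \<delta> \<longrightarrow> \<bar>\<iota> j s - b j * s\<bar> \<le> \<epsilon> * \<bar>s\<bar>"
    and "\<epsilon> > 0"
  shows "\<exists>\<delta>>0. \<forall>u v. norm u \<le> \<delta> \<longrightarrow> norm v \<le> \<delta> \<longrightarrow>
    \<bar>Phi_remainder m x b f \<iota> u - Phi_remainder m x b f \<iota> v\<bar> \<le> \<epsilon> * max (norm u) (norm v) * norm (u - v)"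
proof -
  interpret finite_measure unit_ival by (rule finite_measure_unit_ival)
  \<comment> \<open>One share of \<epsilon> for the integral, over an interval of measure 1, and one
    for each of the \<open>m\<close> nodes.\<close>
  define \<eta> where "\<eta> = \<epsilon> / (1 + real m)"
  have \<epsilon>_eq: "\<epsilon> = \<eta> * (1 + real m)" by (simp add: \<eta>_def)
  have \<eta>: "\<eta> > 0" using \<open>\<epsilon> > 0\<close> by (simp add: \<eta>_def)
  obtain \<delta>f where \<delta>f: "\<delta>f > 0" "AE t in unit_ival. \<forall>s. \<bar>s\<bar> \<le> \<delta>f \<longrightarrow> \<bar>f t s\<bar> \<le> \<eta> * \<bar>s\<bar>"
    using f0[OF \<eta>] by blast
  have "\<forall>j\<in>{1..m}. \<exists>\<delta>>0. \<forall>s. \<bar>s\<bar> \<le> \<delta> \<longrightarrow> \<bar>\<iota> j s - b j * s\<bar> \<le> \<eta> * \<bar>s\<bar>"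
    using \<iota>0[OF _ \<eta>] by blast
  then obtain d where d: "\<And>j. j \<in> {1..m} \<Longrightarrow> d j > 0"
    "\<And>j s. j \<in> {1..m} \<Longrightarrow> \<bar>s\<bar> \<le> d j \<Longrightarrow> \<bar>\<iota> j s - b j * s\<bar> \<le> \<eta> * \<bar>s\<bar>"
    by metis
  define \<delta> where "\<delta> = Min (insert \<delta>f (d ` {1..m}))"
  have \<delta>: "\<delta> > 0" "\<delta> \<le> \<delta>f" "\<And>j. j \<in> {1..m} \<Longrightarrow> \<delta> \<le> d j"
  proof -
    show "\<delta> > 0" unfolding \<delta>_def using \<delta>f(1) d(1) by (subst Min_gr_iff) auto
    show "\<delta> \<le> \<delta>f" "\<And>j. j \<in> {1..m} \<Longrightarrow> \<delta> \<le> d j"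
      unfolding \<delta>_def by (rule Min_le; simp)+
  qed
  show ?thesis
  proof (intro exI[of _ \<delta>] conjI allI impI \<delta>(1))
    fix u v :: H10 assume u: "norm u \<le> \<delta>" and v: "norm v \<le> \<delta>"
    define B where "B = \<eta> * max (norm u) (norm v) * norm (u - v)"
    have B: "\<eta> * max \<bar>fun_of u t\<bar> \<bar>fun_of v t\<bar> * \<bar>fun_of u t - fun_of v t\<bar> \<le> B" for t
      unfolding B_def using fun_of_le_norm[of u t] fun_of_le_norm[of v t] fun_of_le_norm[of "u - v" t] \<eta>
      by (intro mult_mono) (auto simp: fun_of_minus)
    have small: "\<bar>fun_of u t\<bar> \<le> \<delta>" "\<bar>fun_of v t\<bar> \<le> \<delta>" for t
      using fun_of_le_norm[of u t] fun_of_le_norm[of v t] u v by linarith+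
    let ?F = "\<lambda>u t. primitive (f t) (fun_of u t)"
    have "AE t in unit_ival. continuous_on UNIV (f t)" using f by (simp add: caratheodory_def)
    then have AE: "AE t in unit_ival. norm (?F u t - ?F v t) \<le> B"
      using \<delta>f(2)
    proof eventually_elim
      case (elim t)
      have "\<bar>(?F u t - 0 * (fun_of u t)\<^sup>2 / 2) - (?F v t - 0 * (fun_of v t)\<^sup>2 / 2)\<bar> \<le>
          \<eta> * max \<bar>fun_of u t\<bar> \<bar>fun_of v t\<bar> * \<bar>fun_of u t - fun_of v t\<bar>"
        using elim \<eta> small order_trans[OF small(1) \<delta>(2)] order_trans[OF small(2) \<delta>(2)]
        by (intro primitive_remainder_Lipschitz[where \<delta>=\<delta>f]) auto
      then show ?case using B[of t] by simp
    qed
    have "\<bar>(LINT t|unit_ival. ?F u t) - (LINT t|unit_ival. ?F v t)\<bar> = norm (LINT t|unit_ival. ?F u t - ?F v t)"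
      using int by simp
    also have "\<dots> \<le> (LINT t|unit_ival. norm (?F u t - ?F v t))"
      by (rule integral_norm_bound)
    also have "\<dots> \<le> (LINT t|unit_ival. B)"
      using int AE by (intro integral_mono_AE) auto
    also have "\<dots> = B"
      by (simp add: measure_restrict_space)
    finally have F: "\<bar>(LINT t|unit_ival. ?F u t) - (LINT t|unit_ival. ?F v t)\<bar> \<le> B" .
    let ?R = "\<lambda>u j. primitive (\<iota> j) (fun_of u (x j)) - b j * (fun_of u (x j))\<^sup>2 / 2"
    have R: "\<bar>?R u j - ?R v j\<bar> \<le> B" if j: "j \<in> {1..m}" for j
      using small[of "x j"] \<delta>(3)[OF j] \<eta>
      by (intro order_trans[OF primitive_remainder_Lipschitz[OF \<iota>[OF j] d(2)[OF j]] B]) auto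
    have "\<bar>(\<Sum>j=1..m. ?R u j) - (\<Sum>j=1..m. ?R v j)\<bar> \<le> (\<Sum>j=1..m. \<bar>?R u j - ?R v j\<bar>)"
      unfolding sum_subtractf[symmetric] by (rule sum_abs)
    also have "\<dots> \<le> real m * B"
      using sum_bounded_above[of "{1..m}" "\<lambda>j. \<bar>?R u j - ?R v j\<bar>" B] R by simp
    finally have "\<bar>Phi_remainder m x b f \<iota> u - Phi_remainder m x b f \<iota> v\<bar> \<le> B + real m * B"
      using F unfolding Phi_remainder_def by linarith
    also have "\<dots> = \<epsilon> * max (norm u) (norm v) * norm (u - v)"
      unfolding B_def \<epsilon>_eq by (simp add: algebra_simps)
    finally show "\<bar>Phi_remainder m x b f \<iota> u - Phi_remainder m x b f \<iota> v\<bar> \<le>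
        \<epsilon> * max (norm u) (norm v) * norm (u - v)" .
  qed
qed

lemma Phi_eq: "Phi m x f \<iota> u = Phi_quad m x b u + Phi_remainder m x b f \<iota> u"
  by (simp add: Phi_def Phi_quad_def Phi_remainder_def sum_subtractf sum_divide_distrib right_diff_distrib)

section \<open>Nodes and piecewise affine functions\<close>

lemma subspace_piecewise_affine: "subspace (piecewise_affine m x)"
  unfolding subspace_def piecewise_affine_def
proof (clarsimp simp: fun_of_zero fun_of_plus fun_of_scaleR, intro conjI allI impI ballI)
  show "\<exists>p q. \<forall>t\<in>{x (j - Suc 0)..x j}. p + q * t = 0" for j
    by (intro exI[of _ 0]) simp
next
  fix u v :: H10 and j
  assume u: "\<forall>j\<in>{Suc 0..Suc m}. \<exists>p q. \<forall>t\<in>{x (j - Suc 0)..x j}. fun_of u t = p + q * t"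
    and v: "\<forall>j\<in>{Suc 0..Suc m}. \<exists>p q. \<forall>t\<in>{x (j - Suc 0)..x j}. fun_of v t = p + q * t"
    and j: "j \<in> {Suc 0..Suc m}"
  obtain p q p' q' where "\<forall>t\<in>{x (j - Suc 0)..x j}. fun_of u t = p + q * t"
      "\<forall>t\<in>{x (j - Suc 0)..x j}. fun_of v t = p' + q' * t"
    using u v j by blast
  then show "\<exists>p q. \<forall>t\<in>{x (j - Suc 0)..x j}. fun_of u t + fun_of v t = p + q * t"
    by (intro exI[of _ "p + p'"] exI[of _ "q + q'"]) (simp add: algebra_simps)
next
  fix c and u :: H10 and j
  assume u: "\<forall>j\<in>{Suc 0..Suc m}. \<exists>p q. \<forall>t\<in>{x (j - Suc 0)..x j}. fun_of u t = p + q * t"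
    and j: "j \<in> {Suc 0..Suc m}"
  obtain p q where "\<forall>t\<in>{x (j - Suc 0)..x j}. fun_of u t = p + q * t"
    using u j by blast
  then show "\<exists>p q. \<forall>t\<in>{x (j - Suc 0)..x j}. c * fun_of u t = p + q * t"
    by (intro exI[of _ "c * p"] exI[of _ "c * q"]) (simp add: algebra_simps)
qed

locale nodes =
  fixes m :: nat and x :: "nat \<Rightarrow> real"
  assumes x0: "x 0 = 0" and x1: "x (m + 1) = 1" and mono: "strict_mono_on {0..m + 1} x"
begin

lemma node_less: "i < j \<Longrightarrow> j \<le> m + 1 \<Longrightarrow> x i < x j"
  using mono by (auto simp: strict_mono_on_def)

lemma node_le: "i \<le> j \<Longrightarrow> j \<le> m + 1 \<Longrightarrow> x i \<le> x j"
  using node_less[of i j] by (cases "i = j") auto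

lemma node_interior: "j \<in> {1..m} \<Longrightarrow> 0 < x j" "j \<in> {1..m} \<Longrightarrow> x j < 1"
  using node_less[of 0 j] node_less[of j "m + 1"] x0 x1 by auto

lemma node_01: "j \<le> m + 1 \<Longrightarrow> x j \<in> {0..1}"
  using node_le[of 0 j] node_le[of j "m + 1"] x0 x1 by auto

lemma node_cover:
  assumes "t \<in> {0<..<1}"
  obtains j where "j \<in> {1..m + 1}" "t \<in> {x (j - 1)..x j}"
proof -
  define j where "j = (LEAST j. t \<le> x j)"
  have "t \<le> x (m + 1)" using assms x1 by simp
  then have j: "t \<le> x j" "j \<le> m + 1" unfolding j_def by (auto intro: LeastI Least_le)
  have "j \<noteq> 0" using j assms x0 by (intro notI) auto
  then have "\<not> t \<le> x (j - 1)" using not_less_Least[of "j - 1" "\<lambda>j. t \<le> x j"] by (simp add: j_def)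
  with j \<open>j \<noteq> 0\<close> show thesis by (intro that[of j]) auto
qed

lemma inner_green_node: "j \<in> {1..m} \<Longrightarrow> u \<bullet> green (x j) = fun_of u (x j)"
  by (rule inner_green) (auto intro: node_interior)

lemma green_node_piecewise_affine:
  assumes j: "j \<in> {1..m}"
  shows "green (x j) \<in> piecewise_affine m x"
  unfolding piecewise_affine_def
proof (intro CollectI ballI)
  fix i assume i: "i \<in> {1..m + 1}"
  have fg: "fun_of (green (x j)) t = min t (x j) - x j * t" if t: "t \<in> {x (i - 1)..x i}" for t
  proof -
    have "i - 1 \<le> m + 1" "i \<le> m + 1" using i by auto
    then have "x (i - 1) \<in> {0..1}" "x i \<in> {0..1}" by (blast intro: node_01)+
    then have "t \<in> {0..1}" using t by auto
    then show ?thesis using node_interior[OF j] by (simp add: fun_of_green green_fun_eq)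
  qed
  show "\<exists>p q. \<forall>t\<in>{x (i - 1)..x i}. fun_of (green (x j)) t = p + q * t"
  proof (cases "i \<le> j")
    case True
    then have "x i \<le> x j" using j by (intro node_le) auto
    then show ?thesis
      by (intro exI[of _ 0] exI[of _ "1 - x j"]) (auto simp: fg algebra_simps)
  next
    case False
    then have "x j \<le> x (i - 1)" using i by (intro node_le) auto
    then show ?thesis
      by (intro exI[of _ "x j"] exI[of _ "- x j"]) (auto simp: fg)
  qed
qed

text \<open>On each piece an affine function vanishes at two distinct endpoints; the boundary values
  take care of the outermost nodes.\<close>

lemma piecewise_affine_eqI:
  assumes w: "w \<in> piecewise_affine m x" and 0: "\<And>j. j \<in> {1..m} \<Longrightarrow> fun_of w (x j) = 0"
  shows "w = 0"
proof (rule H10_eqI, rule ext)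
  have node0: "fun_of w (x j) = 0" if "j \<le> m + 1" for j
  proof -
    consider "j = 0" | "j = m + 1" | "j \<in> {1..m}" using \<open>j \<le> m + 1\<close> by force
    then show ?thesis using 0 x0 x1 by cases (auto simp: fun_of_outside)
  qed
  fix t
  show "fun_of w t = fun_of 0 t"
  proof (cases "t \<in> {0<..<1}")
    case True
    then obtain j where j: "j \<in> {1..m + 1}" "t \<in> {x (j - 1)..x j}" by (rule node_cover)
    then obtain p q where pq: "\<And>s. s \<in> {x (j - 1)..x j} \<Longrightarrow> fun_of w s = p + q * s"
      using w unfolding piecewise_affine_def by blast
    have less: "x (j - 1) < x j" using j by (intro node_less) auto
    have "p + q * x (j - 1) = 0" "p + q * x j = 0"
      using pq[of "x (j - 1)"] pq[of "x j"] node0[of "j - 1"] node0[of j] j less by auto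
    moreover have "q * (x j - x (j - 1)) = (p + q * x j) - (p + q * x (j - 1))"
      by (simp only: right_diff_distrib add_diff_add diff_self add_0)
    ultimately have "q * (x j - x (j - 1)) = 0" by simp
    then have "q = 0" using less by simp
    moreover have "p = 0" using \<open>p + q * x j = 0\<close> \<open>q = 0\<close> by simp
    ultimately show ?thesis using pq[OF j(2)] by (simp add: fun_of_zero)
  qed (simp add: fun_of_outside)
qed


text \<open>For the inclusion into the span no coefficients are computed: the residue
  \<open>w - p\<close> of the orthogonal projection is piecewise affine and orthogonal to all Green
  functions, so by the reproducing property it vanishes at all nodes.\<close>

lemma piecewise_affine_eq_span: "piecewise_affine m x = span ((\<lambda>j. green (x j)) ` {1..m})"
proof
  show "span ((\<lambda>j. green (x j)) ` {1..m}) \<subseteq> piecewise_affine m x"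
    by (rule span_minimal) (auto intro: green_node_piecewise_affine subspace_piecewise_affine)
  show "piecewise_affine m x \<subseteq> span ((\<lambda>j. green (x j)) ` {1..m})"
  proof
    fix w assume w: "w \<in> piecewise_affine m x"
    obtain p where p: "p \<in> span ((\<lambda>j. green (x j)) ` {1..m})"
      "\<And>y. y \<in> span ((\<lambda>j. green (x j)) ` {1..m}) \<Longrightarrow> (w - p) \<bullet> y = 0"
      by (rule orthogonal_decomposition[of "(\<lambda>j. green (x j)) ` {1..m}" w]) auto
    have "p \<in> piecewise_affine m x"
      using p(1) \<open>span _ \<subseteq> piecewise_affine m x\<close> by blast
    then have "w - p \<in> piecewise_affine m x"
      using w subspace_piecewise_affine by (simp add: subspace_diff)
    moreover have "fun_of (w - p) (x j) = 0" if "j \<in> {1..m}" for j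
      using p(2)[of "green (x j)"] that by (simp add: inner_green_node span_base)
    ultimately have "w - p = 0" by (rule piecewise_affine_eqI)
    with p(1) show "w \<in> span ((\<lambda>j. green (x j)) ` {1..m})" by simp
  qed
qed

text \<open>Each Green function is affine off its pole and its slope drops by 1 there, so the slope
  of the sum drops at a node by the coefficient of that node, which is the jump prescribed by the
  interface condition.\<close>

lemma interface_solution_green_sum:
  assumes u: "u = (\<Sum>j=1..m. (b j * fun_of u (x j)) *\<^sub>R green (x j))"
  shows "interface_solution m x b (fun_of u)"
proof -
  define c where "c j = b j * fun_of u (x j)" for j
  define u' where "u' t = (\<Sum>j=1..m. c j * green_deriv (x j) t)" for t
  have fun_sum: "fun_of (\<Sum>j\<in>I. c j *\<^sub>R v j) t = (\<Sum>j\<in>I. c j * fun_of (v j) t)" for I :: "nat set" and v t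
    by (induction I rule: infinite_finite_induct) (simp_all add: fun_of_zero fun_of_plus fun_of_scaleR)
  have u_eq: "fun_of u t = (\<Sum>j=1..m. c j * green_fun (x j) t)" for t
  proof -
    have "fun_of u t = fun_of (\<Sum>j=1..m. c j *\<^sub>R green (x j)) t"
      using arg_cong[OF u, of "\<lambda>u. fun_of u t"] by (simp add: c_def)
    then show ?thesis
      unfolding fun_sum by (simp add: fun_of_green node_interior)
  qed
  have deriv: "(fun_of u has_real_derivative u' t) (at t)" if "t \<in> {0<..<1} - x ` {1..m}" for t
    unfolding u_eq[abs_def] u'_def
    by (intro DERIV_sum DERIV_cmult green_fun_has_deriv) (use that node_interior in auto)
  have deriv2: "(u' has_real_derivative 0) (at t)" if "t \<in> {0<..<1} - x ` {1..m}" for t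
  proof -
    have "\<forall>\<^sub>F s in nhds t. \<forall>j\<in>{1..m}. green_deriv (x j) s = green_deriv (x j) t"
      by (intro eventually_ball_finite ballI green_deriv_locally_const) (use that in auto)
    then have "\<forall>\<^sub>F s in nhds t. u' s = u' t"
      by eventually_elim (simp add: u'_def)
    then show ?thesis
      by (subst DERIV_cong_ev[OF refl _ refl]) (auto)
  qed
  have jump: "\<exists>l r. (u' \<longlongrightarrow> l) (at_left (x i)) \<and> (u' \<longlongrightarrow> r) (at_right (x i)) \<and> r = l - b i * fun_of u (x i)"
    if i: "i \<in> {1..m}" for i
  proof (intro exI conjI)
    \<comment> \<open>The one-sided slopes differ only through \<open>\<le>\<close> against
      \<open><\<close>, that is, by 1 for the index \<open>i\<close> and not at all for the
      others.\<close>
    let ?l = "\<lambda>j. if x i \<le> x j then 1 - x j else - x j"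
    let ?r = "\<lambda>j. if x i < x j then 1 - x j else - x j"
    have left: "(green_deriv a \<longlongrightarrow> (if y \<le> a then 1 - a else - a)) (at_left y)" for a y
    proof (rule tendsto_eventually)
      show "\<forall>\<^sub>F s in at_left y. green_deriv a s = (if y \<le> a then 1 - a else - a)"
        by (rule eventually_at_leftI[of "if y \<le> a then y - 1 else a"]) (auto simp: green_deriv_def split: if_splits)
    qed
    have right: "(green_deriv a \<longlongrightarrow> (if y < a then 1 - a else - a)) (at_right y)" for a y
    proof (rule tendsto_eventually)
      show "\<forall>\<^sub>F s in at_right y. green_deriv a s = (if y < a then 1 - a else - a)"
        by (rule eventually_at_rightI[of _ "if y < a then a else y + 1"]) (auto simp: green_deriv_def split: if_splits)
    qed
    show "(u' \<longlongrightarrow> (\<Sum>j=1..m. c j * ?l j)) (at_left (x i))"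
      unfolding u'_def by (intro tendsto_sum tendsto_mult tendsto_const left)
    show "(u' \<longlongrightarrow> (\<Sum>j=1..m. c j * ?r j)) (at_right (x i))"
      unfolding u'_def by (intro tendsto_sum tendsto_mult tendsto_const right)
    have "x i = x j \<longleftrightarrow> i = j" if "j \<in> {1..m}" for j
      using node_less[of i j] node_less[of j i] i that by (cases i j rule: linorder_cases) auto
    then have "(\<Sum>j=1..m. c j * ?l j) - (\<Sum>j=1..m. c j * ?r j) = (\<Sum>j=1..m. if j = i then c j else 0)"
      unfolding sum_subtractf[symmetric] by (intro sum.cong) (auto simp: algebra_simps)
    also have "\<dots> = b i * fun_of u (x i)" using i by (simp add: c_def)
    finally show "(\<Sum>j=1..m. c j * ?r j) = (\<Sum>j=1..m. c j * ?l j) - b i * fun_of u (x i)" by linarith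
  qed
  show ?thesis
    unfolding interface_solution_def
    using fun_of_cont deriv deriv2 jump
    by (intro conjI exI[of _ u'] exI[of _ "\<lambda>_. 0"]) (auto simp: fun_of_outside)
qed

text \<open>The Green functions make the Riesz representative explicit: pairing \<open>u\<close>
  with \<open>v\<close> in the form is the inner product of \<open>z\<close> with \<open>v\<close>.
  A vector of the radical thus has \<open>z = 0\<close> and is a sum of Green functions, which
  solves the resonance problem classically without any regularity theory.\<close>

lemma form_nondegenerate:
  assumes b: "b \<notin> resonance_set m x"
    and 0: "\<And>v. u \<bullet> v - (\<Sum>j=1..m. b j * (u \<bullet> green (x j)) * (v \<bullet> green (x j))) = 0"
  shows "u = 0"
proof (rule ccontr)
  assume "u \<noteq> 0"
  define z where "z = u - (\<Sum>j=1..m. (b j * fun_of u (x j)) *\<^sub>R green (x j))"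
  have "z \<bullet> v = 0" for v
  proof -
    have "z \<bullet> v = u \<bullet> v - (\<Sum>j=1..m. b j * fun_of u (x j) * (v \<bullet> green (x j)))"
      by (simp add: z_def inner_diff_left inner_sum_left inner_commute[of "green _" v])
    also have "\<dots> = 0" using 0[of v] by (simp add: inner_green_node)
    finally show ?thesis .
  qed
  then have "z = 0" using inner_eq_zero_iff by blast
  then have "interface_solution m x b (fun_of u)"
    by (intro interface_solution_green_sum) (simp add: z_def)
  moreover have "\<exists>t\<in>{0..1}. fun_of u t \<noteq> 0"
  proof (rule ccontr)
    assume "\<not> (\<exists>t\<in>{0..1}. fun_of u t \<noteq> 0)"
    then have "fun_of u t = fun_of 0 t" for t
      using fun_of_outside[of t u] by (cases "t \<in> {0<..<1}") (auto simp: fun_of_zero)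
    then have "u = 0" by (intro H10_eqI) auto
    with \<open>u \<noteq> 0\<close> show False by simp
  qed
  ultimately show False using b by (auto simp: resonance_set_def)
qed

lemma Phi_quad_eq:
  "Phi_quad m x b u = (u \<bullet> u - (\<Sum>j=1..m. b j * (u \<bullet> green (x j)) * (u \<bullet> green (x j)))) / 2"
proof -
  have "u \<bullet> u = (LINT t|unit_ival. (weak_deriv u t)\<^sup>2)"
    by (simp add: inner_H10_def power2_eq_square)
  moreover have "(\<Sum>j=1..m. b j * (u \<bullet> green (x j)) * (u \<bullet> green (x j))) = (\<Sum>j=1..m. b j * (fun_of u (x j))\<^sup>2)"
    by (intro sum.cong) (auto simp: inner_green_node power2_eq_square)
  ultimately show ?thesis by (simp add: Phi_quad_def)
qed

end

theorem theorem3p3: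
  fixes m :: nat
    and x :: "nat \<Rightarrow> real"
    and f :: "real \<Rightarrow> real \<Rightarrow> real"
    and \<iota> h :: "nat \<Rightarrow> real \<Rightarrow> real"
    and b :: "nat \<Rightarrow> real"
    and U :: "H10 set"
  assumes "m \<ge> 1"
    and "x 0 = 0" and "x (m + 1) = 1" and "strict_mono_on {0..m + 1} x"
    and "caratheodory f"
    and "\<And>j. j \<in> {1..m} \<Longrightarrow> continuous_on UNIV (\<iota> j)"
    and "\<And>u :: H10. integrable unit_ival (\<lambda>t. primitive (f t) (fun_of u t))"
    and "C1_functional (Phi m x f \<iota>)"
    and "\<And>\<epsilon>. \<epsilon> > 0 \<Longrightarrow>
      \<exists>\<delta>>0. AE t in unit_ival. \<forall>s. \<bar>s\<bar> \<le> \<delta> \<longrightarrow> \<bar>f t s\<bar> \<le> \<epsilon> * \<bar>s\<bar>"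
    and "\<And>j s. j \<in> {1..m} \<Longrightarrow> \<iota> j s = b j * s + h j s"
    and "\<And>j \<epsilon>. j \<in> {1..m} \<Longrightarrow> \<epsilon> > 0 \<Longrightarrow>
      \<exists>\<delta>>0. \<forall>s. \<bar>s\<bar> \<le> \<delta> \<longrightarrow> \<bar>h j s\<bar> \<le> \<epsilon> * \<bar>s\<bar>"
    and "b \<notin> resonance_set m x"
    and "0 \<in> interior U"
  shows "(\<forall>q. let C = critical_group TYPE('g::ab_group_add) q (Phi m x f \<iota>) U in
            if q = morse_index (Phi_quad m x b) (piecewise_affine m x)
            then C \<cong> additive_group TYPE('g)
            else trivial_group C)
    \<and> (\<forall>q>m. trivial_group (critical_group TYPE('g) q (Phi m x f \<iota>) U))"
proof -
  note x0 = assms(2) and x1 = assms(3) and mono = assms(4) and carath = assms(5) and cont = assms(6)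
    and int = assms(7) and f0 = assms(9) and \<iota>h = assms(10) and h0 = assms(11) and res = assms(12) and U = assms(13)
  interpret nodes m x by standard (fact x0, fact x1, fact mono)
  define \<beta> where "\<beta> u v = u \<bullet> v - (\<Sum>j=1..m. b j * (u \<bullet> green (x j)) * (v \<bullet> green (x j)))" for u v
  define k where "k = morse_index (Phi_quad m x b) (piecewise_affine m x)"
  have quad: "Phi_quad m x b = (\<lambda>u. \<beta> u u / 2)"
    by (simp add: fun_eq_iff Phi_quad_eq \<beta>_def)
  have \<iota>0: "\<exists>\<delta>>0. \<forall>s. \<bar>s\<bar> \<le> \<delta> \<longrightarrow> \<bar>\<iota> j s - b j * s\<bar> \<le> \<epsilon> * \<bar>s\<bar>"
    if "j \<in> {1..m}" "\<epsilon> > 0" for j \<epsilon>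
    using h0[OF that] \<iota>h[OF that(1)] by simp
  have G: "\<exists>\<delta>>0. \<forall>u v. norm u \<le> \<delta> \<longrightarrow> norm v \<le> \<delta> \<longrightarrow>
      \<bar>Phi_remainder m x b f \<iota> u - Phi_remainder m x b f \<iota> v\<bar> \<le> \<epsilon> * max (norm u) (norm v) * norm (u - v)"
    if "\<epsilon> > 0" for \<epsilon>
    by (rule Phi_remainder_Lipschitz[OF carath cont int f0 \<iota>0 that])
  have G0: "Phi_remainder m x b f \<iota> 0 = 0"
    by (simp add: Phi_remainder_def fun_of_zero)
  have \<Phi>: "Phi m x f \<iota> u = \<beta> u u / 2 + Phi_remainder m x b f \<iota> u" for u
    unfolding Phi_eq[of m x f \<iota> u b] quad ..
  have k: "k = morse_index (\<lambda>u. \<beta> u u / 2) (span ((\<lambda>j. green (x j)) ` {1..m}))"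
    by (simp add: k_def quad piecewise_affine_eq_span)
  have nondeg: "u = 0" if "\<And>v. \<beta> u v = 0" for u
    using that unfolding \<beta>_def by (rule form_nondegenerate[OF res])
  have triv: "trivial_group (critical_group TYPE('g) q (Phi m x f \<iota>) U)" if "q \<noteq> k" for q
    by (rule critical_group_nondegenerate(1)[OF \<beta>_def k finite_atLeastAtMost _ _ G0 \<Phi> U that])
       (fact nondeg, fact G)
  have gen: "critical_group TYPE('g) k (Phi m x f \<iota>) U \<cong> additive_group TYPE('g)"
    by (rule critical_group_nondegenerate(2)[OF \<beta>_def k finite_atLeastAtMost _ _ G0 \<Phi> U])
       (fact nondeg, fact G)
  \<comment> \<open>Negative subspaces lie in the span of \<open>m\<close> Green functions; this
    bound yields the vanishing in all degrees above \<open>m\<close>.\<close>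
  have "k \<le> card {1..m}"
    by (rule critical_group_nondegenerate(3)[OF \<beta>_def k finite_atLeastAtMost _ _ G0 \<Phi> U])
       (fact nondeg, fact G)
  then have "k \<le> m" by simp
  then show ?thesis
    using triv gen by (auto simp: Let_def simp flip: k_def)
qed

end
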